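(* Let $\beta>0$, $\alpha=1+1/\beta$, and $A=\{t_n\}_{n\ge1}$ with $t_n=\lfloor n^\alpha\rfloor$. (i) For any $m>0$, there is a rank one system $(X,\mathcal{B},\mu,T)$ such that $0<h^A(T)<m$. (ii) For any integer $L\ge2$, there is a rank one system $(X,\mathcal{B},\mu,T)$ such that $$C_1\log L\le h^A(T)\le C_2\log L,$$ where $C_1=\frac{\beta}{1+\beta}$ and $C_2=(2\beta)^{\frac1{1+\beta}}$ depend only on $\beta$.
   Context: **Systems.** A measure-preserving system $(X,\mathcal{B},\mu,T)$ consists of a standard probability space and an invertible measure-preserving transformation $T$. Set equalities are modulo null sets. **Sequence entropy.** Let $f(0)=0$ and $f(x)=-x\log x$ for $x>0$. For a finite measurable partition $\xi=\{X_1,\dots,X_m\}$ put $H(\xi)=\sum_{i=1}^m f(\mu(X_i))$. For a strictly increasing sequence $A=\{t_n\}_{n\ge1}$ of non-negative integers put $$h^A(T,\xi)=\limsup_{n\to\infty}\frac1n H\Big(\bigvee_{k=1}^n T^{-t_k}\xi\Big),\qquad h^A(T)=\sup_\xi h^A(T,\xi),$$ the supremum being over all finite measurable partitions $\xi$ of $X$. **Rank one systems.** $(X,\mathcal{B},\mu,T)$ is a rank one system if there are integers $h_1\ge1$, $q_n\ge1$ ($n\ge1$) and $a_{n,i}\ge0$ ($n\ge1$, $1\le i\le q_n-1$) such that, with $a_n=\sum_{i=1}^{q_n-1}a_{n,i}$ and $h_{n+1}=q_nh_n+a_n$, the sequence $h_n$ is strictly increasing and $\sum_{n}a_n/h_{n+1}<\infty$,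 and measurable sets $F_n$ of positive measure such that for all $n\ge 1$: (a) $F_n,TF_n,\dots,T^{h_n-1}F_n$ are pairwise disjoint; their union is the tower $S_n$ with base $F_n$ and height $h_n$; (b) $F_n$ is partitioned into measurable sets $F_{n,1},\dots,F_{n,q_n}$; (c) $T^{h_n+a_{n,i}}F_{n,i}=F_{n,i+1}$ for $1\le i\le q_n-1$ (the sets $T^{h_n+j}F_{n,i}$, $0\le j<a_{n,i}$, are the spacer levels of $S_{n+1}$); (d) $F_{n+1}=F_{n,1}$; (e) the partitions $\xi_n=\{F_n,TF_n,\dots,T^{h_n-1}F_n,X\setminus S_n\}$ form a refining sequence converging to the partition into points (i.e. they generate $\mathcal{B}$ modulo null sets). *)

theory Defs
  imports "HOL-Probability.Probability"
begin

section \<open>Measure-preserving systems\<close>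

text \<open>Standard Borel: the measurable sets are the Borel sets of some Polish topology on the space.\<close>

definition standard_borel_space :: "'a measure \<Rightarrow> bool" where
  "standard_borel_space M \<longleftrightarrow>
     (\<exists>X. completely_metrizable_space X \<and> second_countable X \<and> topspace X = space M \<and>
          sets M = sigma_sets (topspace X) {U. openin X U})"

locale measure_preserving_system = prob_space M
  for M :: "'a measure" and T :: "'a \<Rightarrow> 'a" +
  assumes standard: "standard_borel_space M"
    and bij_T: "bij_betw T (space M) (space M)"
    and measurable_T: "T \<in> measurable M M"
    and measurable_inv_T: "the_inv_into (space M) T \<in> measurable M M"
    and preserving_T: "\<And>A. A \<in> sets M \<Longrightarrow> emeasure M (T -` A \<inter> space M) = emeasure M A"

definition eq_mod_null :: "'a measure \<Rightarrow> 'a set \<Rightarrow> 'a set \<Rightarrow> bool" where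
  "eq_mod_null M A B \<longleftrightarrow> sym_diff A B \<in> null_sets M"

section \<open>Sequence entropy\<close>

text \<open>
  Partitions are taken in the exact sense of \<open>partition_on\<close>, with nonempty cells. A partition
  modulo null sets agrees, up to null sets, with an exact one, and the entropies below do not
  change.
\<close>

definition finite_measurable_partition :: "'a measure \<Rightarrow> 'a set set \<Rightarrow> bool" where
  "finite_measurable_partition M \<xi> \<longleftrightarrow> finite \<xi> \<and> \<xi> \<subseteq> sets M \<and> partition_on (space M) \<xi>"

definition entropy_fun :: "real \<Rightarrow> real" where
  "entropy_fun x = (if x = 0 then 0 else - x * ln x)"

definition partition_entropy :: "'a measure \<Rightarrow> 'a set set \<Rightarrow> real" where
  "partition_entropy M \<xi> = (\<Sum>B\<in>\<xi>. entropy_fun (measure M B))"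

definition preimage_partition :: "'a measure \<Rightarrow> ('a \<Rightarrow> 'a) \<Rightarrow> 'a set set \<Rightarrow> 'a set set" where
  "preimage_partition M S \<xi> = (\<lambda>B. S -` B \<inter> space M) ` \<xi>"

text \<open>
  The sequence \<open>t 1, t 2, \<dots>\<close> is indexed from 1; the value \<open>t 0\<close> is irrelevant. The join of the
  partitions is their \<open>common_refinement\<close>.
\<close>

definition sequence_entropy_partition ::
    "'a measure \<Rightarrow> ('a \<Rightarrow> 'a) \<Rightarrow> (nat \<Rightarrow> nat) \<Rightarrow> 'a set set \<Rightarrow> ereal" where
  "sequence_entropy_partition M T t \<xi> =
     limsup (\<lambda>n. ereal (1 / real n *
       partition_entropy M
         (common_refinement ((\<lambda>k. preimage_partition M (T ^^ t k) \<xi>) ` {1..n}))))"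

definition sequence_entropy :: "'a measure \<Rightarrow> ('a \<Rightarrow> 'a) \<Rightarrow> (nat \<Rightarrow> nat) \<Rightarrow> ereal" where
  "sequence_entropy M T t =
     (SUP \<xi> \<in> {\<xi>. finite_measurable_partition M \<xi>}. sequence_entropy_partition M T t \<xi>)"

section \<open>Rank one systems\<close>

definition tower :: "('a \<Rightarrow> 'a) \<Rightarrow> 'a set \<Rightarrow> nat \<Rightarrow> 'a set" where
  "tower T F h = (\<Union>j<h. (T ^^ j) ` F)"

definition tower_partition :: "'a measure \<Rightarrow> ('a \<Rightarrow> 'a) \<Rightarrow> 'a set \<Rightarrow> nat \<Rightarrow> 'a set set" where
  "tower_partition M T F h = (\<lambda>j. (T ^^ j) ` F) ` {..<h} \<union> {space M - tower T F h}"

text \<open>Heights \<open>h\<close>, cut numbers \<open>q\<close> and spacer numbers \<open>a\<close>; all stages are numbered from 1.\<close>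

definition rank_one_parameters ::
    "(nat \<Rightarrow> nat) \<Rightarrow> (nat \<Rightarrow> nat) \<Rightarrow> (nat \<Rightarrow> nat \<Rightarrow> nat) \<Rightarrow> bool" where
  "rank_one_parameters h q a \<longleftrightarrow>
     h 1 \<ge> 1 \<and> (\<forall>n\<ge>1. q n \<ge> 1) \<and>
     (\<forall>n\<ge>1. h (Suc n) = q n * h n + (\<Sum>i=1..q n - 1. a n i)) \<and>
     strict_mono_on {1..} h \<and>
     (\<lambda>n. real (\<Sum>i=1..q n - 1. a n i) / real (h (Suc n))) summable_on {1..}"

text \<open>
  Here \<open>F n\<close> is the base of the \<open>n\<close>-th tower and \<open>G n i\<close> is the piece of \<open>F n\<close> that becomes the base
  of the \<open>i\<close>-th column. Equality and disjointness are modulo null sets throughout.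
\<close>

definition rank_one_towers ::
    "'a measure \<Rightarrow> ('a \<Rightarrow> 'a) \<Rightarrow> (nat \<Rightarrow> nat) \<Rightarrow> (nat \<Rightarrow> nat) \<Rightarrow> (nat \<Rightarrow> nat \<Rightarrow> nat) \<Rightarrow>
     (nat \<Rightarrow> 'a set) \<Rightarrow> (nat \<Rightarrow> nat \<Rightarrow> 'a set) \<Rightarrow> bool" where
  "rank_one_towers M T h q a F G \<longleftrightarrow>
     (\<forall>n\<ge>1. F n \<in> sets M \<and> emeasure M (F n) > 0) \<and>
     (\<forall>n\<ge>1. \<forall>i<h n. \<forall>j<h n. i \<noteq> j \<longrightarrow> (T ^^ i) ` F n \<inter> (T ^^ j) ` F n \<in> null_sets M) \<and>
     (\<forall>n\<ge>1. (\<forall>i\<in>{1..q n}. G n i \<in> sets M) \<and>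
        (\<forall>i\<in>{1..q n}. \<forall>j\<in>{1..q n}. i \<noteq> j \<longrightarrow> G n i \<inter> G n j \<in> null_sets M) \<and>
        eq_mod_null M (\<Union>i\<in>{1..q n}. G n i) (F n)) \<and>
     (\<forall>n\<ge>1. \<forall>i\<in>{1..q n - 1}. eq_mod_null M ((T ^^ (h n + a n i)) ` G n i) (G n (i + 1))) \<and>
     (\<forall>n\<ge>1. eq_mod_null M (F (Suc n)) (G n 1)) \<and>
     (\<forall>n\<ge>1. \<forall>A\<in>tower_partition M T (F (Suc n)) (h (Suc n)).
        \<exists>B\<in>tower_partition M T (F n) (h n). A - B \<in> null_sets M) \<and>
     (\<forall>B\<in>sets M. \<exists>C\<in>sigma_sets (space M) (\<Union>n\<in>{1..}. tower_partition M T (F n) (h n)).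
        eq_mod_null M B C)"

definition rank_one_system :: "'a measure \<Rightarrow> ('a \<Rightarrow> 'a) \<Rightarrow> bool" where
  "rank_one_system M T \<longleftrightarrow>
     measure_preserving_system M T \<and>
     (\<exists>h q a F G. rank_one_parameters h q a \<and> rank_one_towers M T h q a F G)"

end

theory Submission
  imports Defs "HOL-Real_Asymp.Real_Asymp"
begin

text \<open>
  For every \<open>v > 0\<close> there is a rank one system whose sequence entropy along \<open>t n = \<lfloor>n powr \<alpha>\<rfloor>\<close> is
  exactly \<open>v\<close>; the theorem uses \<open>v = m / 2\<close> and \<open>v = C\<^sub>1 * ln L\<close>.

  Fix a large \<open>S\<close>. A tower of height \<open>h\<close> is cut so that the spacers between its copies, all less than
  \<open>S\<close>, run through every word of length \<open>W = (v / ln S) * N\<close> over \<open>S\<close> letters, each word being repeated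
  many times in a row; here \<open>N = (v * h / ln S) powr \<beta>\<close>, so that an orbit segment of length
  \<open>N powr \<alpha>\<close> crosses about \<open>W\<close> blocks. The number of possible names along an orbit segment of length
  \<open>t\<close> is at most about \<open>h * S ^ (t / h)\<close>. Taking for each \<open>n\<close> the better of the bounds given by two
  consecutive towers yields the upper bound \<open>v\<close>. Conversely, because \<open>S\<close> is large, the gaps of \<open>t\<close> up
  to time \<open>N\<close> are shorter than \<open>h\<close>, so each block is sampled. The position of a point above the
  base of the first tower distinguishes shifts by less than \<open>S\<close>, so the samples reveal every spacer, and
  since a word is repeated, a segment starting anywhere in the word sees all its \<open>W\<close> letters.
  Hence the \<open>N\<close>-th entropy is close to \<open>W * ln S = v * N\<close>.

  The system lives on the real line. Levels are half-open intervals with left end points \<open>e n l\<close>, and \<open>T\<close>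
  is a piecewise translation. Only the point \<open>0\<close> of the union \<open>X\<close> of all towers has no
  preimage in \<open>X\<close>; letting the negative integers flow into \<open>0\<close> makes \<open>T\<close> a bijection of the line.
\<close>

section \<open>Entropy of finite-valued functions\<close>

text \<open>The exact value rests on a coincidence built into the recursion. The number of cuts is
  \<open>S ^ W\<close> up to factors with negligible logarithm, so the logarithm of the next height
  is about \<open>W * ln S = v * N\<close>: locating a point in the next tower costs just as much as
  the samples of the words force. The exponent \<beta> is dictated by \<open>t\<close>. With
  \<open>N powr (1 / \<beta>) = (v / ln S) * h\<close>, the first \<open>N\<close> times reach about
  \<open>N powr \<alpha> = N * (v / ln S) * h\<close>, that is \<open>W\<close> blocks, and the gaps
  of \<open>t\<close> near \<open>N\<close> are about \<open>\<alpha> * (v / ln S) * h\<close>. That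
  they be short compared with \<open>h\<close> is thus a condition on \<open>S\<close> alone, the
  same at every stage. The lower bound needs one partition, fixed for all stages, that tells apart
  points of an orbit fewer than \<open>S\<close> steps apart; a first tower of height
  \<open>2 * S\<close> provides it. The upper bound concerns every finite partition, hence the
  detour through tower partitions with a correction of small entropy. Since every positive value is
  attained exactly, part (ii) reduces to \<open>C\<^sub>1 \<le> C\<^sub>2\<close>.\<close>

definition rv_entropy :: "'a measure \<Rightarrow> ('a \<Rightarrow> 'c) \<Rightarrow> real" where
  "rv_entropy M X = (\<Sum>v\<in>X ` space M. entropy_fun (measure M (X -` {v} \<inter> space M)))"

text \<open>Partitions are traded for functions with finitely many values: a join becomes the
  function that collects the tuple of values.\<close>

definition fibres :: "'a measure \<Rightarrow> ('a \<Rightarrow> 'c) \<Rightarrow> 'a set set" where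
  "fibres M X = (\<lambda>v. X -` {v} \<inter> space M) ` X ` space M"

lemma fibresE:
  assumes "P \<in> fibres M X" obtains v where "P = X -` {v} \<inter> space M"
  using assms unfolding fibres_def by auto

lemma restrict_eq_restrict_iff: "restrict f I = restrict g I \<longleftrightarrow> (\<forall>k\<in>I. f k = g k)"
proof
  assume eq: "restrict f I = restrict g I"
  show "\<forall>k\<in>I. f k = g k"
  proof
    fix k assume "k \<in> I"
    with fun_cong[OF eq, of k] show "f k = g k" by simp
  qed
qed (auto intro: restrict_ext)

lemma partition_entropy_fibres: "partition_entropy M (fibres M X) = rv_entropy M X"
  unfolding partition_entropy_def fibres_def rv_entropy_def
  by (subst sum.reindex) (auto simp: inj_on_def)

context prob_space
begin

text \<open>Base \<open>exp 1\<close> gives natural logarithms, so data processing, the chain rule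
  and the bound by the number of values of positive probability can be taken from
  \<open>information_space\<close>.\<close>

lemma rv_entropy_eq_entropy:
  assumes "simple_function M X"
  shows "rv_entropy M X = entropy (exp 1) (count_space (X ` space M)) X"
proof -
  interpret information_space M "exp 1" by standard simp
  have "simple_distributed M X (\<lambda>x. measure M (X -` {x} \<inter> space M))"
    using assms by (rule simple_distributedI) (auto simp: measure_nonneg)
  from entropy_simple_distributed[OF this] show ?thesis
    by (simp add: rv_entropy_def entropy_fun_def log_def sum_negf [symmetric] if_distrib
        cong: if_cong) (intro sum.cong, auto)
qed

lemma rv_entropy_compose_le:
  assumes "simple_function M X"
  shows "rv_entropy M (\<lambda>x. f (X x)) \<le> rv_entropy M X"
proof -
  interpret information_space M "exp 1" by standard simp
  from entropy_data_processing[OF assms, of f] simple_function_compose[OF assms, of f] assms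
  show ?thesis by (simp add: rv_entropy_eq_entropy comp_def)
qed

lemma rv_entropy_Pair_le:
  assumes X: "simple_function M X" and Y: "simple_function M Y"
  shows "rv_entropy M (\<lambda>x. (X x, Y x)) \<le> rv_entropy M X + rv_entropy M Y"
proof -
  interpret information_space M "exp 1" by standard simp
  from entropy_chain_rule[OF X Y] conditional_entropy_less_eq_entropy[OF Y X]
  show ?thesis by (simp add: rv_entropy_eq_entropy X Y simple_function_Pair)
qed

text \<open>A value of positive probability is taken on every set \<open>A\<close> of full
  probability, and the other values contribute nothing. Names may therefore be counted on
  \<open>X\<close> alone.\<close>

lemma rv_entropy_le_ln_card:
  assumes X: "simple_function M X" and A: "A \<in> events" "prob A = 1" and V: "X ` A \<subseteq> V" "finite V"
  shows "rv_entropy M X \<le> ln (card V)"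
proof -
  interpret information_space M "exp 1" by standard simp
  let ?f = "\<lambda>x. prob (X -` {x} \<inter> space M)"
  have sd: "simple_distributed M X ?f"
    using X by (rule simple_distributedI) (auto simp: measure_nonneg)
  have sub: "X ` space M \<inter> {x. ?f x \<noteq> 0} \<subseteq> V"
  proof safe
    fix x assume x: "x \<in> space M" and nz: "?f (X x) \<noteq> 0"
    have ev: "X -` {X x} \<inter> space M \<in> events" using X x by (auto simp: simple_function_def)
    show "X x \<in> V"
    proof (rule ccontr)
      assume "X x \<notin> V"
      then have "X -` {X x} \<inter> space M \<subseteq> space M - A" using V by auto
      then have "?f (X x) \<le> prob (space M - A)" using A by (intro finite_measure_mono) auto
      also have "\<dots> = 0" using A prob_compl by simp
      finally show False using nz by (simp add: measure_le_0_iff)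
    qed
  qed
  have "X ` space M \<inter> {x. ?f x \<noteq> 0} \<noteq> {}"
  proof
    assume "X ` space M \<inter> {x. ?f x \<noteq> 0} = {}"
    then have "(\<Sum>x\<in>X ` space M. ?f x) = 0" by (intro sum.neutral) auto
    moreover have "(\<Sum>x\<in>X ` space M. ?f x) = 1" using simple_distributed_sum_space[OF sd] .
    ultimately show False by simp
  qed
  then have pos: "card (X ` space M \<inter> {x. ?f x \<noteq> 0}) > 0"
    using X by (subst card_gt_0_iff) (auto simp: simple_function_def)
  have "rv_entropy M X \<le> ln (card (X ` space M \<inter> {x. ?f x \<noteq> 0}))"
    using entropy_le_card_not_0[OF sd] by (simp add: rv_entropy_eq_entropy X log_def)
  also have "\<dots> \<le> ln (card V)" using card_mono[OF V(2) sub] pos by simp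
  finally show ?thesis .
qed

lemma simple_function_restrict_family:
  assumes "finite I" and "\<And>k. k \<in> I \<Longrightarrow> simple_function M (Y k)"
  shows "simple_function M (\<lambda>x. restrict (\<lambda>k. Y k x) I)"
  unfolding simple_function_def
proof (intro conjI ballI)
  show "finite ((\<lambda>x. restrict (\<lambda>k. Y k x) I) ` space M)"
  proof (rule finite_subset)
    show "(\<lambda>x. restrict (\<lambda>k. Y k x) I) ` space M \<subseteq> PiE I (\<lambda>k. Y k ` space M)" by auto
    show "finite (PiE I (\<lambda>k. Y k ` space M))"
      using assms by (intro finite_PiE) (auto simp: simple_function_def)
  qed
  fix v assume "v \<in> (\<lambda>x. restrict (\<lambda>k. Y k x) I) ` space M"
  then obtain y where y: "y \<in> space M" "v = restrict (\<lambda>k. Y k y) I" by auto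
  have "(\<lambda>x. restrict (\<lambda>k. Y k x) I) -` {v} \<inter> space M
      = {x \<in> space M. \<forall>k\<in>I. x \<in> Y k -` {Y k y} \<inter> space M}"
    using y by (auto simp: restrict_eq_restrict_iff)
  also have "\<dots> \<in> events"
  proof (intro sets.sets_Collect_finite_All assms)
    fix k assume k: "k \<in> I"
    have "{x \<in> space M. x \<in> Y k -` {Y k y} \<inter> space M} = Y k -` {Y k y} \<inter> space M" by auto
    with assms(2)[OF k] y show "{x \<in> space M. x \<in> Y k -` {Y k y} \<inter> space M} \<in> events"
      by (simp add: simple_function_def)
  qed
  finally show "(\<lambda>x. restrict (\<lambda>k. Y k x) I) -` {v} \<inter> space M \<in> events" .
qed

lemma rv_entropy_family_le:
  assumes "finite I" and "\<And>k. k \<in> I \<Longrightarrow> simple_function M (Y k)"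
  shows "rv_entropy M (\<lambda>x. restrict (\<lambda>k. Y k x) I) \<le> (\<Sum>k\<in>I. rv_entropy M (Y k))"
  using assms
proof (induction I rule: finite_induct)
  case empty
  have "(\<lambda>x. restrict (\<lambda>k. Y k x) {}) = (\<lambda>x. restrict (\<lambda>k. Y k undefined) {})"
    by (simp add: restrict_def)
  moreover have "rv_entropy M (\<lambda>x. c) \<le> ln (card {c})" for c :: "'b \<Rightarrow> 'c"
    by (rule rv_entropy_le_ln_card[where A = "space M"]) (auto simp: prob_space)
  ultimately show ?case by simp
next
  case (insert i I)
  let ?R = "\<lambda>x. restrict (\<lambda>k. Y k x) I"
  have sR: "simple_function M ?R" using insert by (intro simple_function_restrict_family) auto
  have si: "simple_function M (Y i)" using insert by auto
  let ?g = "\<lambda>(y, r). \<lambda>k\<in>insert i I. if k = i then y else r k"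
  have eq: "(\<lambda>x. restrict (\<lambda>k. Y k x) (insert i I)) = (\<lambda>x. ?g (Y i x, ?R x))"
    using insert.hyps by (auto simp: fun_eq_iff)
  have "rv_entropy M (\<lambda>x. ?g (Y i x, ?R x)) \<le> rv_entropy M (\<lambda>x. (Y i x, ?R x))"
    by (intro rv_entropy_compose_le simple_function_Pair si sR)
  also have "\<dots> \<le> rv_entropy M (Y i) + rv_entropy M ?R" by (intro rv_entropy_Pair_le si sR)
  also have "rv_entropy M ?R \<le> (\<Sum>k\<in>I. rv_entropy M (Y k))"
    by (rule insert.IH) (rule insert.prems, simp)
  finally show ?case using insert.hyps unfolding eq by (simp add: add.commute)
qed

end

text \<open>A cell of the refinement arises from a choice of one cell in each partition, and any
  point of the intersection forces the choice to be the cells of that point. A nonempty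
  \<open>I\<close> keeps the intersection inside the space.\<close>

lemma common_refinement_fibres:
  assumes "I \<noteq> {}"
  shows "common_refinement ((\<lambda>k. fibres M (Y k)) ` I) = fibres M (\<lambda>x. restrict (\<lambda>k. Y k x) I)"
    (is "?L = ?R")
proof
  have cell: "(\<lambda>x. restrict (\<lambda>k. Y k x) I) -` {restrict (\<lambda>k. Y k x) I} \<inter> space M
      = (\<Inter>k\<in>I. Y k -` {Y k x} \<inter> space M)" for x
    using assms by (auto simp: restrict_eq_restrict_iff)
  show "?L \<subseteq> ?R"
  proof
    fix C assume "C \<in> ?L"
    then obtain f where f: "f \<in> (\<Pi> P\<in>(\<lambda>k. fibres M (Y k)) ` I. P)"
      and C': "C = \<Inter> (f ` (\<lambda>k. fibres M (Y k)) ` I)" and ne: "C \<noteq> {}"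
      unfolding common_refinement by blast
    have C: "C = (\<Inter>k\<in>I. f (fibres M (Y k)))" unfolding C' by (simp only: image_image)
    obtain x where x: "x \<in> C" using ne by auto
    have eqk: "f (fibres M (Y k)) = Y k -` {Y k x} \<inter> space M" if "k \<in> I" for k
    proof -
      have "f (fibres M (Y k)) \<in> fibres M (Y k)" using f that by (auto simp: Pi_iff)
      then obtain v where v: "f (fibres M (Y k)) = Y k -` {v} \<inter> space M" by (rule fibresE)
      moreover have "x \<in> f (fibres M (Y k))" using x C that by blast
      ultimately show ?thesis by auto
    qed
    have "x \<in> space M"
    proof -
      obtain k where "k \<in> I" using assms by blast
      with x C have "x \<in> f (fibres M (Y k))" by blast
      with eqk[OF \<open>k \<in> I\<close>] show ?thesis by simp
    qed
    moreover have "C = (\<lambda>x. restrict (\<lambda>k. Y k x) I) -` {restrict (\<lambda>k. Y k x) I} \<inter> space M"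
      unfolding cell C by (intro INF_cong refl) (use eqk in simp)
    ultimately show "C \<in> ?R" unfolding fibres_def by blast
  qed
  show "?R \<subseteq> ?L"
  proof
    fix C assume "C \<in> ?R"
    then obtain x where x: "x \<in> space M"
      and C: "C = (\<lambda>x. restrict (\<lambda>k. Y k x) I) -` {restrict (\<lambda>k. Y k x) I} \<inter> space M"
      unfolding fibres_def by auto
    define f where "f P = (SOME B. B \<in> P \<and> x \<in> B)" for P
    have ex: "f (fibres M (Y k)) \<in> fibres M (Y k) \<and> x \<in> f (fibres M (Y k))" for k
      unfolding f_def by (rule someI[of _ "Y k -` {Y k x} \<inter> space M"]) (use x in \<open>auto simp: fibres_def\<close>)
    have eqk: "f (fibres M (Y k)) = Y k -` {Y k x} \<inter> space M" for k
    proof -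
      obtain v where "f (fibres M (Y k)) = Y k -` {v} \<inter> space M"
        using ex[of k, THEN conjunct1] by (rule fibresE)
      with ex[of k, THEN conjunct2] show ?thesis by auto
    qed
    have "C = \<Inter> (f ` (\<lambda>k. fibres M (Y k)) ` I)"
      unfolding C cell by (simp only: image_image eqk)
    moreover have "x \<in> C" using C x by auto
    moreover have "f \<in> (\<Pi> P\<in>(\<lambda>k. fibres M (Y k)) ` I. P)" using ex by auto
    ultimately show "C \<in> ?L" unfolding common_refinement by (intro DiffI UN_I[of f]) auto
  qed
qed

text \<open>Surjectivity of \<open>S\<close> makes both functions take the same values, so no
  preimage of a cell is empty.\<close>

lemma preimage_partition_fibres:
  assumes "S ` space M = space M"
  shows "preimage_partition M S (fibres M Y) = fibres M (\<lambda>x. Y (S x))"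
proof -
  have "S x \<in> space M" if "x \<in> space M" for x using imageI[OF that, of S] by (simp only: assms)
  then have *: "S -` (Y -` {v} \<inter> space M) \<inter> space M = (\<lambda>x. Y (S x)) -` {v} \<inter> space M" for v
    by auto
  have "(\<lambda>x. Y (S x)) ` space M = Y ` space M"
    by (metis assms image_image)
  then show ?thesis unfolding preimage_partition_def fibres_def
    by (simp only: image_image [of _ _ "Y ` space M"] *)
qed

lemma partition_on_eq_fibres:
  assumes "partition_on (space M) \<xi>"
  shows "\<xi> = fibres M (\<lambda>x. THE B. B \<in> \<xi> \<and> x \<in> B)"
proof -
  let ?Y = "\<lambda>x. THE B. B \<in> \<xi> \<and> x \<in> B"
  have Y: "?Y x = B" if "B \<in> \<xi>" "x \<in> B" for x B
    using that assms by (intro the_equality) (auto simp: partition_on_def disjoint_def)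
  have cell: "?Y -` {B} \<inter> space M = B" if "B \<in> \<xi>" for B
  proof -
    have "B \<subseteq> space M" using that assms by (auto simp: partition_on_def)
    moreover have "x \<in> B" if "x \<in> space M" "?Y x = B" for x
    proof -
      obtain B' where "B' \<in> \<xi>" "x \<in> B'" using assms \<open>x \<in> space M\<close> by (auto simp: partition_on_def)
      with Y that(2) show ?thesis by auto
    qed
    ultimately show ?thesis using Y[OF that] by auto
  qed
  have img: "?Y ` space M = \<xi>"
  proof -
    have "B \<in> ?Y ` space M" if "B \<in> \<xi>" for B
    proof -
      have "B \<noteq> {}" "B \<subseteq> space M" using assms that by (auto simp: partition_on_def)
      then obtain x where "x \<in> B" "x \<in> space M" by auto
      with Y[OF that] show ?thesis by (auto intro!: image_eqI[of _ _ x])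
    qed
    moreover have "?Y x \<in> \<xi>" if x: "x \<in> space M" for x
    proof -
      obtain B where "B \<in> \<xi>" "x \<in> B" using assms x by (auto simp: partition_on_def)
      with Y show ?thesis by auto
    qed
    ultimately show ?thesis by auto
  qed
  show ?thesis unfolding fibres_def img using cell by (auto simp: image_iff)
qed

definition name_entropy ::
    "'a measure \<Rightarrow> ('a \<Rightarrow> 'a) \<Rightarrow> (nat \<Rightarrow> nat) \<Rightarrow> ('a \<Rightarrow> 'c) \<Rightarrow> nat \<Rightarrow> real" where
  "name_entropy M T t Y n = rv_entropy M (\<lambda>x. \<lambda>k\<in>{1..n}. Y ((T ^^ t k) x))"

lemma sequence_entropy_fibres:
  assumes "T ` space M = space M"
  shows "sequence_entropy_partition M T t (fibres M Y)
       = limsup (\<lambda>n. ereal (name_entropy M T t Y n / real n))"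
  unfolding sequence_entropy_partition_def
proof (rule Limsup_eq)
  have Tk: "(T ^^ k) ` space M = space M" for k
  proof (induction k)
    case (Suc k)
    have "(T ^^ Suc k) ` space M = T ` (T ^^ k) ` space M" by (simp only: funpow.simps image_comp)
    then show ?case using Suc assms by simp
  qed simp
  show "\<forall>\<^sub>F n in sequentially.
     ereal (1 / real n * partition_entropy M (common_refinement
       ((\<lambda>k. preimage_partition M (T ^^ t k) (fibres M Y)) ` {1..n})))
     = ereal (name_entropy M T t Y n / real n)"
    \<comment> \<open>For \<open>n = 0\<close> the join would be over no partitions; the limsup
      ignores this term.\<close>
    using eventually_gt_at_top[of 0]
  proof eventually_elim
    case (elim n)
    then have "{1..n} \<noteq> {}" by auto
    then show ?case
      by (simp add: preimage_partition_fibres[OF Tk] common_refinement_fibres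
          partition_entropy_fibres name_entropy_def)
  qed
qed

section \<open>Cutting and stacking\<close>

text \<open>Stages are numbered from 0 here. No spacers are put above the last copy, so the top
  level of every tower has its right end at \<open>h 0\<close>. The initial height
  \<open>2 * S\<close> is what lets the first tower distinguish shifts by less than
  \<open>S\<close>.\<close>

locale cutting_stacking =
  fixes S :: nat and h q :: "nat \<Rightarrow> nat" and a :: "nat \<Rightarrow> nat \<Rightarrow> nat"
  assumes S_pos: "S \<ge> 1" and h_0: "h 0 = 2 * S" and q_ge_2: "q n \<ge> 2"
    and a_less: "a n i < S"
    and h_Suc: "h (Suc n) = (\<Sum>j<q n - 1. h n + a n j) + h n"
begin

section \<open>Levels as intervals and their refinement from stage to stage\<close>

definition w :: "nat \<Rightarrow> real" where "w n = 1 / (\<Prod>k<n. real (q k))"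

definition start :: "nat \<Rightarrow> nat \<Rightarrow> nat" where "start n i = (\<Sum>j<i. h n + a n j)"

definition copy :: "nat \<Rightarrow> nat \<Rightarrow> nat" where "copy n L = Max {i. i < q n \<and> start n i \<le> L}"

text \<open>
  \<open>e n l\<close> is the left end point of level \<open>l\<close> of the \<open>n\<close>-th tower. It is also defined for \<open>l \<ge> h n\<close>:
  the intervals beyond the top are the places where spacers can be put.
\<close>

primrec e :: "nat \<Rightarrow> nat \<Rightarrow> real" where
  "e 0 = real"
| "e (Suc n) = (\<lambda>L. real (copy n L) * w (Suc n) + e n (L - start n (copy n L)))"

definition lev :: "nat \<Rightarrow> nat \<Rightarrow> real set" where "lev n l = {e n l..<e n l + w n}"

definition X :: "real set" where "X = (\<Union>n. \<Union>l<h n. lev n l)"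

text \<open>The last copy has no upper limit: intervals beyond the top of the new tower count as
  continuing its last copy, in accordance with \<open>copy\<close>.\<close>

definition in_copy :: "nat \<Rightarrow> nat \<Rightarrow> nat \<Rightarrow> bool" where
  "in_copy n i l \<longleftrightarrow> i < q n \<and> (i < q n - 1 \<longrightarrow> l < h n + a n i)"

lemma q_pos: "q n > 0" using q_ge_2[of n] by simp

lemma h_pos: "h n > 0"
  by (induction n) (use S_pos in \<open>auto simp: h_0 h_Suc\<close>)

lemma w_0 [simp]: "w 0 = 1" by (simp add: w_def)

lemma w_Suc: "w n = real (q n) * w (Suc n)"
  using q_pos[of n] by (simp add: w_def field_simps)

lemma w_pos: "w n > 0"
  by (simp add: w_def q_pos prod_pos)

lemma w_Suc_le: "w (Suc n) \<le> w n / 2"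
  using q_ge_2[of n] w_pos[of "Suc n"] by (simp add: w_Suc[of n] mult_right_mono)

lemma w_le: "w n \<le> (1 / 2) ^ n"
proof (induction n)
  case (Suc n) then show ?case using w_Suc_le[of n] by simp
qed simp

lemma w_antimono: "m \<le> n \<Longrightarrow> w n \<le> w m"
proof (rule lift_Suc_antimono_le)
  show "w (Suc n) \<le> w n" for n using w_Suc_le[of n] w_pos[of n] by simp
qed

lemma w_tendsto_0: "w \<longlonglongrightarrow> 0"
proof (rule tendsto_sandwich[of "\<lambda>_. 0" _ _ "\<lambda>n. (1 / 2) ^ n"])
  show "(\<lambda>n. (1 / 2 :: real) ^ n) \<longlonglongrightarrow> 0" by (intro LIMSEQ_power_zero) simp
qed (auto simp: w_le less_imp_le[OF w_pos])

lemma start_0 [simp]: "start n 0 = 0" by (simp add: start_def)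

lemma start_Suc: "start n (Suc i) = start n i + h n + a n i" by (simp add: start_def)

lemma start_mono: "i \<le> j \<Longrightarrow> start n i \<le> start n j"
  unfolding start_def by (intro sum_mono2) auto

lemma h_Suc_start: "h (Suc n) = start n (q n - 1) + h n"
  by (simp add: h_Suc start_def)

lemma start_less_h: assumes "i < q n" "l < h n" shows "start n i + l < h (Suc n)"
proof -
  have "start n i \<le> start n (q n - 1)" using assms(1) by (intro start_mono) simp
  then show ?thesis using assms(2) by (simp add: h_Suc_start)
qed

lemma in_copyI: "i < q n \<Longrightarrow> l < h n \<Longrightarrow> in_copy n i l"
  by (auto simp: in_copy_def)

lemma copy_start: assumes "in_copy n i l" shows "copy n (start n i + l) = i"
  unfolding copy_def
proof (rule Max_eqI)
  fix j assume "j \<in> {j. j < q n \<and> start n j \<le> start n i + l}"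
  then have j: "j < q n" "start n j \<le> start n i + l" by auto
  show "j \<le> i"
  proof (rule ccontr)
    assume "\<not> j \<le> i"
    then have "start n (Suc i) \<le> start n j" and "i < q n - 1" using j by (auto intro!: start_mono)
    then show False using assms j by (auto simp: in_copy_def start_Suc)
  qed
qed (use assms in \<open>auto simp: in_copy_def\<close>)

lemma level_decomp:
  obtains i l where "L = start n i + l" "in_copy n i l" "L < h (Suc n) \<Longrightarrow> l < h n \<or> i < q n - 1 \<and> l < h n + a n i"
proof -
  let ?A = "{i. i < q n \<and> start n i \<le> L}"
  have A: "finite ?A" "?A \<noteq> {}" using q_pos[of n] by (auto intro!: exI[of _ 0])
  from Max_in[OF this] have c: "copy n L < q n" "start n (copy n L) \<le> L" by (auto simp: copy_def)
  have *: "L < start n (Suc (copy n L))" if "copy n L < q n - 1"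
  proof (rule ccontr)
    assume "\<not> ?thesis"
    then have "Suc (copy n L) \<in> ?A" using that by auto
    from Max_ge[OF A(1) this] show False by (simp add: copy_def)
  qed
  have ic: "in_copy n (copy n L) (L - start n (copy n L))"
    using c * by (auto simp: in_copy_def start_Suc)
  show ?thesis
  proof (rule that[of "copy n L" "L - start n (copy n L)"])
    assume L: "L < h (Suc n)"
    show "L - start n (copy n L) < h n \<or>
      copy n L < q n - 1 \<and> L - start n (copy n L) < h n + a n (copy n L)"
    proof (cases "copy n L < q n - 1")
      case False
      then have "copy n L = q n - 1" using c by simp
      with L c show ?thesis by (simp add: h_Suc_start)
    qed (use ic in \<open>auto simp: in_copy_def\<close>)
  qed (use c ic in auto)
qed

lemma e_Suc_start:
  assumes "in_copy n i l" shows "e (Suc n) (start n i + l) = real i * w (Suc n) + e n l"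
  using copy_start[OF assms] by simp

declare e.simps(2) [simp del]

lemma lev_Suc:
  assumes "in_copy n i l"
  shows "lev (Suc n) (start n i + l) = {e n l + real i * w (Suc n)..<e n l + real (Suc i) * w (Suc n)}"
  using e_Suc_start[OF assms] by (simp add: lev_def algebra_simps)

lemma lev_Suc_subset:
  assumes "in_copy n i l" shows "lev (Suc n) (start n i + l) \<subseteq> lev n l"
proof -
  have "real (Suc i) * w (Suc n) \<le> w n"
    using assms w_pos[of "Suc n"] unfolding w_Suc[of n] in_copy_def
    by (intro mult_right_mono) auto
  moreover have "0 \<le> real i * w (Suc n)" using w_pos[of "Suc n"] by simp
  ultimately show ?thesis unfolding lev_Suc[OF assms] by (auto simp: lev_def)
qed

text \<open>A level of the next stage is the \<open>i\<close>-th of \<open>q n\<close> equal pieces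
  of an interval of this stage; a point determines the interval by induction and then
  \<open>i\<close>. Intervals beyond the top are included, so spacers never collide with the
  tower.\<close>

lemma lev_unique: "x \<in> lev n l \<Longrightarrow> x \<in> lev n l' \<Longrightarrow> l = l'"
proof (induction n arbitrary: l l')
  case 0
  then show ?case by (auto simp: lev_def)
next
  case (Suc n)
  obtain i k where ik: "l = start n i + k" "in_copy n i k" using level_decomp by metis
  obtain i' k' where ik': "l' = start n i' + k'" "in_copy n i' k'" using level_decomp by metis
  have "k = k'" using Suc.IH Suc.prems lev_Suc_subset ik ik' by blast
  moreover have "i = i'"
  proof -
    have x: "x - e n k \<in> {real i * w (Suc n)..<real (Suc i) * w (Suc n)}"
      "x - e n k \<in> {real i' * w (Suc n)..<real (Suc i') * w (Suc n)}"
      using Suc.prems \<open>k = k'\<close> unfolding ik(1) ik'(1) lev_Suc[OF ik(2)] lev_Suc[OF ik'(2)] by auto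
    have "real i * w (Suc n) < real (Suc i') * w (Suc n)" "real i' * w (Suc n) < real (Suc i) * w (Suc n)"
      using x by auto
    then show ?thesis using w_pos[of "Suc n"] by (simp add: mult_less_cancel_right_disj)
  qed
  ultimately show ?case using ik ik' by simp
qed

lemma lev_disjoint: "l \<noteq> l' \<Longrightarrow> lev n l \<inter> lev n l' = {}"
  using lev_unique by blast

lemma lev_split:
  assumes "x \<in> lev n l" "l < h n" obtains i where "i < q n" "x \<in> lev (Suc n) (start n i + l)"
proof -
  define i where "i = nat \<lfloor>(x - e n l) / w (Suc n)\<rfloor>"
  have nn: "0 \<le> (x - e n l) / w (Suc n)" using assms w_pos[of "Suc n"] by (auto simp: lev_def)
  have lt: "(x - e n l) / w (Suc n) < real (q n)"
    using assms w_pos[of "Suc n"] by (auto simp: lev_def w_Suc[of n] field_simps)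
  have i: "real i \<le> (x - e n l) / w (Suc n)" "(x - e n l) / w (Suc n) < real (Suc i)"
    using nn unfolding i_def by (auto, linarith+)
  then have iq: "i < q n" using lt by linarith
  have "x \<in> lev (Suc n) (start n i + l)"
    unfolding lev_Suc[OF in_copyI[OF iq assms(2)]] using i w_pos[of "Suc n"] by (auto simp: field_simps)
  with iq that show ?thesis by blast
qed

text \<open>The interval \<open>h n - 1 + d\<close> is continued by the last copy, that is by its
  own rightmost piece. Its right end point stays at \<open>h 0 + d\<close> while its width tends to
  0.\<close>

lemma e_top: "e n (h n - 1 + d) = real (h 0) - w n + real d"
proof (induction n arbitrary: d)
  case 0
  then show ?case using h_pos[of 0] by (auto simp: of_nat_diff)
next
  case (Suc n)
  have ic: "in_copy n (q n - 1) (h n - 1 + d)" using q_pos[of n] by (auto simp: in_copy_def)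
  have "h (Suc n) - 1 + d = start n (q n - 1) + (h n - 1 + d)" using h_pos[of n] by (simp add: h_Suc_start)
  then have "e (Suc n) (h (Suc n) - 1 + d) = real (q n - 1) * w (Suc n) + (real (h 0) - w n + real d)"
    using e_Suc_start[OF ic] Suc by (simp only:)
  then show ?case using q_pos[of n] by (simp add: w_Suc[of n] of_nat_diff algebra_simps)
qed

lemma lev_top: "lev n (h n - 1) = {real (h 0) - w n..<real (h 0)}"
  using e_top[of n 0] by (simp add: lev_def)

lemma lev_spacer: "lev n (h n + d) = {real (h 0) + real d + 1 - w n..<real (h 0) + real d + 1}"
proof -
  have "h n - 1 + Suc d = h n + d" using h_pos[of n] by simp
  with e_top[of n "Suc d"] have "e n (h n + d) = real (h 0) + real d + 1 - w n" by simp
  then show ?thesis by (simp add: lev_def)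
qed

lemma e_bottom: "e n 0 = 0"
proof (induction n)
  case (Suc n)
  have "in_copy n 0 0" using h_pos[of n] q_pos[of n] by (intro in_copyI) auto
  from e_Suc_start[OF this] Suc show ?case by simp
qed simp

lemma lev_bottom: "lev n 0 = {0..<w n}" by (simp add: lev_def e_bottom)

text \<open>Cutting keeps columns together: the levels above \<open>x\<close> reappear in every
  later tower with the same translations between them. Questions about two towers can thus be moved
  to a common one.\<close>

lemma lev_lift:
  assumes "x \<in> lev n l" "l < h n" "n \<le> m"
  obtains l' where "l' < h m" "x \<in> lev m l'"
    "\<And>d. l + d < h n \<Longrightarrow> l' + d < h m \<and> e m (l' + d) - e m l' = e n (l + d) - e n l \<and> lev m (l' + d) \<subseteq> lev n (l + d)"
proof -
  have "\<exists>l'. l' < h m \<and> x \<in> lev m l' \<and> (\<forall>d. l + d < h n \<longrightarrow> l' + d < h m \<and>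
      e m (l' + d) - e m l' = e n (l + d) - e n l \<and> lev m (l' + d) \<subseteq> lev n (l + d))"
    using assms(3)
  proof (induction m rule: dec_induct)
    case base
    show ?case using assms by (intro exI[of _ l]) auto
  next
    case (step m)
    then obtain l' where l': "l' < h m" "x \<in> lev m l'"
      "\<And>d. l + d < h n \<Longrightarrow> l' + d < h m \<and> e m (l' + d) - e m l' = e n (l + d) - e n l \<and> lev m (l' + d) \<subseteq> lev n (l + d)"
      by blast
    obtain i where i: "i < q m" "x \<in> lev (Suc m) (start m i + l')" using lev_split[OF l'(2,1)] .
    show ?case
    proof (intro exI[of _ "start m i + l'"] conjI allI impI)
      show "start m i + l' < h (Suc m)" using i l' by (intro start_less_h)
      show "x \<in> lev (Suc m) (start m i + l')" by fact
      fix d assume d: "l + d < h n"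
      note ic = in_copyI[OF i(1), of "l' + d"] in_copyI[OF i(1) l'(1)]
      show "start m i + l' + d < h (Suc m)"
        using start_less_h[OF i(1), of "l' + d"] l'(3)[OF d] by simp
      show "e (Suc m) (start m i + l' + d) - e (Suc m) (start m i + l') = e n (l + d) - e n l"
        using e_Suc_start[OF ic(1)] e_Suc_start[OF ic(2)] l'(3)[OF d] by (simp add: add.assoc)
      show "lev (Suc m) (start m i + l' + d) \<subseteq> lev n (l + d)"
        using lev_Suc_subset[OF ic(1)] l'(3)[OF d] by (auto simp: add.assoc)
    qed
  qed
  then show ?thesis using that by blast
qed

lemma in_X_lift:
  assumes "x \<in> X" obtains n l where "n \<ge> N" "l < h n" "x \<in> lev n l"
proof -
  obtain n l where "l < h n" "x \<in> lev n l" using assms by (auto simp: X_def)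
  with lev_lift[of x n l "max n N"] that[of "max n N"] show ?thesis by (metis max.cobounded1 max.cobounded2)
qed

section \<open>The transformation on the union of the towers\<close>

definition T :: "real \<Rightarrow> real" where
  "T x = (if \<exists>n l. l + 1 < h n \<and> x \<in> lev n l
          then x + (THE z. \<exists>n l. l + 1 < h n \<and> x \<in> lev n l \<and> z = e n (l + 1) - e n l)
          else if \<exists>k. x = - real (Suc k) then x + 1 else x)"

text \<open>Two towers that contain \<open>x\<close> below their tops prescribe the same
  translation, as is seen in a later tower; this justifies the definite description in
  \<open>T\<close>.\<close>

lemma T_lev:
  assumes "l + 1 < h n" "x \<in> lev n l" shows "T x = x + (e n (l + 1) - e n l)"
proof -
  have "(THE z. \<exists>n l. l + 1 < h n \<and> x \<in> lev n l \<and> z = e n (l + 1) - e n l) = e n (l + 1) - e n l"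
  proof (rule the_equality)
    fix z assume "\<exists>n l. l + 1 < h n \<and> x \<in> lev n l \<and> z = e n (l + 1) - e n l"
    then obtain n' l' where l': "l' + 1 < h n'" "x \<in> lev n' l'" "z = e n' (l' + 1) - e n' l'" by blast
    define m where "m = max n n'"
    obtain k where k: "x \<in> lev m k" "e m (k + 1) - e m k = e n (l + 1) - e n l"
      using lev_lift[of x n l m] assms by (metis add_lessD1 m_def max.cobounded1)
    obtain k' where k': "x \<in> lev m k'" "e m (k' + 1) - e m k' = e n' (l' + 1) - e n' l'"
      using lev_lift[of x n' l' m] l' by (metis add_lessD1 m_def max.cobounded2)
    show "z = e n (l + 1) - e n l" using lev_unique[OF k(1) k'(1)] k k' l' by simp
  qed (use assms in blast)
  moreover have "\<exists>n l. l + 1 < h n \<and> x \<in> lev n l" using assms by blast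
  ultimately show ?thesis unfolding T_def by simp
qed

lemma T_in_lev: assumes "l + 1 < h n" "x \<in> lev n l" shows "T x \<in> lev n (l + 1)"
  using T_lev[OF assms] assms(2) by (auto simp: lev_def)

lemma T_pow_lev:
  assumes "l + k < h n" "x \<in> lev n l"
  shows "(T ^^ k) x = x + (e n (l + k) - e n l) \<and> (T ^^ k) x \<in> lev n (l + k)"
  using assms(1)
proof (induction k)
  case 0
  then show ?case using assms by simp
next
  case (Suc k)
  then have IH: "(T ^^ k) x = x + (e n (l + k) - e n l)" "(T ^^ k) x \<in> lev n (l + k)" by auto
  have "l + k + 1 < h n" using Suc.prems by simp
  from T_lev[OF this IH(2)] T_in_lev[OF this IH(2)] show ?case using IH(1) by simp
qed

lemma T_pow_image_lev:
  assumes "l + k < h n" shows "(T ^^ k) ` lev n l = lev n (l + k)"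
proof
  show "(T ^^ k) ` lev n l \<subseteq> lev n (l + k)" using T_pow_lev[OF assms] by blast
  show "lev n (l + k) \<subseteq> (T ^^ k) ` lev n l"
  proof
    fix y assume y: "y \<in> lev n (l + k)"
    define x where "x = y - (e n (l + k) - e n l)"
    have "x \<in> lev n l" using y by (auto simp: x_def lev_def)
    moreover from T_pow_lev[OF assms this] have "(T ^^ k) x = y" by (simp add: x_def)
    ultimately show "y \<in> (T ^^ k) ` lev n l" by blast
  qed
qed

text \<open>The top levels are \<open>[h 0 - w n, h 0)\<close>. A point of \<open>X\<close> in one
  of them is strictly below \<open>h 0\<close>, so it has left the top once the width is
  small.\<close>

lemma X_not_top:
  assumes "x \<in> X" obtains n l where "n \<ge> N" "l + 1 < h n" "x \<in> lev n l"
proof -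
  obtain n l where nl: "n \<ge> N" "l < h n" "x \<in> lev n l" using in_X_lift[OF assms] .
  show ?thesis
  proof (cases "l + 1 < h n")
    case True with nl that show ?thesis by blast
  next
    case False
    then have "l = h n - 1" using nl by simp
    then have x: "x < real (h 0)" using nl lev_top by simp
    have "\<forall>\<^sub>F m in sequentially. w m < real (h 0) - x"
      using x by (intro order_tendstoD(2)[OF w_tendsto_0]) simp
    then obtain m0 where m0: "\<And>m. m \<ge> m0 \<Longrightarrow> w m < real (h 0) - x" by (auto simp: eventually_sequentially)
    obtain m l' where m: "m \<ge> max m0 N" "l' < h m" "x \<in> lev m l'" using in_X_lift[OF assms] .
    have "l' \<noteq> h m - 1" using m m0[of m] lev_top[of m] by auto
    then have "l' + 1 < h m" using m by simp
    with m that show ?thesis by auto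
  qed
qed

lemma lev_subset_X: "l < h n \<Longrightarrow> lev n l \<subseteq> X" by (auto simp: X_def)

lemma T_in_X: assumes "x \<in> X" shows "T x \<in> X"
proof -
  obtain n l where "l + 1 < h n" "x \<in> lev n l" using X_not_top[OF assms] .
  with T_in_lev lev_subset_X show ?thesis by blast
qed

lemma T_pow_in_X: "x \<in> X \<Longrightarrow> (T ^^ k) x \<in> X"
  by (induction k) (auto intro: T_in_X)

lemma X_lift_time:
  assumes "x \<in> X" obtains n l where "n \<ge> N" "l + t < h n" "x \<in> lev n l"
proof -
  have "\<exists>n l. n \<ge> N \<and> l + t < h n \<and> x \<in> lev n l"
  proof (induction t)
    case 0
    then show ?case using in_X_lift[OF assms] by (metis add.right_neutral)
  next
    case (Suc t)
    then obtain n l where nl: "n \<ge> N" "l + t < h n" "x \<in> lev n l" by blast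
    obtain m k where mk: "m \<ge> n" "k + 1 < h m" "(T ^^ t) x \<in> lev m k"
      using X_not_top[OF T_pow_in_X[OF assms]] .
    obtain l' where l': "x \<in> lev m l'" "l' + t < h m"
      using lev_lift[OF nl(3) _ mk(1)] nl(2) by (metis add_lessD1)
    have "(T ^^ t) x \<in> lev m (l' + t)" using T_pow_lev[OF l'(2,1)] by blast
    from lev_unique[OF this mk(3)] mk l' nl show ?case by (intro exI[of _ m] exI[of _ l']) auto
  qed
  then show ?thesis using that by blast
qed

text \<open>Each gap receives fewer than \<open>S\<close> spacers, so everything added stays in the
  \<open>S\<close> unit intervals after the first tower, and the total measure is finite. Intervals
  not yet used are included to make the induction work.\<close>

lemma lev_bounds: "l < h n + S \<Longrightarrow> lev n l \<subseteq> {0..<real (h 0 + S)}"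
proof (induction n arbitrary: l)
  case 0
  then show ?case by (auto simp: lev_def)
next
  case (Suc n)
  show ?case
  proof (cases "l < h (Suc n)")
    case True
    obtain i k where ik: "l = start n i + k" "in_copy n i k" "k < h n \<or> i < q n - 1 \<and> k < h n + a n i"
      using level_decomp[of l n] True by metis
    then have "k < h n + S" using a_less[of n i] by auto
    from Suc.IH[OF this] lev_Suc_subset[OF ik(2)] ik(1) show ?thesis by auto
  next
    case False
    define d where "d = l - h (Suc n)"
    have l: "l = h (Suc n) + d" "d < S" using False Suc.prems by (auto simp: d_def)
    have "w (Suc n) \<le> 1" using w_antimono[of 0 "Suc n"] by simp
    with l show ?thesis unfolding l(1) lev_spacer by auto
  qed
qed

lemma X_bounds: "X \<subseteq> {0..<real (h 0 + S)}"
  unfolding X_def using lev_bounds by (meson UN_least trans_less_add1 lessThan_iff)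

end

section \<open>The rank one system\<close>

lemma standard_borel_space_real:
  assumes "space M = (UNIV :: real set)" "sets M = sets borel" shows "standard_borel_space M"
proof -
  obtain B :: "real set set" where B: "countable B" "topological_basis B" using ex_countable_basis by blast
  have "second_countable (euclidean :: real topology)"
    unfolding second_countable_def
  proof (intro exI[of _ B] conjI allI impI)
    show "countable B" by fact
    show "\<forall>V\<in>B. openin euclidean V" using topological_basis_open[OF B(2)] by simp
    fix U :: "real set" and x assume "openin euclidean U \<and> x \<in> U"
    then show "\<exists>V\<in>B. x \<in> V \<and> V \<subseteq> U" using topological_basisE[OF B(2), of U x] by (metis open_openin)
  qed
  then show ?thesis unfolding standard_borel_space_def
    using assms completely_metrizable_space_euclidean
    by (intro exI[of _ "euclidean :: real topology"]) (simp add: borel_def)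
qed

context cutting_stacking
begin

section \<open>Extension to a bijection of the line\<close>

definition neg :: "real set" where "neg = range (\<lambda>k. - real (Suc k))"

text \<open>The space is the whole line, with the complement of \<open>X\<close> a null set: it is
  standard Borel as the real line is, and there is room to complete \<open>T\<close> to a
  bijection.\<close>

definition M :: "real measure" where "M = uniform_measure lborel X"

lemma T_neg: assumes "x \<in> neg" shows "T x = x + 1"
proof -
  have "x \<notin> X" using assms X_bounds by (auto simp: neg_def)
  then have "\<not> (\<exists>n l. l + 1 < h n \<and> x \<in> lev n l)" using lev_subset_X by (meson add_lessD1 subsetD)
  with assms show ?thesis unfolding T_def neg_def by auto
qed

lemma T_other: assumes "x \<notin> X" "x \<notin> neg" shows "T x = x"
proof -
  have "\<not> (\<exists>n l. l + 1 < h n \<and> x \<in> lev n l)" using assms lev_subset_X by (meson add_lessD1 subsetD)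
  with assms show ?thesis unfolding T_def neg_def by auto
qed

lemma zero_in_X: "0 \<in> X"
  using lev_bottom[of 0] lev_subset_X[OF h_pos[of 0]] by auto

lemma neg_X: "neg \<inter> X = {}" using X_bounds by (auto simp: neg_def)

lemma T_X_nonzero: assumes "x \<in> X" shows "T x \<noteq> 0"
proof
  assume "T x = 0"
  obtain n l where nl: "l + 1 < h n" "x \<in> lev n l" using X_not_top[OF assms] .
  have "0 \<in> lev n (l + 1)" using T_in_lev[OF nl] \<open>T x = 0\<close> by simp
  moreover have "0 \<in> lev n 0" using w_pos[of n] by (simp add: lev_bottom)
  ultimately show False using lev_unique by fastforce
qed

lemma T_neg_cases: assumes "x \<in> neg" shows "T x = 0 \<or> T x \<in> neg"
proof -
  obtain k where k: "x = - real (Suc k)" using assms by (auto simp: neg_def)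
  show ?thesis
  proof (cases k)
    case 0 then show ?thesis using k T_neg[OF assms] by simp
  next
    case (Suc j) then have "T x = - real (Suc j)" using k T_neg[OF assms] by simp
    then show ?thesis by (auto simp: neg_def)
  qed
qed

text \<open>Images are kept apart by region: \<open>X\<close> goes into \<open>X\<close> without 0,
  because 0 is in the bottom level of every tower; negative integers go to negative integers or to
  0; all other points are fixed. Two points of \<open>X\<close> are compared in a tower that has
  both below its top.\<close>

lemma T_inj: "inj T"
proof (rule injI)
  fix x y assume eq: "T x = T y"
  have XX: "x = y" if xy: "x \<in> X" "y \<in> X" "T x = T y" for x y
  proof -
    obtain n l where nl: "l + 1 < h n" "x \<in> lev n l" using X_not_top[OF xy(1)] .
    obtain m k where mk: "m \<ge> n" "k + 1 < h m" "y \<in> lev m k" using X_not_top[OF xy(2)] .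
    obtain l' where l': "x \<in> lev m l'" "l' + 1 < h m"
      using lev_lift[OF nl(2) _ mk(1)] nl(1) by (metis add_lessD1)
    have "l' + 1 = k + 1"
      using lev_unique[of "T x" m] T_in_lev[OF l'(2,1)] T_in_lev[OF mk(2,3)] xy(3) by metis
    with T_lev[OF l'(2,1)] T_lev[OF mk(2,3)] xy(3) show ?thesis by simp
  qed
  have Xneg: False if "x \<in> X" "y \<notin> X" "T x = T y" for x y
  proof (cases "y \<in> neg")
    case True
    then show False using T_neg_cases[OF True] T_X_nonzero[OF that(1)] T_in_X[OF that(1)] neg_X that(3) by auto
  next
    case False
    then show False using T_other[OF that(2) False] T_in_X[OF that(1)] that by simp
  qed
  have negother: False if "x \<in> neg" "y \<notin> X" "y \<notin> neg" "T x = T y" for x y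
    using T_neg_cases[OF that(1)] T_other[OF that(2,3)] that zero_in_X by auto
  consider "x \<in> X" "y \<in> X" | "x \<in> X" "y \<notin> X" | "x \<notin> X" "y \<in> X" | "x \<in> neg" "y \<in> neg"
    | "x \<in> neg" "y \<notin> X" "y \<notin> neg" | "y \<in> neg" "x \<notin> X" "x \<notin> neg"
    | "x \<notin> X" "x \<notin> neg" "y \<notin> X" "y \<notin> neg" by blast
  then show "x = y"
  proof cases
    case 4 then show ?thesis using T_neg eq by simp
  next
    case 7 then show ?thesis using T_other eq by simp
  qed (use XX Xneg negother eq in \<open>metis+\<close>)
qed

text \<open>A point \<open>y > 0\<close> of \<open>X\<close> lies above the bottom level
  \<open>[0, w n)\<close> of a tower with \<open>w n < y\<close>, hence comes from the level below
  it.\<close>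

lemma T_surj: "surj T"
proof -
  have "\<exists>x. y = T x" for y
  proof (cases "y \<in> X")
    case True
    show ?thesis
    proof (cases "y = 0")
      case True
      have "- 1 \<in> neg" by (auto simp: neg_def intro!: image_eqI[of _ _ 0])
      from T_neg[OF this] True show ?thesis by (intro exI[of _ "-1"]) simp
    next
      case False
      then have "y > 0" using True X_bounds by auto
      then have "\<forall>\<^sub>F n in sequentially. w n < y" by (intro order_tendstoD(2)[OF w_tendsto_0])
      then obtain N where N: "\<And>n. n \<ge> N \<Longrightarrow> w n < y" by (auto simp: eventually_sequentially)
      obtain n l where nl: "n \<ge> N" "l < h n" "y \<in> lev n l" using in_X_lift[OF True] .
      have "l \<noteq> 0" using nl(3) N[OF nl(1)] by (intro notI) (simp add: lev_bottom)
      then obtain l' where l': "l = l' + 1" by (metis add.commute not0_implies_Suc plus_1_eq_Suc)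
      have "y \<in> (T ^^ 1) ` lev n l'" using T_pow_image_lev[of l' 1 n] nl l' by simp
      then show ?thesis by auto
    qed
  next
    case False
    show ?thesis
    proof (cases "y \<in> neg")
      case True
      then obtain k where k: "y = - real (Suc k)" by (auto simp: neg_def)
      have "- real (Suc (Suc k)) \<in> neg" unfolding neg_def by (rule rangeI)
      from T_neg[OF this] k show ?thesis by (intro exI[of _ "- real (Suc (Suc k))"]) simp
    next
      case 2: False
      from T_other[OF False 2] show ?thesis by metis
    qed
  qed
  then show ?thesis by (auto simp: surj_def)
qed

lemma bij_T: "bij T" using T_inj T_surj by (simp add: bij_def)

section \<open>Measurability and invariance of the measure\<close>

lemma lev_borel [measurable]: "lev n l \<in> sets borel" by (simp add: lev_def)

lemma X_borel [measurable]: "X \<in> sets borel" unfolding X_def by measurable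

lemma countable_neg: "countable neg" by (simp add: neg_def)

lemma subset_neg_borel: "B \<subseteq> neg \<Longrightarrow> B \<in> sets borel"
  by (rule sets.countable) (auto intro: countable_subset[OF _ countable_neg])

lemma X_eq_union: "X = (\<Union>n. \<Union>l\<in>{l. l + 1 < h n}. lev n l)"
proof
  show "X \<subseteq> (\<Union>n. \<Union>l\<in>{l. l + 1 < h n}. lev n l)"
  proof
    fix x assume "x \<in> X"
    then obtain n l where "l + 1 < h n" "x \<in> lev n l" by (rule X_not_top)
    then show "x \<in> (\<Union>n. \<Union>l\<in>{l. l + 1 < h n}. lev n l)" by blast
  qed
  show "(\<Union>n. \<Union>l\<in>{l. l + 1 < h n}. lev n l) \<subseteq> X"
    using lev_subset_X by (intro UN_least) simp
qed

lemma T_image_borel: assumes A: "A \<in> sets borel" shows "T ` A \<in> sets borel"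
proof -
  have neg [measurable]: "neg \<in> sets borel" by (intro subset_neg_borel) auto
  have AX: "A \<inter> X = (\<Union>n. \<Union>l\<in>{l. l + 1 < h n}. A \<inter> lev n l)"
    by (subst X_eq_union) (simp only: Int_UN_distrib)
  have "T ` A = T ` (A \<inter> X) \<union> T ` (A \<inter> neg) \<union> T ` (A - X - neg)" by blast
  then have "T ` A = (\<Union>n. \<Union>l\<in>{l. l + 1 < h n}. T ` (A \<inter> lev n l)) \<union> T ` (A \<inter> neg) \<union> T ` (A - X - neg)"
    unfolding AX by (simp only: image_UN)
  moreover have "T ` (A \<inter> lev n l) \<in> sets borel" if "l + 1 < h n" for n l
  proof -
    define c where "c = e n (l + 1) - e n l"
    have "T ` (A \<inter> lev n l) = (\<lambda>x. x - c) -` (A \<inter> lev n l)"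
    proof -
      have "T ` (A \<inter> lev n l) = (\<lambda>x. x + c) ` (A \<inter> lev n l)"
        using T_lev[OF that] by (intro image_cong) (auto simp: c_def)
      also have "\<dots> = (\<lambda>x. x - c) -` (A \<inter> lev n l)"
      proof safe
        fix x assume "x - c \<in> A" "x - c \<in> lev n l"
        then show "x \<in> (\<lambda>x. x + c) ` (A \<inter> lev n l)" by (intro image_eqI[of _ _ "x - c"]) auto
      qed auto
      finally show ?thesis .
    qed
    moreover have "(\<lambda>x. x - c) -` (A \<inter> lev n l) \<inter> space borel \<in> sets borel"
      using A by (intro measurable_sets[of _ borel borel]) auto
    ultimately show ?thesis by simp
  qed
  moreover have "T ` (A \<inter> neg) \<in> sets borel"
    by (rule sets.countable) (auto intro!: countable_image countable_subset[OF Int_lower2 countable_neg])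
  moreover have "T ` (A - X - neg) = A - X - neg" using T_other by (auto simp: image_iff)
  moreover have "A - X - neg \<in> sets borel" using A by measurable
  ultimately show ?thesis by auto
qed

lemma T_vimage_eq: "T -` A = (\<Union>n. \<Union>l\<in>{l. l + 1 < h n}. (\<lambda>x. x + (e n (l + 1) - e n l)) -` A \<inter> lev n l)
      \<union> (T -` A \<inter> neg) \<union> (A - X - neg)"
proof (intro equalityI subsetI)
  fix x assume "x \<in> T -` A"
  then have x: "T x \<in> A" by auto
  show "x \<in> (\<Union>n. \<Union>l\<in>{l. l + 1 < h n}. (\<lambda>x. x + (e n (l + 1) - e n l)) -` A \<inter> lev n l)
      \<union> (T -` A \<inter> neg) \<union> (A - X - neg)"
  proof (cases "x \<in> X")
    case True
    then obtain n l where "l + 1 < h n" "x \<in> lev n l" using X_not_top by metis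
    with T_lev[OF this] x show ?thesis by auto
  qed (use x T_other[of x] in auto)
next
  fix x assume "x \<in> (\<Union>n. \<Union>l\<in>{l. l + 1 < h n}. (\<lambda>x. x + (e n (l + 1) - e n l)) -` A \<inter> lev n l)
      \<union> (T -` A \<inter> neg) \<union> (A - X - neg)"
  then show "x \<in> T -` A" using T_lev T_other by fastforce
qed

lemma T_measurable [measurable]: "T \<in> borel_measurable borel"
proof (rule measurableI)
  fix A :: "real set" assume A [measurable]: "A \<in> sets borel"
  have "(\<lambda>x. x + (e n (l + 1) - e n l)) -` A \<inter> space borel \<in> sets borel" for n l
    by (rule measurable_sets[OF _ A]) simp
  then have "(\<lambda>x. x + (e n (l + 1) - e n l)) -` A \<in> sets borel" for n l by simp
  moreover have "T -` A \<inter> neg \<in> sets borel" by (intro subset_neg_borel) auto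
  moreover have "neg \<in> sets borel" by (intro subset_neg_borel) auto
  ultimately have "T -` A \<in> sets borel"
    by (subst T_vimage_eq) (auto intro!: sets.Un sets.countable_UN' sets.Int sets.Diff)
  then show "T -` A \<inter> space borel \<in> sets borel" by simp
qed simp

lemma X_emeasure: "emeasure lborel X \<noteq> 0" "emeasure lborel X \<noteq> \<infinity>"
proof -
  have "emeasure lborel (lev 0 0) \<le> emeasure lborel X"
    using lev_subset_X[OF h_pos[of 0]] by (intro emeasure_mono) auto
  then show "emeasure lborel X \<noteq> 0" by (auto simp: lev_def)
  have "emeasure lborel X \<le> emeasure lborel {0..<real (h 0 + S)}"
    using X_bounds by (intro emeasure_mono) auto
  also have "\<dots> < \<infinity>" by simp
  finally show "emeasure lborel X \<noteq> \<infinity>" by simp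
qed

lemma space_M [simp]: "space M = UNIV" by (simp add: M_def)

lemma sets_M [simp, measurable_cong]: "sets M = sets borel" by (simp add: M_def)

sublocale prob_space M
  unfolding M_def using X_emeasure by (rule prob_space_uniform_measure)

lemma prob_X: "prob X = 1"
  using X_emeasure unfolding M_def
  by (subst measure_uniform_measure) (auto simp: measure_def enn2real_eq_0_iff zero_less_iff_neq_zero)

lemma emeasure_M: "A \<in> sets borel \<Longrightarrow> emeasure M A = emeasure lborel (X \<inter> A) / emeasure lborel X"
  by (simp add: M_def)

lemma emeasure_lborel_translate:
  assumes "B \<in> sets borel" shows "emeasure lborel ((\<lambda>x. x + c) -` B) = emeasure lborel (B :: real set)"
proof -
  have "emeasure lborel B = emeasure (distr lborel borel ((+) c)) B" using lborel_distr_plus[of c] by simp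
  also have "\<dots> = emeasure lborel ((+) c -` B)" using assms by (subst emeasure_distr) auto
  also have "(+) c -` B = (\<lambda>x. x + c) -` B" by (auto simp: add.commute)
  finally show ?thesis by simp
qed

text \<open>On the levels of one tower other than the top, \<open>T\<close> is a translation to
  distinct levels, which gives the inequality there; these parts increase to
  \<open>X\<close>.\<close>

lemma emeasure_T_vimage_le:
  assumes A: "A \<in> sets borel" shows "emeasure lborel (X \<inter> T -` A) \<le> emeasure lborel (X \<inter> A)"
proof -
  define D where "D n = (\<Union>l\<in>{l. l + 1 < h n}. lev n l)" for n
  have TA: "T -` A \<in> sets borel" using measurable_sets[OF T_measurable A] by simp
  have fin: "finite {l. l + 1 < h n}" for n by (rule finite_subset[of _ "{..<h n}"]) auto
  have inc: "incseq (\<lambda>n. D n \<inter> T -` A)"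
  proof (rule incseq_SucI, rule subsetI)
    fix n x assume x: "x \<in> D n \<inter> T -` A"
    then obtain l where l: "l + 1 < h n" "x \<in> lev n l" by (auto simp: D_def)
    obtain l' where "l' + 1 < h (Suc n)" "x \<in> lev (Suc n) l'"
      using lev_lift[OF l(2), of "Suc n"] l(1) by (metis add_lessD1 le_SucI order_refl)
    with x show "x \<in> D (Suc n) \<inter> T -` A" by (auto simp: D_def)
  qed
  have Db: "D n \<in> sets borel" for n unfolding D_def by (intro sets.countable_UN') auto
  have le: "emeasure lborel (D n \<inter> T -` A) \<le> emeasure lborel (X \<inter> A)" for n
  proof -
    have "D n \<inter> T -` A = (\<Union>l\<in>{l. l + 1 < h n}. lev n l \<inter> T -` A)" by (auto simp: D_def)
    then have "emeasure lborel (D n \<inter> T -` A) = emeasure lborel (\<Union>l\<in>{l. l + 1 < h n}. lev n l \<inter> T -` A)"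
      by (rule arg_cong)
    also have "\<dots> \<le> (\<Sum>l\<in>{l. l + 1 < h n}. emeasure lborel (lev n l \<inter> T -` A))"
      using fin TA by (intro emeasure_subadditive_finite) auto
    also have "\<dots> = (\<Sum>l\<in>{l. l + 1 < h n}. emeasure lborel (lev n (l + 1) \<inter> A))"
    proof (rule sum.cong)
      fix l assume "l \<in> {l. l + 1 < h n}"
      then have l: "l + 1 < h n" by simp
      have "lev n l \<inter> T -` A = (\<lambda>x. x + (e n (l + 1) - e n l)) -` (lev n (l + 1) \<inter> A)"
        using T_lev[OF l] by (auto simp: lev_def)
      with A show "emeasure lborel (lev n l \<inter> T -` A) = emeasure lborel (lev n (l + 1) \<inter> A)"
        by (simp only: emeasure_lborel_translate sets.Int lev_borel)
    qed simp
    also have "\<dots> = emeasure lborel (\<Union>l\<in>{l. l + 1 < h n}. lev n (l + 1) \<inter> A)"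
    proof (rule sum_emeasure)
      show "disjoint_family_on (\<lambda>l. lev n (l + 1) \<inter> A) {l. l + 1 < h n}"
        unfolding disjoint_family_on_def
      proof (intro ballI impI)
        fix i j :: nat assume "i \<noteq> j"
        then have "lev n (i + 1) \<inter> lev n (j + 1) = {}" by (intro lev_disjoint) simp
        then show "lev n (i + 1) \<inter> A \<inter> (lev n (j + 1) \<inter> A) = {}" by blast
      qed
    qed (use A fin in auto)
    also have "\<dots> \<le> emeasure lborel (X \<inter> A)"
      using A by (intro emeasure_mono) (auto simp: X_def)
    finally show ?thesis .
  qed
  have "X \<inter> T -` A = (\<Union>n. D n \<inter> T -` A)" using X_eq_union unfolding D_def by auto
  then have "emeasure lborel (X \<inter> T -` A) = (SUP n. emeasure lborel (D n \<inter> T -` A))"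
    using inc TA Db by (subst SUP_emeasure_incseq) auto
  also have "\<dots> \<le> emeasure lborel (X \<inter> A)" by (rule SUP_least) (rule le)
  finally show ?thesis .
qed

text \<open>The inequalities for \<open>A\<close> and for its complement force equality, as the
  total mass is 1.\<close>

lemma emeasure_T_vimage: assumes A: "A \<in> sets borel" shows "emeasure M (T -` A) = emeasure M A"
proof -
  have le: "prob (T -` B) \<le> prob B" if B: "B \<in> sets borel" for B
  proof -
    have "T -` B \<in> sets borel" using measurable_sets[OF T_measurable B] by simp
    with emeasure_T_vimage_le[OF B] B have "emeasure M (T -` B) \<le> emeasure M B"
      by (simp add: emeasure_M divide_right_mono_ennreal)
    then show ?thesis by (simp add: emeasure_eq_measure)
  qed
  have TA: "T -` A \<in> sets borel" using measurable_sets[OF T_measurable A] by simp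
  have "prob (UNIV - T -` A) \<le> prob (UNIV - A)"
    using le[of "UNIV - A"] A by (simp add: vimage_Compl Compl_eq_Diff_UNIV[symmetric])
  then have "prob A \<le> prob (T -` A)"
    using prob_compl[of A] prob_compl[of "T -` A"] A TA by simp
  with le[OF A] show ?thesis by (simp add: emeasure_eq_measure)
qed

lemma measure_preserving_system: "measure_preserving_system M T"
proof
  show "standard_borel_space M" by (rule standard_borel_space_real) auto
  show "bij_betw T (space M) (space M)" using bij_T by simp
  show "T \<in> measurable M M"
    using T_measurable by (simp add: measurable_cong_sets[of M borel M borel])
  show "the_inv_into (space M) T \<in> measurable M M"
  proof (rule measurableI)
    fix A assume "A \<in> sets M"
    have "the_inv_into UNIV T -` A = T ` A"
      using the_inv_f_f[OF T_inj] f_the_inv_into_f_bij_betw[OF bij_T] by (auto simp: image_iff) metis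
    with \<open>A \<in> sets M\<close> show "the_inv_into (space M) T -` A \<inter> space M \<in> sets M"
      using T_image_borel by simp
  qed simp
  show "emeasure M (T -` A \<inter> space M) = emeasure M A" if "A \<in> sets M" for A
    using emeasure_T_vimage that by simp
qed

section \<open>Verification of the rank one conditions\<close>

lemma h_Suc_ge: "h (Suc n) \<ge> 2 * h n"
proof -
  have "(\<Sum>j<q n - 1. h n) \<le> (\<Sum>j<q n - 1. h n + a n j)" by (intro sum_mono) simp
  then have "(q n - 1) * h n + h n \<le> h (Suc n)" by (simp add: h_Suc)
  moreover have "1 * h n \<le> (q n - 1) * h n" using q_ge_2[of n] by (intro mult_right_mono) auto
  ultimately show ?thesis by linarith
qed

lemma h_strict_mono: "strict_mono h"
proof (rule strict_mono_Suc_iff[THEN iffD2], rule allI)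
  show "h n < h (Suc n)" for n using h_Suc_ge[of n] h_pos[of n] by simp
qed

lemma h_ge: "h n \<ge> 2 ^ n"
proof (induction n)
  case 0 then show ?case using h_pos[of 0] by simp
next
  case (Suc n) then show ?case using h_Suc_ge[of n] by simp
qed

lemma h_Suc_sum: "h (Suc n) = q n * h n + (\<Sum>i=1..q n - 1. a n (i - 1))"
proof -
  have "(\<Sum>i=1..q n - 1. a n (i - 1)) = (\<Sum>j<q n - 1. a n j)"
    by (rule sum.reindex_bij_witness[of _ Suc "\<lambda>i. i - 1"]) auto
  moreover have "h (Suc n) = (q n - 1) * h n + (\<Sum>j<q n - 1. a n j) + h n"
    by (simp add: h_Suc sum.distrib)
  moreover have "(q n - 1) * h n + h n = q n * h n" using q_pos[of n] by (cases "q n") auto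
  ultimately show ?thesis by linarith
qed

lemma rank_one_parameters:
  "rank_one_parameters (\<lambda>n. h (n - 1)) (\<lambda>n. q (n - 1)) (\<lambda>n i. a (n - 1) (i - 1))"
  unfolding rank_one_parameters_def
proof (intro conjI allI impI)
  show "1 \<le> h (1 - 1)" using h_pos[of 0] by simp
  show "1 \<le> q (n - 1)" for n using q_pos[of "n - 1"] by simp
  show "h (Suc n - 1) = q (n - 1) * h (n - 1) + (\<Sum>i = 1..q (n - 1) - 1. a (n - 1) (i - 1))"
    if "1 \<le> n" for n using h_Suc_sum[of "n - 1"] that by simp
  show "strict_mono_on {1..} (\<lambda>n. h (n - 1))"
    using h_strict_mono by (auto simp: strict_mono_on_def strict_mono_def)
  let ?f = "\<lambda>n. real (\<Sum>i = 1..q (n - 1) - 1. a (n - 1) (i - 1)) / real (h (Suc n - 1))"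
  \<comment> \<open>With \<open>m = n - 1\<close>, at most \<open>q m * S\<close> spacers are added
    and the new height is at least \<open>q m * h m\<close>. The ratio is at most
    \<open>S / h m \<le> S / 2 ^ m\<close>; the factor 2 undoes the shift of the index.\<close>
  have "summable (\<lambda>n. real S * 2 * (1 / 2) ^ n)" by (intro summable_mult summable_geometric) simp
  then have "summable (\<lambda>n. norm (?f n))"
  proof (rule summable_comparison_test'[where N = 1])
    fix n :: nat assume n: "n \<ge> 1"
    then obtain m where m: "n = Suc m" by (cases n) auto
    have "(\<Sum>i = 1..q m - 1. a m (i - 1)) \<le> (\<Sum>i = 1..q m - 1. S)"
      using a_less by (intro sum_mono less_imp_le) auto
    also have "\<dots> \<le> q m * S" by simp
    finally have 1: "(\<Sum>i = 1..q m - 1. a m (i - 1)) \<le> q m * S" .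
    have "q m * h m \<le> h (Suc m)" using h_Suc_sum[of m] by simp
    have "?f n \<le> real (q m * S) / real (q m * h m)"
      unfolding m using 1 \<open>q m * h m \<le> h (Suc m)\<close> q_pos[of m] h_pos[of m]
      by (intro frac_le of_nat_mono) (auto simp del: of_nat_mult of_nat_sum)
    also have "\<dots> = real S / real (h m)" using q_pos[of m] by simp
    also have "\<dots> \<le> real S / 2 ^ m"
    proof -
      have "real (2 ^ m) \<le> real (h m)" using h_ge[of m] of_nat_le_iff by blast
      then show ?thesis by (intro divide_left_mono mult_pos_pos) (auto simp: h_pos)
    qed
    also have "\<dots> = real S * 2 * (1 / 2) ^ n" unfolding m by (simp add: power_one_over field_simps)
    finally have "?f n \<le> real S * 2 * (1 / 2) ^ n" .
    moreover have "?f n \<ge> 0" by (intro divide_nonneg_nonneg of_nat_0_le_iff)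
    ultimately show "norm (norm (?f n)) \<le> real S * 2 * (1 / 2) ^ n"
      by (simp only: real_norm_def abs_of_nonneg abs_idempotent)
  qed
  then have "?f summable_on UNIV" by (rule norm_summable_imp_summable_on)
  then show "?f summable_on {1..}" by (rule summable_on_subset_banach) simp
qed

lemma tower_partition_eq:
  "tower_partition M T (lev n 0) (h n) = lev n ` {..<h n} \<union> {- (\<Union>l<h n. lev n l)}"
proof -
  have "(T ^^ j) ` lev n 0 = lev n j" if "j < h n" for j using T_pow_image_lev[of 0 j n] that by simp
  then have "(\<lambda>j. (T ^^ j) ` lev n 0) ` {..<h n} = lev n ` {..<h n}"
    "tower T (lev n 0) (h n) = (\<Union>l<h n. lev n l)"
    by (auto simp: tower_def image_iff)
  then show ?thesis by (simp add: tower_partition_def Compl_eq_Diff_UNIV)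
qed

lemma lev_bottom_split: "lev n 0 = (\<Union>i<q n. lev (Suc n) (start n i))"
proof
  show "lev n 0 \<subseteq> (\<Union>i<q n. lev (Suc n) (start n i))"
  proof
    fix x assume "x \<in> lev n 0"
    then obtain i where "i < q n" "x \<in> lev (Suc n) (start n i + 0)" using lev_split h_pos by metis
    then show "x \<in> (\<Union>i<q n. lev (Suc n) (start n i))" by auto
  qed
  show "(\<Union>i<q n. lev (Suc n) (start n i)) \<subseteq> lev n 0"
    using lev_Suc_subset[OF in_copyI[OF _ h_pos]] by auto
qed

lemma lev_subset_cases:
  assumes "l < h (Suc n)"
  obtains l' where "l' < h n" "lev (Suc n) l \<subseteq> lev n l'" | "lev (Suc n) l \<inter> (\<Union>l<h n. lev n l) = {}"
proof -
  obtain i k where ik: "l = start n i + k" "in_copy n i k" using level_decomp by metis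
  show ?thesis
  proof (cases "k < h n")
    case True with lev_Suc_subset[OF ik(2)] ik(1) that show ?thesis by blast
  next
    case False
    then have "lev n k \<inter> (\<Union>l<h n. lev n l) = {}" using lev_unique by blast
    with lev_Suc_subset[OF ik(2)] ik(1) that show ?thesis by blast
  qed
qed

lemma tower_mono: "(\<Union>l<h n. lev n l) \<subseteq> (\<Union>l<h (Suc n). lev (Suc n) l)"
proof
  fix x assume "x \<in> (\<Union>l<h n. lev n l)"
  then obtain l where l: "l < h n" "x \<in> lev n l" by auto
  obtain l' where "l' < h (Suc n)" "x \<in> lev (Suc n) l'" using lev_lift[OF l(2,1), of "Suc n"] by auto
  then show "x \<in> (\<Union>l<h (Suc n). lev (Suc n) l)" by auto
qed

text \<open>The widths tend to 0, so the level around a point of an open set eventually lies inside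
  that set.\<close>

lemma open_inter_X:
  assumes "open U"
  shows "U \<inter> X = (\<Union>n. \<Union>l\<in>{l. l < h n \<and> lev n l \<subseteq> U}. lev n l)"
proof
  show "U \<inter> X \<subseteq> (\<Union>n. \<Union>l\<in>{l. l < h n \<and> lev n l \<subseteq> U}. lev n l)"
  proof
    fix x assume x: "x \<in> U \<inter> X"
    then obtain d where d: "d > 0" "ball x d \<subseteq> U" using assms openE by blast
    then have "\<forall>\<^sub>F n in sequentially. w n < d" by (intro order_tendstoD(2)[OF w_tendsto_0])
    then obtain N where N: "\<And>n. n \<ge> N \<Longrightarrow> w n < d" by (auto simp: eventually_sequentially)
    obtain n l where nl: "n \<ge> N" "l < h n" "x \<in> lev n l" using in_X_lift x by blast
    have "lev n l \<subseteq> ball x d" using nl(3) N[OF nl(1)] by (auto simp: lev_def dist_real_def)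
    with d nl show "x \<in> (\<Union>n. \<Union>l\<in>{l. l < h n \<and> lev n l \<subseteq> U}. lev n l)" by blast
  qed
qed (auto simp: X_def)

lemma levels_generate:
  assumes "B \<in> sets borel"
  shows "B \<inter> X \<in> sigma_sets UNIV (\<Union>n. lev n ` {..<h n})"
proof -
  interpret G: sigma_algebra UNIV "sigma_sets UNIV (\<Union>n. lev n ` {..<h n})"
    by (rule sigma_algebra_sigma_sets) auto
  have lev: "lev n l \<in> sigma_sets UNIV (\<Union>n. lev n ` {..<h n})" if "l < h n" for n l
    using that by (intro sigma_sets.Basic) auto
  have op: "U \<inter> X \<in> sigma_sets UNIV (\<Union>n. lev n ` {..<h n})" if "open U" for U
    unfolding open_inter_X[OF that] by (intro G.countable_UN'') (auto intro!: G.finite_UN lev)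
  have "B \<in> sigma_sets UNIV {S. open S}" using assms by (simp add: borel_def)
  then show ?thesis
  proof induction
    case (Basic U) then show ?case using op by simp
  next
    case Empty then show ?case by simp
  next
    case (Compl B)
    have "(UNIV - B) \<inter> X = (UNIV \<inter> X) - (B \<inter> X)" by auto
    then show ?case using Compl op[of UNIV] by (simp only: open_UNIV G.Diff)
  next
    case (Union B)
    have "(\<Union>i. B i) \<inter> X = (\<Union>i. B i \<inter> X)" by auto
    then show ?case using Union.IH by (simp only:) (rule sigma_sets.Union)
  qed
qed

lemma null_outside_X: "- X \<in> null_sets M"
  using prob_compl[of X] prob_X by (intro null_setsI) (auto simp: emeasure_eq_measure Compl_eq_Diff_UNIV)

text \<open>The pieces of a base are the bottom levels of the copies, seen as levels of the next
  stage. All conditions hold exactly and not only modulo null sets, apart from generation, where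
  \<open>B\<close> is replaced by \<open>B \<inter> X\<close>.\<close>

lemma rank_one_towers:
  "rank_one_towers M T (\<lambda>n. h (n - 1)) (\<lambda>n. q (n - 1)) (\<lambda>n i. a (n - 1) (i - 1))
     (\<lambda>n. lev (n - 1) 0) (\<lambda>n i. lev n (start (n - 1) (i - 1)))"
proof -
  have eqI: "eq_mod_null M A B" if "A = B" for A B using that by (simp add: eq_mod_null_def)
  have disj: "A \<inter> B \<in> null_sets M" if "A \<inter> B = {}" for A B using that by simp
  show ?thesis
    unfolding rank_one_towers_def
  proof (intro conjI allI impI)
    fix n :: nat
    show "lev (n - 1) 0 \<in> sets M" by simp
    have "prob (lev (n - 1) 0) > 0"
    proof -
      have "X \<inter> lev (n - 1) 0 = lev (n - 1) 0" using lev_subset_X[OF h_pos] by auto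
      moreover have "emeasure lborel (lev (n - 1) 0) = ennreal (w (n - 1))"
        using w_pos[of "n - 1"] by (simp add: lev_def)
      ultimately have "emeasure M (lev (n - 1) 0) > 0"
        using X_emeasure w_pos[of "n - 1"]
        by (simp add: emeasure_M ennreal_zero_less_divide top.not_eq_extremum)
      then show ?thesis by (simp add: emeasure_eq_measure)
    qed
    then show "0 < emeasure M (lev (n - 1) 0)" by (simp add: emeasure_eq_measure)
  next
    fix n i j :: nat assume "1 \<le> n" "i < h (n - 1)" "j < h (n - 1)" "i \<noteq> j"
    then show "(T ^^ i) ` lev (n - 1) 0 \<inter> (T ^^ j) ` lev (n - 1) 0 \<in> null_sets M"
      using T_pow_image_lev[of 0 i "n - 1"] T_pow_image_lev[of 0 j "n - 1"] lev_disjoint by simp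
  next
    fix n :: nat assume "1 \<le> n"
    then obtain m where m: "n = Suc m" by (cases n) auto
    show "\<forall>i\<in>{1..q (n - 1)}. lev n (start (n - 1) (i - 1)) \<in> sets M" by simp
    show "\<forall>i\<in>{1..q (n - 1)}. \<forall>j\<in>{1..q (n - 1)}. i \<noteq> j \<longrightarrow>
        lev n (start (n - 1) (i - 1)) \<inter> lev n (start (n - 1) (j - 1)) \<in> null_sets M"
    proof (intro ballI impI disj lev_disjoint)
      fix i j assume ij: "i \<in> {1..q (n - 1)}" "j \<in> {1..q (n - 1)}" "i \<noteq> j"
      have "in_copy m (i - 1) 0" "in_copy m (j - 1) 0" using ij h_pos[of m] by (auto simp: m intro!: in_copyI)
      from this[THEN copy_start] have "start m (i - 1) \<noteq> start m (j - 1)" using ij by auto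
      then show "start (n - 1) (i - 1) \<noteq> start (n - 1) (j - 1)" by (simp add: m)
    qed
    have "(\<Union>i\<in>{1..q m}. lev (Suc m) (start m (i - 1))) = (\<Union>i<q m. lev (Suc m) (start m i))"
    proof (intro equalityI subsetI)
      fix x assume "x \<in> (\<Union>i<q m. lev (Suc m) (start m i))"
      then obtain i where "i < q m" "x \<in> lev (Suc m) (start m i)" by auto
      then show "x \<in> (\<Union>i\<in>{1..q m}. lev (Suc m) (start m (i - 1)))" by (intro UN_I[of "Suc i"]) auto
    qed fastforce
    then show "eq_mod_null M (\<Union>i\<in>{1..q (n - 1)}. lev n (start (n - 1) (i - 1))) (lev (n - 1) 0)"
      using lev_bottom_split[of m] by (intro eqI) (simp add: m)
  next
    fix n :: nat assume "1 \<le> n"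
    then obtain m where m: "n = Suc m" by (cases n) auto
    show "\<forall>i\<in>{1..q (n - 1) - 1}. eq_mod_null M ((T ^^ (h (n - 1) + a (n - 1) (i - 1))) `
        lev n (start (n - 1) (i - 1))) (lev n (start (n - 1) (i + 1 - 1)))"
    proof (intro ballI eqI)
      fix i assume i: "i \<in> {1..q (n - 1) - 1}"
      then have *: "start m i = start m (i - 1) + (h m + a m (i - 1))" "i < q m"
        using start_Suc[of m "i - 1"] by (auto simp: m)
      have "start m i < h (Suc m)" using start_less_h[OF *(2) h_pos[of m]] by simp
      then show "(T ^^ (h (n - 1) + a (n - 1) (i - 1))) ` lev n (start (n - 1) (i - 1))
          = lev n (start (n - 1) (i + 1 - 1))"
        using T_pow_image_lev[of "start m (i - 1)" "h m + a m (i - 1)" "Suc m"] by (simp add: m * )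
    qed
  next
    fix n :: nat assume "1 \<le> n"
    then show "eq_mod_null M (lev (Suc n - 1) 0) (lev n (start (n - 1) (1 - 1)))" by (intro eqI) simp
  next
    fix n :: nat assume "1 \<le> n"
    then obtain m where m: "n = Suc m" by (cases n) auto
    show "\<forall>A\<in>tower_partition M T (lev (Suc n - 1) 0) (h (Suc n - 1)).
        \<exists>B\<in>tower_partition M T (lev (n - 1) 0) (h (n - 1)). A - B \<in> null_sets M"
    proof
      fix A assume "A \<in> tower_partition M T (lev (Suc n - 1) 0) (h (Suc n - 1))"
      then consider l where "l < h (Suc m)" "A = lev (Suc m) l" | "A = - (\<Union>l<h (Suc m). lev (Suc m) l)"
        by (auto simp: m tower_partition_eq)
      then have "\<exists>B\<in>tower_partition M T (lev m 0) (h m). A \<subseteq> B"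
      proof cases
        case 1
        show ?thesis using 1(1)
        proof (cases rule: lev_subset_cases)
          case (1 l') then show ?thesis using \<open>A = _\<close> by (auto simp: tower_partition_eq)
        next
          case 2 then show ?thesis using \<open>A = _\<close> by (auto simp: tower_partition_eq)
        qed
      next
        case 2 then show ?thesis using tower_mono[of m] by (auto simp: tower_partition_eq)
      qed
      then obtain B where B: "B \<in> tower_partition M T (lev m 0) (h m)" "A - B = {}" by blast
      then have "A - B \<in> null_sets M" by (simp only: null_sets.empty_sets)
      with B(1) show "\<exists>B\<in>tower_partition M T (lev (n - 1) 0) (h (n - 1)). A - B \<in> null_sets M"
        by (intro bexI[of _ B]) (auto simp: m)
    qed
  next
    show "\<forall>B\<in>sets M. \<exists>C\<in>sigma_sets (space M) (\<Union>n\<in>{1..}. tower_partition M T (lev (n - 1) 0) (h (n - 1))).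
        eq_mod_null M B C"
    proof
      fix B assume B: "B \<in> sets M"
      have "(\<Union>n. lev n ` {..<h n}) \<subseteq> (\<Union>n\<in>{1..}. tower_partition M T (lev (n - 1) 0) (h (n - 1)))"
      proof
        fix A assume "A \<in> (\<Union>n. lev n ` {..<h n})"
        then obtain n where "A \<in> lev n ` {..<h n}" by blast
        then show "A \<in> (\<Union>n\<in>{1..}. tower_partition M T (lev (n - 1) 0) (h (n - 1)))"
          by (intro UN_I[of "Suc n"]) (auto simp: tower_partition_eq)
      qed
      then have "sigma_sets UNIV (\<Union>n. lev n ` {..<h n})
          \<subseteq> sigma_sets UNIV (\<Union>n\<in>{1..}. tower_partition M T (lev (n - 1) 0) (h (n - 1)))"
        by (rule sigma_sets_mono')
      moreover have "B \<inter> X \<in> sigma_sets UNIV (\<Union>n. lev n ` {..<h n})"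
        using B by (intro levels_generate) simp
      moreover have "eq_mod_null M B (B \<inter> X)"
        unfolding eq_mod_null_def using B by (intro null_sets_subset[OF null_outside_X]) auto
      ultimately show "\<exists>C\<in>sigma_sets (space M) (\<Union>n\<in>{1..}. tower_partition M T (lev (n - 1) 0) (h (n - 1))).
          eq_mod_null M B C" by (intro bexI[of _ "B \<inter> X"]) auto
    qed
  qed
qed

lemma rank_one_system: "rank_one_system M T"
  unfolding rank_one_system_def
  using measure_preserving_system rank_one_parameters rank_one_towers by blast

end

section \<open>Counting names\<close>

context cutting_stacking
begin

section \<open>Symbols given by the tower partitions\<close>

definition symbol :: "nat \<Rightarrow> real \<Rightarrow> nat" where
  "symbol n x = (if \<exists>l<h n. x \<in> lev n l then THE l. x \<in> lev n l else h n)"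

lemma sym_lev: assumes "l < h n" "x \<in> lev n l" shows "symbol n x = l"
proof -
  have "(THE l. x \<in> lev n l) = l" using assms(2) lev_unique by (intro the_equality) auto
  with assms show ?thesis by (auto simp: symbol_def)
qed

lemma sym_outside: assumes "\<And>l. l < h n \<Longrightarrow> x \<notin> lev n l" shows "symbol n x = h n"
proof -
  have "\<not> (\<exists>l<h n. x \<in> lev n l)" using assms by blast
  then show ?thesis unfolding symbol_def by (rule if_not_P)
qed

lemma sym_beyond: assumes "x \<in> lev n l" "h n \<le> l" shows "symbol n x = h n"
proof (rule sym_outside)
  fix l' assume "l' < h n"
  with assms(2) have "l \<noteq> l'" by simp
  with assms(1) lev_unique show "x \<notin> lev n l'" by blast
qed

lemma lev_sym: assumes "symbol n x \<noteq> h n" shows "symbol n x < h n" "x \<in> lev n (symbol n x)"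
proof -
  obtain l where "l < h n" "x \<in> lev n l" using assms sym_outside by blast
  with sym_lev show "symbol n x < h n" "x \<in> lev n (symbol n x)" by auto
qed

lemma sym_le: "symbol n x \<le> h n"
  using lev_sym(1)[of n x] by fastforce

text \<open>A level of the later tower lies in one cell of the earlier partition, so
  \<open>g\<close> can evaluate the earlier symbol at the left end point of the level.\<close>

lemma sym_factor:
  assumes "n \<le> m" obtains g where "\<And>x. symbol n x = g (symbol m x)"
proof
  have const: "symbol n x = symbol n y" if "x \<in> lev m k" "y \<in> lev m k" "symbol n x < h n" for x y k
  proof -
    from that(3) obtain l where l: "l < h n" "x \<in> lev n l" using lev_sym[of n x] by auto
    obtain k' where k': "x \<in> lev m k'" "lev m (k' + 0) \<subseteq> lev n (l + 0)"
      using lev_lift[OF l(2,1) assms] l(1) by (metis add.right_neutral)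
    have "k' = k" using lev_unique[OF k'(1) that(1)] .
    then have "y \<in> lev n l" using k' that(2) by auto
    with l sym_lev show ?thesis by simp
  qed
  show "symbol n x = (if symbol m x < h m then symbol n (e m (symbol m x)) else h n)" for x
  proof (cases "\<exists>k<h m. x \<in> lev m k")
    case True
    then obtain k where k: "k < h m" "x \<in> lev m k" by blast
    have ek: "e m k \<in> lev m k" using w_pos[of m] by (simp add: lev_def)
    have "symbol n x = symbol n (e m k)"
      using const[OF k(2) ek] const[OF ek k(2)] sym_le[of n x] sym_le[of n "e m k"] by linarith
    then show ?thesis using sym_lev[OF k] k by simp
  next
    case False
    then have "symbol m x = h m" by (intro sym_outside) blast
    moreover have "symbol n x = h n" using False lev_lift[OF _ _ assms] by (intro sym_outside) metis
    ultimately show ?thesis by simp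
  qed
qed

lemma simple_function_sym [intro]: "simple_function M (symbol n)"
  unfolding simple_function_def
proof (intro conjI ballI)
  show "finite (symbol n ` space M)" by (rule finite_subset[of _ "{..h n}"]) (use sym_le in auto)
  fix v assume "v \<in> symbol n ` space M"
  show "symbol n -` {v} \<inter> space M \<in> sets M"
  proof (cases "v < h n")
    case True
    have "symbol n -` {v} = lev n v"
    proof (intro equalityI subsetI)
      fix x assume "x \<in> symbol n -` {v}"
      then show "x \<in> lev n v" using True lev_sym[of n x] by auto
    qed (use True sym_lev in auto)
    then show ?thesis by simp
  next
    case False
    have eq: "symbol n -` {v} = (if v = h n then - (\<Union>l\<in>{..<h n}. lev n l) else {})"
    proof -
      have "symbol n x = h n \<longleftrightarrow> x \<notin> (\<Union>l\<in>{..<h n}. lev n l)" for x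
      proof
        assume eq: "symbol n x = h n"
        show "x \<notin> (\<Union>l\<in>{..<h n}. lev n l)"
        proof
          assume "x \<in> (\<Union>l\<in>{..<h n}. lev n l)"
          then obtain l where "l < h n" "x \<in> lev n l" by auto
          with sym_lev eq show False by simp
        qed
      qed (auto intro: sym_outside)
      moreover have "symbol n x \<noteq> v" if "v \<noteq> h n" for x using sym_le[of n x] False that by simp
      ultimately show ?thesis by (simp add: set_eq_iff)
    qed
    have "symbol n -` {v} \<in> sets borel"
    proof -
      have "(\<Union>l\<in>{..<h n}. lev n l) \<in> sets borel" by (intro sets.finite_UN) auto
      then show ?thesis unfolding eq by (metis borel_comp sets.empty_sets)
    qed
    then show ?thesis by simp
  qed
qed

lemma measurable_T_pow [measurable]: "T ^^ k \<in> measurable M M"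
  by (induction k) (auto intro!: measurable_comp[of _ M M T M] simp: measurable_cong_sets[of M borel M borel] comp_def id_def)

lemma simple_function_T_pow:
  assumes "simple_function M Y" shows "simple_function M (\<lambda>x. Y ((T ^^ k) x))"
  unfolding simple_function_def
proof (intro conjI ballI)
  show "finite ((\<lambda>x. Y ((T ^^ k) x)) ` space M)"
    by (rule finite_subset[of _ "Y ` space M"]) (use assms in \<open>auto simp: simple_function_def\<close>)
  fix v assume "v \<in> (\<lambda>x. Y ((T ^^ k) x)) ` space M"
  then have "Y -` {v} \<inter> space M \<in> sets M" using assms by (auto simp: simple_function_def)
  from measurable_sets[OF measurable_T_pow this, of k]
  show "(\<lambda>x. Y ((T ^^ k) x)) -` {v} \<inter> space M \<in> sets M"
    by (simp add: vimage_def)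
qed

lemma emeasure_T_pow_vimage: "A \<in> sets borel \<Longrightarrow> emeasure M ((T ^^ k) -` A) = emeasure M A"
proof (induction k arbitrary: A)
  case (Suc k)
  have "T -` A \<in> sets borel" using measurable_sets[OF T_measurable Suc.prems] by simp
  then have "emeasure M ((T ^^ k) -` (T -` A)) = emeasure M A"
    using Suc emeasure_T_vimage by simp
  moreover have "(T ^^ Suc k) -` A = (T ^^ k) -` (T -` A)" by auto
  ultimately show ?case by (simp only:)
qed simp

lemma T_pow_surj: "range (T ^^ k) = UNIV"
  using bij_T bij_betw_funpow[of T UNIV k] by (auto simp: bij_def)

lemma rv_entropy_T_pow:
  assumes "simple_function M Y" shows "rv_entropy M (\<lambda>x. Y ((T ^^ k) x)) = rv_entropy M Y"
proof -
  have "(\<lambda>x. Y ((T ^^ k) x)) ` UNIV = Y ` UNIV"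
    using T_pow_surj[of k] by (metis image_image)
  moreover have "measure M ((\<lambda>x. Y ((T ^^ k) x)) -` {v}) = measure M (Y -` {v})" if "v \<in> range Y" for v
  proof -
    have "Y -` {v} \<in> sets borel" using assms that by (auto simp: simple_function_def)
    from emeasure_T_pow_vimage[OF this, of k] show ?thesis by (simp add: measure_def vimage_def)
  qed
  ultimately show ?thesis by (simp add: rv_entropy_def)
qed

section \<open>Return times to the base and the number of names\<close>

lemma return_time:
  assumes "b \<in> lev n 0"
  obtains u where "u < S" "(T ^^ (h n + u)) b \<in> lev n 0" "\<And>d. d < u \<Longrightarrow> symbol n ((T ^^ (h n + d)) b) = h n"
proof -
  \<comment> \<open>The least such \<open>m\<close> is the first stage at which the tower continues
    above the block of height \<open>h n\<close> over \<open>b\<close>. One stage earlier, at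
    \<open>k\<close>, the block ends at the top, so the \<open>a k i\<close> spacers of its column
    follow, and then a copy of tower \<open>k\<close>, whose bottom level lies in that of stage
    \<open>n\<close>.\<close>
  define P where "P m \<longleftrightarrow> n \<le> m \<and> (\<exists>l. b \<in> lev m l \<and> l + h n < h m)" for m
  have bX: "b \<in> X" using assms lev_subset_X[OF h_pos[of n]] by auto
  have "\<exists>m. P m" using X_lift_time[OF bX, of n "h n"] unfolding P_def by metis
  then have Pm: "P (LEAST m. P m)" by (rule LeastI_ex)
  define m where "m = (LEAST m. P m)"
  have "\<not> P n" using lev_unique[OF assms] h_pos[of n] by (auto simp: P_def)
  then have "m \<noteq> n" "P m" using Pm by (auto simp: m_def)
  then obtain k where k: "m = Suc k" "n \<le> k" unfolding P_def by (metis Suc_leI le_SucE less_imp_Suc_add order_le_less le_add1)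
  have nPk: "\<not> P k" using not_less_Least[of k P] k(1) by (simp add: m_def)
  obtain l where l: "l < h k" "b \<in> lev k l" "\<And>d. 0 + d < h n \<Longrightarrow> l + d < h k \<and>
      e k (l + d) - e k l = e n (0 + d) - e n 0 \<and> lev k (l + d) \<subseteq> lev n (0 + d)"
    using lev_lift[OF assms h_pos k(2)] by blast
  from l(3)[of "h n - 1"] have l3: "l + (h n - 1) < h k" using h_pos[of n] by simp
  have lh: "l + h n = h k"
  proof -
    have "\<not> l + h n < h k" using nPk l(2) k(2) by (auto simp: P_def)
    with l3 h_pos[of n] show ?thesis by simp
  qed
  obtain i where i: "i < q k" "b \<in> lev (Suc k) (start k i + l)" by (rule lev_split[OF l(2,1)])
  have "start k i + l + h n < h (Suc k)"
    using \<open>P m\<close> lev_unique[OF i(2)] unfolding P_def k(1) by blast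
  then have iq: "i < q k - 1" using lh i(1) h_Suc_start[of k] by (cases "i = q k - 1") auto
  have Suci: "start k (Suc i) < h (Suc k)" using start_less_h[of "Suc i" k 0] iq h_pos[of k] by simp
  have pos: "(T ^^ (h n + d)) b \<in> lev (Suc k) (start k i + (h k + d))" if "d \<le> a k i" for d
  proof -
    have "start k i + l + (h n + d) < h (Suc k)" using Suci that lh by (simp add: start_Suc)
    from T_pow_lev[OF this i(2)]
    have "(T ^^ (h n + d)) b \<in> lev (Suc k) (start k i + l + (h n + d))" by blast
    moreover have "start k i + l + (h n + d) = start k i + (h k + d)" using lh by simp
    ultimately show ?thesis by (simp only:)
  qed
  show ?thesis
  proof (rule that[of "a k i"])
    show "a k i < S" by (rule a_less)
    have "(T ^^ (h n + a k i)) b \<in> lev (Suc k) (start k (Suc i) + 0)"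
      using pos[of "a k i"] by (simp add: start_Suc add.assoc)
    moreover have "lev (Suc k) (start k (Suc i) + 0) \<subseteq> lev k 0"
      using iq h_pos[of k] by (intro lev_Suc_subset in_copyI) auto
    moreover have "lev k 0 \<subseteq> lev n 0" using w_antimono[OF k(2)] by (auto simp: lev_bottom)
    ultimately show "(T ^^ (h n + a k i)) b \<in> lev n 0" by blast
    fix d assume d: "d < a k i"
    have "lev (Suc k) (start k i + (h k + d)) \<subseteq> lev k (h k + d)"
      using d iq by (intro lev_Suc_subset) (auto simp: in_copy_def)
    moreover have "lev k (h k + d) \<subseteq> lev n (h n + d)" using w_antimono[OF k(2)] by (auto simp: lev_spacer)
    ultimately have "(T ^^ (h n + d)) b \<in> lev n (h n + d)" using pos[of d] d by auto
    then show "symbol n ((T ^^ (h n + d)) b) = h n" by (rule sym_beyond) simp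
  qed
qed

text \<open>Going down the stages, a level lies in a copy of the previous tower or is one of fewer
  than \<open>S\<close> spacers above a top level. Top levels are nested, so in the latter case the
  top level of stage \<open>n\<close> is reached, \<open>h n - 1\<close> steps above the
  base.\<close>

lemma last_base:
  assumes "x \<in> X" obtains b l where "b \<in> lev n 0" "l < h n + S" "x = (T ^^ l) b"
proof -
  have "\<exists>b\<in>lev n 0. \<exists>l<h n + S. x = (T ^^ l) b" if "n \<le> m" "k < h m" "x \<in> lev m k" for m k
    using that
  proof (induction m arbitrary: k rule: dec_induct)
    case base
    have "x \<in> (T ^^ k) ` lev n 0" using T_pow_image_lev[of 0 k n] base by simp
    then show ?case using base by (metis imageE trans_less_add1)
  next
    case (step m)
    obtain i l where il: "k = start m i + l" "in_copy m i l" "l < h m \<or> i < q m - 1 \<and> l < h m + a m i"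
      using level_decomp[of k m] step.prems by metis
    show ?case
    proof (cases "l < h m")
      case True
      then show ?thesis using step.IH[of l] lev_Suc_subset[OF il(2)] step.prems il(1) by auto
    next
      case False
      define d where "d = l - h m"
      have d: "l = h m + d" "d < S" using False il(3) a_less[of m i] by (auto simp: d_def)
      have "k = (start m i + (h m - 1)) + (d + 1)" using il(1) d h_pos[of m] by simp
      then have "x \<in> (T ^^ (d + 1)) ` lev (Suc m) (start m i + (h m - 1))"
        using T_pow_image_lev[of "start m i + (h m - 1)" "d + 1" "Suc m"] step.prems by simp
      then obtain y where y: "y \<in> lev (Suc m) (start m i + (h m - 1))" "x = (T ^^ (d + 1)) y" by blast
      have "lev (Suc m) (start m i + (h m - 1)) \<subseteq> lev m (h m - 1)"
        using il(2) h_pos[of m] by (intro lev_Suc_subset in_copyI) (auto simp: in_copy_def)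
      moreover have "lev m (h m - 1) \<subseteq> lev n (h n - 1)"
        using w_antimono[OF step.hyps(1)] unfolding lev_top by auto
      ultimately have "y \<in> (T ^^ (h n - 1)) ` lev n 0"
        using T_pow_image_lev[of 0 "h n - 1" n] h_pos[of n] y(1) by auto
      then obtain b where b: "b \<in> lev n 0" "y = (T ^^ (h n - 1)) b" by blast
      have "x = (T ^^ (d + 1 + (h n - 1))) b" using b(2) y(2) by (simp only: funpow_add comp_def)
      moreover have "d + 1 + (h n - 1) < h n + S" using d h_pos[of n] by simp
      ultimately show ?thesis using b(1) by blast
    qed
  qed
  moreover obtain m k where "n \<le> m" "k < h m" "x \<in> lev m k" using in_X_lift[OF assms] .
  ultimately show ?thesis using that by blast
qed

definition ret :: "nat \<Rightarrow> real \<Rightarrow> nat" where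
  "ret n b = (SOME u. u < S \<and> (T ^^ (h n + u)) b \<in> lev n 0 \<and>
     (\<forall>d<u. symbol n ((T ^^ (h n + d)) b) = h n))"

lemma ret:
  assumes "b \<in> lev n 0"
  shows "ret n b < S" "(T ^^ (h n + ret n b)) b \<in> lev n 0"
    "d < ret n b \<Longrightarrow> symbol n ((T ^^ (h n + d)) b) = h n"
proof -
  have "\<exists>u. u < S \<and> (T ^^ (h n + u)) b \<in> lev n 0 \<and> (\<forall>d<u. symbol n ((T ^^ (h n + d)) b) = h n)"
    using return_time[OF assms] by metis
  from someI_ex[OF this] show "ret n b < S" "(T ^^ (h n + ret n b)) b \<in> lev n 0"
    "d < ret n b \<Longrightarrow> symbol n ((T ^^ (h n + d)) b) = h n" by (auto simp: ret_def)
qed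

primrec rets :: "nat \<Rightarrow> nat \<Rightarrow> real \<Rightarrow> nat list" where
  "rets n 0 b = []"
| "rets n (Suc B) b = ret n b # rets n B ((T ^^ (h n + ret n b)) b)"

lemma rets_lists: "b \<in> lev n 0 \<Longrightarrow> rets n B b \<in> {xs. set xs \<subseteq> {..<S} \<and> length xs = B}"
proof (induction B arbitrary: b)
  case (Suc B)
  from Suc.IH[OF ret(2)[OF Suc.prems]] ret(1)[OF Suc.prems] show ?case by simp
qed simp

text \<open>Inside a block the symbol counts upwards, and on the spacers after it the symbol is
  \<open>h n\<close>. Each return takes at least \<open>h n\<close> steps, so the next
  \<open>B\<close> spacer numbers fix the symbols for \<open>B * h n\<close> steps.\<close>

lemma sym_determined:
  assumes "b \<in> lev n 0" "b' \<in> lev n 0" "rets n B b = rets n B b'" "j < B * h n"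
  shows "symbol n ((T ^^ j) b) = symbol n ((T ^^ j) b')"
  using assms
proof (induction B arbitrary: b b' j)
  case (Suc B)
  let ?u = "ret n b"
  have u: "ret n b' = ?u" using Suc.prems(3) by simp
  have tail: "rets n B ((T ^^ (h n + ?u)) b) = rets n B ((T ^^ (h n + ?u)) b')"
    using Suc.prems(3) u by simp
  consider "j < h n" | "h n \<le> j" "j < h n + ?u" | "h n + ?u \<le> j" by linarith
  then show ?case
  proof cases
    case 1
    have "(T ^^ j) c \<in> lev n j" if "c \<in> lev n 0" for c using T_pow_lev[OF _ that, of j] 1 by (metis add_0)
    with Suc.prems sym_lev[OF 1] show ?thesis by simp
  next
    case 2
    define d where "d = j - h n"
    have "j = h n + d" "d < ?u" using 2 by (auto simp: d_def)
    then show ?thesis using ret(3)[OF Suc.prems(1)] ret(3)[OF Suc.prems(2)] u by simp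
  next
    case 3
    define d where "d = j - (h n + ?u)"
    have j: "j = d + (h n + ?u)" using 3 by (simp add: d_def)
    have "d < B * h n" using Suc.prems(4) j by simp
    from Suc.IH[OF ret(2)[OF Suc.prems(1)] ret(2)[OF Suc.prems(2), unfolded u] tail this]
    show ?thesis unfolding j by (simp only: funpow_add comp_def)
  qed
qed simp

lemma name_entropy_sym_le:
  assumes B: "\<And>k. k \<in> {1..N} \<Longrightarrow> t k + h n + S \<le> B * h n"
  shows "name_entropy M T t (symbol n) N \<le> ln (real ((h n + S) * S ^ B))"
proof -
  let ?f = "\<lambda>x. \<lambda>k\<in>{1..N}. symbol n ((T ^^ t k) x)"
  let ?K = "{..<h n + S} \<times> {xs. set xs \<subseteq> {..<S} \<and> length xs = B}"
  have finK: "finite ?K" by (intro finite_cartesian_product finite_lists_length_eq) auto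
  have cardK: "card ?K = (h n + S) * S ^ B" by (simp add: card_cartesian_product card_lists_length_eq)
  have "\<exists>b l. b \<in> lev n 0 \<and> l < h n + S \<and> x = (T ^^ l) b" if "x \<in> X" for x
    using last_base[OF that] by metis
  then obtain b l where bl: "\<And>x. x \<in> X \<Longrightarrow> b x \<in> lev n 0 \<and> l x < h n + S \<and> x = (T ^^ l x) (b x)"
    by metis
  \<comment> \<open>A point is encoded by its height above the last visit to the base and by the
    next \<open>B\<close> spacer numbers. The assumption on \<open>B\<close> leaves room for that
    height, which is below \<open>h n + S\<close>.\<close>
  let ?key = "\<lambda>x. (l x, rets n B (b x))"
  have key: "?key x \<in> ?K" if "x \<in> X" for x
    using bl[OF that] rets_lists[of "b x" n B] by (simp only: mem_Times_iff fst_conv snd_conv lessThan_iff)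
  have det: "?f x = ?f y" if xy: "x \<in> X" "y \<in> X" "?key x = ?key y" for x y
  proof (rule restrict_ext)
    fix k assume k: "k \<in> {1..N}"
    have "t k + l x < B * h n" using B[OF k] bl[OF xy(1)] by linarith
    then have "symbol n ((T ^^ (t k + l x)) (b x)) = symbol n ((T ^^ (t k + l x)) (b y))"
      using bl[OF xy(1)] bl[OF xy(2)] xy(3) by (intro sym_determined[of _ _ _ B]) auto
    moreover have "(T ^^ t k) x = (T ^^ (t k + l x)) (b x)" "(T ^^ t k) y = (T ^^ (t k + l x)) (b y)"
      using bl[OF xy(1)] bl[OF xy(2)] xy(3) by (simp_all add: funpow_add)
    ultimately show "symbol n ((T ^^ t k) x) = symbol n ((T ^^ t k) y)" by simp
  qed
  have "?f ` X \<subseteq> (\<lambda>c. ?f (SOME x. x \<in> X \<and> ?key x = c)) ` ?K"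
  proof
    fix z assume "z \<in> ?f ` X"
    then obtain x where x: "x \<in> X" "z = ?f x" by blast
    define y where "y = (SOME y. y \<in> X \<and> ?key y = ?key x)"
    have "y \<in> X \<and> ?key y = ?key x" unfolding y_def by (rule someI[of _ x]) (use x in simp)
    then have "z = ?f y" using det[of y x] x by simp
    then show "z \<in> (\<lambda>c. ?f (SOME x. x \<in> X \<and> ?key x = c)) ` ?K"
      unfolding y_def using key[OF x(1)] by (intro image_eqI[of _ _ "?key x"])
  qed
  from finite_subset[OF this finite_imageI[OF finK]] surj_card_le[OF finK this]
  have V: "finite (?f ` X)" "card (?f ` X) \<le> (h n + S) * S ^ B"
    unfolding cardK by blast+
  have "card (?f ` X) > 0" using V(1) zero_in_X by (auto simp: card_gt_0_iff)
  have "name_entropy M T t (symbol n) N \<le> ln (card (?f ` X))"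
    unfolding name_entropy_def
    by (rule rv_entropy_le_ln_card[of _ X])
      (use V(1) in \<open>auto intro!: simple_function_restrict_family simple_function_T_pow simp: prob_X\<close>)
  also have "\<dots> \<le> ln (real ((h n + S) * S ^ B))" using V(2) \<open>card (?f ` X) > 0\<close> 
    by (intro ln_mono) (simp_all only: of_nat_le_iff of_nat_0_less_iff)
  finally show ?thesis .
qed

lemma name_entropy_sym_mono:
  assumes "n \<le> m" shows "name_entropy M T t (symbol n) N \<le> name_entropy M T t (symbol m) N"
proof -
  obtain g where g: "\<And>x. symbol n x = g (symbol m x)" using sym_factor[OF assms] by blast
  let ?f = "\<lambda>x. \<lambda>k\<in>{1..N}. symbol m ((T ^^ t k) x)"
  have "name_entropy M T t (symbol n) N = rv_entropy M (\<lambda>x. (\<lambda>r. \<lambda>k\<in>{1..N}. g (r k)) (?f x))"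
    unfolding name_entropy_def
  proof (rule arg_cong[of _ _ "rv_entropy M"], rule ext, rule restrict_ext)
    fix x k assume "k \<in> {1..N}"
    then have "?f x k = symbol m ((T ^^ t k) x)" by (rule restrict_apply')
    then show "symbol n ((T ^^ t k) x) = g (?f x k)" by (simp only: g [symmetric])
  qed
  also have "\<dots> \<le> rv_entropy M ?f"
    by (intro rv_entropy_compose_le simple_function_restrict_family simple_function_T_pow) auto
  finally show ?thesis by (simp add: name_entropy_def)
qed

end

section \<open>Upper bound for the sequence entropy\<close>

lemma simple_function_if_fibres:
  assumes "finite (fibres M Y)" "fibres M Y \<subseteq> sets M" shows "simple_function M Y"
  unfolding simple_function_def
proof (intro conjI ballI)
  have "inj_on (\<lambda>v. Y -` {v} \<inter> space M) (Y ` space M)" by (auto simp: inj_on_def)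
  with assms(1) show "finite (Y ` space M)" unfolding fibres_def by (simp add: finite_image_iff)
  show "Y -` {v} \<inter> space M \<in> sets M" if "v \<in> Y ` space M" for v
    using assms(2) that by (auto simp: fibres_def)
qed

text \<open>This is \<open>ln y \<le> y - 1\<close> at \<open>y = 1 / sqrt x\<close>. It controls
  cells of small measure, the bound after it a cell of measure near 1.\<close>

lemma entropy_fun_le_sqrt: assumes "0 \<le> x" shows "entropy_fun x \<le> 2 * sqrt x"
proof (cases "x = 0")
  case False
  then have x: "x > 0" using assms by simp
  have "ln (1 / sqrt x) \<le> 1 / sqrt x - 1" using x by (intro ln_le_minus_one) simp
  then have "- ln x \<le> 2 * (1 / sqrt x)" using x by (simp add: ln_div ln_sqrt)
  then have "x * - ln x \<le> x * (2 * (1 / sqrt x))" using x by (intro mult_left_mono) auto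
  also have "\<dots> = 2 * (x / sqrt x)" by simp
  also have "\<dots> = 2 * sqrt x" using x by (simp only: real_div_sqrt less_imp_le)
  finally show ?thesis using x by (simp add: entropy_fun_def)
qed (simp add: entropy_fun_def)

lemma entropy_fun_le_one_minus: assumes "0 \<le> x" shows "entropy_fun x \<le> 1 - x"
proof (cases "x = 0")
  case False
  then have x: "x > 0" using assms by simp
  have "ln (1 / x) \<le> 1 / x - 1" using x by (intro ln_le_minus_one) simp
  then have "x * - ln x \<le> x * (1 / x - 1)" using x by (intro mult_left_mono) (auto simp: ln_div)
  also have "\<dots> = 1 - x" using x by (simp add: field_simps)
  finally show ?thesis using x by (simp add: entropy_fun_def)
qed (simp add: entropy_fun_def)

context cutting_stacking
begin

section \<open>Approximation of finite partitions by tower partitions\<close>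

lemma emeasure_M_le: assumes "B \<in> sets borel" shows "emeasure M B \<le> emeasure lborel B"
proof -
  have "1 = emeasure lborel (lev 0 0)" by (simp add: lev_def)
  also have "\<dots> \<le> emeasure lborel X" using lev_subset_X[OF h_pos[of 0]] by (intro emeasure_mono) auto
  finally have X1: "1 \<le> emeasure lborel X" .
  have "emeasure M B = emeasure lborel (X \<inter> B) / emeasure lborel X" using assms by (rule emeasure_M)
  also have "\<dots> \<le> emeasure lborel (X \<inter> B)"
  proof (rule divide_le_posI_ennreal)
    show "0 < emeasure lborel X" using X_emeasure(1) by (simp add: zero_less_iff_neq_zero)
    show "emeasure lborel (X \<inter> B) \<le> emeasure lborel X * emeasure lborel (X \<inter> B)"
      using mult_right_mono[OF X1, of "emeasure lborel (X \<inter> B)"] by simp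
  qed
  also have "\<dots> \<le> emeasure lborel B" using assms by (simp add: emeasure_mono)
  finally show ?thesis .
qed

text \<open>Each fibre of \<open>Y\<close> is approximated from outside by an open set, and this
  from inside by the levels it contains. Both errors are below \<open>d\<close>, whence the 2 in the
  choice of \<open>d\<close>.\<close>

lemma approximate_by_levels:
  assumes Y: "simple_function M Y" and "\<epsilon> > 0"
  obtains n \<phi> where "prob {x. Y x \<noteq> \<phi> (symbol n x)} < \<epsilon>"
proof -
  define V where "V = range Y"
  define A where "A v = Y -` {v}" for v
  have V: "finite V" "V \<noteq> {}" using Y by (auto simp: V_def simple_function_def)
  have A: "A v \<in> sets borel" if "v \<in> V" for v using Y that by (auto simp: A_def V_def simple_function_def)
  define d where "d = \<epsilon> / (2 * card V)"
  have d: "d > 0" using V \<open>\<epsilon> > 0\<close> by (simp add: d_def card_gt_0_iff)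
  have "\<exists>U. open U \<and> A v \<subseteq> U \<and> emeasure lborel (U - A v) < ennreal d" if "v \<in> V" for v
    using outer_regular_lborel[OF A[OF that] d] by metis
  then obtain U where U: "\<And>v. v \<in> V \<Longrightarrow> open (U v) \<and> A v \<subseteq> U v \<and> emeasure lborel (U v - A v) < ennreal d"
    by metis
  have Ub: "U v \<in> sets borel" if "v \<in> V" for v using U[OF that] by simp
  have UA: "prob (U v - A v) < d" if "v \<in> V" for v
  proof -
    have "emeasure M (U v - A v) < ennreal d"
      using emeasure_M_le[of "U v - A v"] U[OF that] A[OF that] Ub[OF that] by (auto intro: le_less_trans)
    then show ?thesis using d by (simp add: emeasure_eq_measure ennreal_less_iff)
  qed
  define C where "C v n = (\<Union>l\<in>{l. l < h n \<and> lev n l \<subseteq> U v}. lev n l)" for v n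
  have Cb: "C v n \<in> sets borel" for v n unfolding C_def by (intro sets.finite_UN) auto
  have CU: "C v n \<subseteq> U v" for v n unfolding C_def by blast
  have ev: "\<forall>\<^sub>F n in sequentially. prob (U v - C v n) < d" if v: "v \<in> V" for v
  proof -
    have inc: "incseq (C v)"
    proof (rule incseq_SucI, rule subsetI)
      fix n x assume "x \<in> C v n"
      then obtain l where l: "l < h n" "lev n l \<subseteq> U v" "x \<in> lev n l" by (auto simp: C_def)
      obtain l' where "l' < h (Suc n)" "x \<in> lev (Suc n) l'" "lev (Suc n) (l' + 0) \<subseteq> lev n (l + 0)"
        using lev_lift[OF l(3,1), of "Suc n"] l(1) by (metis add.right_neutral le_SucI order_refl)
      with l show "x \<in> C v (Suc n)" by (auto simp: C_def)
    qed
    have "(\<lambda>n. prob (C v n)) \<longlonglongrightarrow> prob (\<Union>n. C v n)"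
      using inc Cb by (intro finite_Lim_measure_incseq) auto
    also have "(\<Union>n. C v n) = U v \<inter> X" using open_inter_X[of "U v"] U[OF v] by (simp add: C_def)
    also have "prob (U v \<inter> X) = prob (U v)"
    proof (rule antisym)
      have "prob (U v) \<le> prob ((U v \<inter> X) \<union> (- X))" using Ub[OF v] by (intro finite_measure_mono) auto
      also have "\<dots> \<le> prob (U v \<inter> X) + prob (- X)" using Ub[OF v] by (intro measure_Un_le) auto
      also have "prob (- X) = 0" using null_outside_X by (simp add: null_sets_def measure_def)
      finally show "prob (U v) \<le> prob (U v \<inter> X)" by simp
    qed (use Ub[OF v] in \<open>auto intro!: finite_measure_mono\<close>)
    finally have "\<forall>\<^sub>F n in sequentially. prob (C v n) > prob (U v) - d"
      using d by (intro order_tendstoD(1)) auto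
    then show ?thesis
    proof eventually_elim
      case (elim n)
      then show ?case using finite_measure_Diff[of "U v" "C v n"] Cb CU Ub[OF v] by simp
    qed
  qed
  have "\<forall>\<^sub>F n in sequentially. \<forall>v\<in>V. prob (U v - C v n) < d"
    using V(1) ev by (intro eventually_ball_finite) auto
  then obtain n where n: "\<And>v. v \<in> V \<Longrightarrow> prob (U v - C v n) < d" by (auto simp: eventually_sequentially)
  \<comment> \<open>A level may lie in several \<open>U v\<close>. If it has a point outside the
    exceptional set \<open>?W\<close>, it lies in only one, because that point belongs to
    \<open>A v\<close> for each such \<open>v\<close>.\<close>
  define \<phi> where "\<phi> l = (THE v. v \<in> V \<and> lev n l \<subseteq> U v)" for l
  let ?W = "- X \<union> (\<Union>v\<in>V. (U v - A v) \<union> (U v - C v n))"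
  have "{x. Y x \<noteq> \<phi> (symbol n x)} \<subseteq> ?W"
  proof (rule subsetI, rule ccontr)
    fix x assume ne: "x \<in> {x. Y x \<noteq> \<phi> (symbol n x)}" and out: "x \<notin> ?W"
    have YV: "Y x \<in> V" "x \<in> A (Y x)" by (auto simp: V_def A_def)
    then have "x \<in> C (Y x) n" using out U by blast
    then obtain l where l: "l < h n" "lev n l \<subseteq> U (Y x)" "x \<in> lev n l" by (auto simp: C_def)
    have "\<phi> l = Y x"
      unfolding \<phi>_def
    proof (rule the_equality)
      fix v assume v: "v \<in> V \<and> lev n l \<subseteq> U v"
      then have "x \<in> A v" using l out by blast
      then show "v = Y x" by (simp add: A_def)
    qed (use YV l in blast)
    with sym_lev[OF l(1,3)] ne show False by simp
  qed
  then have "prob {x. Y x \<noteq> \<phi> (symbol n x)} \<le> prob ?W"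
    using V(1) A Ub Cb by (intro finite_measure_mono) (auto intro!: sets.Un sets.finite_UN sets.Diff borel_comp)
  also have "\<dots> \<le> prob (- X) + prob (\<Union>v\<in>V. (U v - A v) \<union> (U v - C v n))"
    using V(1) A Ub Cb by (intro measure_Un_le) (auto intro!: sets.Un sets.finite_UN sets.Diff borel_comp)
  also have "prob (- X) = 0" using null_outside_X by (simp add: null_sets_def measure_def)
  also have "prob (\<Union>v\<in>V. (U v - A v) \<union> (U v - C v n)) \<le> (\<Sum>v\<in>V. prob ((U v - A v) \<union> (U v - C v n)))"
    using V(1) A Ub Cb by (intro finite_measure_subadditive_finite) (auto intro!: sets.Un sets.Diff)
  also have "\<dots> < (\<Sum>v\<in>V. d + d)"
  proof (rule sum_strict_mono)
    fix v assume v: "v \<in> V"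
    have "prob ((U v - A v) \<union> (U v - C v n)) \<le> prob (U v - A v) + prob (U v - C v n)"
      using v A Ub Cb by (intro measure_Un_le) auto
    with UA[OF v] n[OF v] show "prob ((U v - A v) \<union> (U v - C v n)) < d + d" by simp
  qed (use V in auto)
  also have "\<dots> = \<epsilon>" using V by (simp add: d_def card_gt_0_iff)
  finally show ?thesis by (intro that[of \<phi> n]) simp
qed

text \<open>\<open>Y\<close> is a function of \<open>Y'\<close> and \<open>Z\<close>, and by
  invariance \<open>Z\<close> has the same entropy at every time. Replacing a partition thus has a
  price per sample that does not depend on \<open>t\<close>.\<close>

lemma name_entropy_correction_le:
  assumes Y: "simple_function M Y" and Z: "simple_function M Z" and Y': "simple_function M Y'"
    and eq: "\<And>x. Y x = g (Y' x) (Z x)"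
  shows "name_entropy M T t Y N \<le> name_entropy M T t Y' N + real N * rv_entropy M Z"
proof -
  let ?f = "\<lambda>Y x. \<lambda>k\<in>{1..N}. Y ((T ^^ t k) x)"
  have sf: "simple_function M (?f Z)" "simple_function M (?f Y')"
    using Z Y' by (auto intro!: simple_function_restrict_family simple_function_T_pow)
  have "?f Y = (\<lambda>x. (\<lambda>(r, s). \<lambda>k\<in>{1..N}. g (r k) (s k)) (?f Y' x, ?f Z x))"
  proof
    fix x
    show "?f Y x = (\<lambda>(r, s). \<lambda>k\<in>{1..N}. g (r k) (s k)) (?f Y' x, ?f Z x)"
      unfolding prod.case by (rule restrict_ext) (simp only: eq restrict_apply')
  qed
  then have "name_entropy M T t Y N
      = rv_entropy M (\<lambda>x. (\<lambda>(r, s). \<lambda>k\<in>{1..N}. g (r k) (s k)) (?f Y' x, ?f Z x))"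
    unfolding name_entropy_def by (rule arg_cong)
  also have "\<dots> \<le> rv_entropy M (\<lambda>x. (?f Y' x, ?f Z x))"
    by (intro rv_entropy_compose_le simple_function_Pair sf)
  also have "\<dots> \<le> rv_entropy M (?f Y') + rv_entropy M (?f Z)" by (intro rv_entropy_Pair_le sf)
  also have "rv_entropy M (?f Z) \<le> (\<Sum>k\<in>{1..N}. rv_entropy M (\<lambda>x. Z ((T ^^ t k) x)))"
    by (intro rv_entropy_family_le simple_function_T_pow Z) auto
  also have "\<dots> = real N * rv_entropy M Z" by (simp add: rv_entropy_T_pow[OF Z])
  finally show ?thesis by (simp only: name_entropy_def)
qed

text \<open>\<open>Z\<close> reports the true value only where the guess \<open>\<phi>\<close> from
  the level fails, so nearly all mass sits at \<open>None\<close>.\<close>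

lemma small_correction:
  assumes Y: "simple_function M Y" and "\<epsilon> > 0"
  shows "\<exists>n \<phi> Z. simple_function M Z \<and> rv_entropy M Z \<le> \<epsilon> \<and>
    (\<forall>x. Y x = (case Z x of None \<Rightarrow> \<phi> (symbol n x) | Some y \<Rightarrow> y))"
proof -
  define c where "c = real (card (range Y)) + 1"
  have finY: "finite (range Y)" using Y by (simp add: simple_function_def)
  have c: "c > 0" by (simp add: c_def)
  \<comment> \<open>The first term serves \<open>None\<close>, of measure near 1, the second the
    remaining values through the square root bound. Each of the at most \<open>c\<close> values then
    contributes at most \<open>\<epsilon> / c\<close>.\<close>
  define d where "d = min (\<epsilon> / c) ((\<epsilon> / c / 2)\<^sup>2)"
  have d: "d > 0" using \<open>\<epsilon> > 0\<close> c by (simp add: d_def)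
  obtain n \<phi> where n: "prob {x. Y x \<noteq> \<phi> (symbol n x)} < d" using approximate_by_levels[OF Y d] .
  define Z where "Z x = (if Y x = \<phi> (symbol n x) then None else Some (Y x))" for x
  have Zeq: "Z = (\<lambda>x. (\<lambda>(y, s). if y = \<phi> s then None else Some y) (Y x, symbol n x))"
    by (auto simp: Z_def)
  have sZ: "simple_function M Z"
    unfolding Zeq
    using simple_function_compose[OF simple_function_Pair[OF Y simple_function_sym[of n]],
        of "\<lambda>(y, s). if y = \<phi> s then None else Some y"] by (simp add: comp_def)
  let ?bad = "{x. Y x \<noteq> \<phi> (symbol n x)}"
  have bad: "Z -` {None} = UNIV - ?bad" by (auto simp: Z_def)
  have good_ev: "Z -` {None} \<in> sets borel" using simple_functionD(2)[OF sZ, of "{None}"] by simp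
  moreover have "?bad = UNIV - Z -` {None}" by (auto simp: Z_def)
  ultimately have bad_ev: "?bad \<in> sets borel" by simp
  have f: "entropy_fun (prob (Z -` {z})) \<le> \<epsilon> / c" for z
  proof (cases z)
    case None
    have "prob (Z -` {None}) = 1 - prob ?bad" unfolding bad using prob_compl[of ?bad] bad_ev by simp
    then have "entropy_fun (prob (Z -` {z})) \<le> prob ?bad"
      using entropy_fun_le_one_minus[of "prob (Z -` {None})"] None by simp
    with n show ?thesis by (simp add: d_def)
  next
    case (Some y)
    then have "prob (Z -` {z}) \<le> prob ?bad"
      using bad_ev by (intro finite_measure_mono) (auto simp: Z_def split: if_splits)
    then have "prob (Z -` {z}) \<le> (\<epsilon> / c / 2)\<^sup>2" using n by (simp add: d_def)
    then have "sqrt (prob (Z -` {z})) \<le> \<epsilon> / c / 2"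
      using \<open>\<epsilon> > 0\<close> c by (intro real_le_lsqrt) auto
    with entropy_fun_le_sqrt[of "prob (Z -` {z})"] show ?thesis by simp
  qed
  have "range Z \<subseteq> insert None (Some ` range Y)" by (auto simp: Z_def)
  then have "card (range Z) \<le> card (insert None (Some ` range Y))" using finY by (intro card_mono) auto
  also have "\<dots> = card (range Y) + 1"
    using finY by (subst card_insert_disjoint) (auto simp: card_image)
  finally have card: "real (card (range Z)) \<le> c" by (simp add: c_def)
  have "rv_entropy M Z \<le> (\<Sum>z\<in>range Z. \<epsilon> / c)" 
    unfolding rv_entropy_def space_M Int_UNIV_right by (rule sum_mono) (rule f)
  also have "\<dots> = real (card (range Z)) * (\<epsilon> / c)" by simp
  also have "\<dots> \<le> c * (\<epsilon> / c)" using card \<open>\<epsilon> > 0\<close> c by (intro mult_right_mono) auto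
  also have "\<dots> = \<epsilon>" using c by simp
  finally have "rv_entropy M Z \<le> \<epsilon>" .
  then show ?thesis using sZ by (intro exI[of _ n] exI[of _ \<phi>] exI[of _ Z]) (auto simp: Z_def)
qed

text \<open>The stage used for counting may vary with \<open>N\<close>: later towers refine earlier
  ones, so any stage from \<open>n\<^sub>0\<close> on bounds the names of the fixed stage that
  approximates the given partition.\<close>

lemma sequence_entropy_le:
  assumes bound: "\<And>n\<^sub>0 \<epsilon>. \<epsilon> > 0 \<Longrightarrow> \<forall>\<^sub>F N in sequentially. \<exists>n\<ge>n\<^sub>0. \<exists>B.
     (\<forall>k\<in>{1..N}. t k + h n + S \<le> B * h n) \<and> ln (real ((h n + S) * S ^ B)) \<le> (v + \<epsilon>) * real N"
  shows "sequence_entropy M T t \<le> ereal v"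
  unfolding sequence_entropy_def
proof (rule SUP_least)
  fix \<xi> assume "\<xi> \<in> {\<xi>. finite_measurable_partition M \<xi>}"
  then have \<xi>: "finite \<xi>" "\<xi> \<subseteq> sets M" "partition_on (space M) \<xi>"
    by (auto simp: finite_measurable_partition_def)
  define Y where "Y x = (THE B. B \<in> \<xi> \<and> x \<in> B)" for x
  have fib: "\<xi> = fibres M Y" using partition_on_eq_fibres[OF \<xi>(3)] by (simp add: Y_def[abs_def])
  have Y: "simple_function M Y" using simple_function_if_fibres \<xi> fib by blast
  have "limsup (\<lambda>N. ereal (name_entropy M T t Y N / real N)) \<le> ereal v + ereal e" if "e > 0" for e
  proof -
    obtain n\<^sub>0 \<phi> Z where Z: "simple_function M Z" "rv_entropy M Z \<le> e / 2"
      "\<forall>x. Y x = (case Z x of None \<Rightarrow> \<phi> (symbol n\<^sub>0 x) | Some y \<Rightarrow> y)"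
      using small_correction[OF Y half_gt_zero[OF \<open>e > 0\<close>]] by (elim exE conjE)
    have le: "name_entropy M T t Y N \<le> name_entropy M T t (symbol n\<^sub>0) N + real N * rv_entropy M Z" for N
      by (rule name_entropy_correction_le[OF Y Z(1) simple_function_sym,
            where g = "\<lambda>s z. case z of None \<Rightarrow> \<phi> s | Some y \<Rightarrow> y"]) (rule Z(3)[rule_format])
    have "\<forall>\<^sub>F N in sequentially. ereal (name_entropy M T t Y N / real N) \<le> ereal (v + e)"
      using bound[OF half_gt_zero[OF \<open>e > 0\<close>], of n\<^sub>0] eventually_gt_at_top[of 0]
    proof eventually_elim
      case (elim N)
      then obtain n B where nB: "n \<ge> n\<^sub>0" "\<And>k. k \<in> {1..N} \<Longrightarrow> t k + h n + S \<le> B * h n"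
        "ln (real ((h n + S) * S ^ B)) \<le> (v + e / 2) * real N" by blast
      have "name_entropy M T t (symbol n\<^sub>0) N \<le> (v + e / 2) * real N"
        using name_entropy_sym_mono[OF nB(1), of t N] name_entropy_sym_le[of N t n B] nB(2,3) by force
      moreover have "real N * rv_entropy M Z \<le> real N * (e / 2)" using Z(2) by (intro mult_left_mono) auto
      ultimately have "name_entropy M T t Y N \<le> (v + e) * real N" using le[of N] by (simp add: algebra_simps)
      then show ?case using elim(2) by (simp add: field_simps)
    qed
    then have "limsup (\<lambda>N. ereal (name_entropy M T t Y N / real N)) \<le> ereal (v + e)"
      by (rule Limsup_bounded)
    then show ?thesis by simp
  qed
  then have "limsup (\<lambda>N. ereal (name_entropy M T t Y N / real N)) \<le> ereal v"
    by (rule ereal_le_epsilon2)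
  then show "sequence_entropy_partition M T t \<xi> \<le> ereal v"
    unfolding fib using sequence_entropy_fibres[of T M t Y] T_surj by simp
qed

end

section \<open>Lower bound for the sequence entropy\<close>

text \<open>Adjoin the indicator of \<open>G\<close>, at a cost of at most \<open>ln 2\<close>. The
  parts of \<open>G\<close> on which \<open>Y\<close> is constant have measure at most
  \<open>c\<close>, so each contributes at least its measure times \<open>- ln c\<close>.\<close>

lemma (in prob_space) rv_entropy_ge:
  assumes Y: "simple_function M Y" and G: "G \<in> events" and c: "0 < c"
    and le: "\<And>v. prob (Y -` {v} \<inter> space M \<inter> G) \<le> c"
  shows "prob G * (- ln c) - ln 2 \<le> rv_entropy M Y"
proof -
  let ?Z = "\<lambda>x. (Y x, x \<in> G)"
  let ?p = "\<lambda>v. prob (Y -` {v} \<inter> space M \<inter> G)"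
  have sG: "simple_function M (\<lambda>x. x \<in> G)"
    unfolding simple_function_def
  proof (intro conjI ballI)
    fix b assume "b \<in> (\<lambda>x. x \<in> G) ` space M"
    have "(\<lambda>x. x \<in> G) -` {b} \<inter> space M = (if b then G \<inter> space M else space M - G)" by auto
    then show "(\<lambda>x. x \<in> G) -` {b} \<inter> space M \<in> events" using G by simp
  qed (rule finite_subset[of _ UNIV], auto)
  have sZ: "simple_function M ?Z" by (intro simple_function_Pair Y sG)
  have finY: "finite (Y ` space M)" and finZ: "finite (?Z ` space M)"
    using Y sZ by (auto simp: simple_function_def)
  have Yev: "Y -` {v} \<inter> space M \<inter> G \<in> events" for v
    using simple_functionD(2)[OF Y, of "{v}"] G by (auto intro: sets.Int)
  have f_nonneg: "0 \<le> entropy_fun x" if "0 \<le> x" "x \<le> 1" for x :: real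
    using that by (auto simp: entropy_fun_def mult_nonneg_nonpos)
  have f_ge: "x * (- ln c) \<le> entropy_fun x" if "0 \<le> x" "x \<le> c" for x
  proof (cases "x = 0")
    case False
    then have "ln x \<le> ln c" using that c by (intro ln_mono) auto
    then have "x * ln x \<le> x * ln c" using that by (intro mult_left_mono) auto
    then show ?thesis using False by (simp add: entropy_fun_def)
  qed (simp add: entropy_fun_def)
  have vim: "?Z -` {(v, True)} \<inter> space M = Y -` {v} \<inter> space M \<inter> G" for v by auto
  have "prob G = prob (\<Union>v\<in>Y ` space M. Y -` {v} \<inter> space M \<inter> G)"
    using sets.sets_into_space[OF G] by (intro arg_cong[of _ _ prob]) auto
  also have "\<dots> = (\<Sum>v\<in>Y ` space M. ?p v)"
    using finY Yev by (intro finite_measure_finite_Union) (auto simp: disjoint_family_on_def)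
  finally have "prob G * (- ln c) = (\<Sum>v\<in>Y ` space M. ?p v * (- ln c))" by (simp only: sum_distrib_right)
  also have "\<dots> \<le> (\<Sum>v\<in>Y ` space M. entropy_fun (?p v))"
    using f_ge le by (intro sum_mono) auto
  also have "\<dots> = (\<Sum>z\<in>(\<lambda>v. (v, True)) ` Y ` space M. entropy_fun (prob (?Z -` {z} \<inter> space M)))"
    unfolding vim[symmetric] by (subst (2) sum.reindex) (auto simp: inj_on_def)
  also have "\<dots> = (\<Sum>z\<in>(\<lambda>v. (v, True)) ` Y ` space M \<inter> ?Z ` space M. entropy_fun (prob (?Z -` {z} \<inter> space M)))"
  proof (intro sum.mono_neutral_right ballI)
    fix z assume "z \<in> (\<lambda>v. (v, True)) ` Y ` space M - (\<lambda>v. (v, True)) ` Y ` space M \<inter> ?Z ` space M"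
    then have "z \<notin> ?Z ` space M" by blast
    then have "?Z -` {z} \<inter> space M = {}" by blast
    then show "entropy_fun (prob (?Z -` {z} \<inter> space M)) = 0" by (simp only: measure_empty) (simp add: entropy_fun_def)
  qed (use finY in auto)
  also have "\<dots> \<le> (\<Sum>z\<in>?Z ` space M. entropy_fun (prob (?Z -` {z} \<inter> space M)))"
    using finZ by (intro sum_mono2) (auto intro: f_nonneg)
  also have "\<dots> = rv_entropy M ?Z" by (simp add: rv_entropy_def)
  also have "\<dots> \<le> rv_entropy M Y + rv_entropy M (\<lambda>x. x \<in> G)" by (intro rv_entropy_Pair_le Y sG)
  also have "rv_entropy M (\<lambda>x. x \<in> G) \<le> ln (card (UNIV :: bool set))"
    by (rule rv_entropy_le_ln_card[OF sG, of "space M"]) (auto simp: prob_space)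
  finally show ?thesis by (simp add: card_UNIV_bool)
qed

lemma finite_measurable_partition_fibres:
  assumes "simple_function M Y" shows "finite_measurable_partition M (fibres M Y)"
  using assms unfolding finite_measurable_partition_def fibres_def simple_function_def partition_on_def disjoint_def
  by auto

lemma eq_if_digits_eq:
  fixes x y :: nat
  assumes "x < S ^ m" "y < S ^ m" "\<And>c. c < m \<Longrightarrow> x div S ^ c mod S = y div S ^ c mod S"
  shows "x = y"
  using assms
proof (induction m arbitrary: x y)
  case (Suc m)
  have "x div S = y div S"
  proof (rule Suc.IH)
    show "x div S < S ^ m" "y div S < S ^ m"
      using Suc.prems(1,2) by (auto intro!: less_mult_imp_div_less simp: mult.commute)
    show "x div S div S ^ c mod S = y div S div S ^ c mod S" if "c < m" for c
      using Suc.prems(3)[of "Suc c"] that by (simp add: div_mult2_eq)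
  qed
  moreover have "x mod S = y mod S" using Suc.prems(3)[of 0] by simp
  ultimately show ?case by (metis div_mult_mod_eq)
qed simp

context cutting_stacking
begin

section \<open>The floor as height above the base of the first tower\<close>

lemma w_le_1: "w n \<le> 1" using w_antimono[of 0 n] by simp

lemma floor_lev: "x \<in> lev n l \<Longrightarrow> y \<in> lev n l \<Longrightarrow> \<lfloor>x\<rfloor> = \<lfloor>y\<rfloor>"
proof (induction n arbitrary: l)
  case 0
  then have "\<lfloor>x\<rfloor> = int l" "\<lfloor>y\<rfloor> = int l" by (auto simp: lev_def floor_eq_iff)
  then show ?case by simp
next
  case (Suc n)
  obtain i k where "l = start n i + k" "in_copy n i k" using level_decomp by metis
  with Suc lev_Suc_subset show ?case by blast
qed

lemma floor_top: assumes "x \<in> lev n (h n - 1 + d)" shows "\<lfloor>x\<rfloor> = int (h 0 - 1 + d)"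
  using assms w_le_1[of n] h_pos[of 0] unfolding lev_def e_top by (auto simp: floor_eq_iff of_nat_diff)

lemma floor_bottom: assumes "x \<in> lev n 0" shows "\<lfloor>x\<rfloor> = 0"
  using assms w_le_1[of n] by (auto simp: lev_bottom floor_eq_iff)

text \<open>A step goes up in the first tower, onto the next spacer, or down to the base of a new
  copy. The last happens only at a top level or at a spacer above one, where the floor is at least
  \<open>h 0 - 1\<close>.\<close>

lemma floor_T:
  assumes "x \<in> X" shows "\<lfloor>T x\<rfloor> = \<lfloor>x\<rfloor> + 1 \<or> \<lfloor>T x\<rfloor> = 0 \<and> int (h 0) - 1 \<le> \<lfloor>x\<rfloor>"
proof -
  have "\<lfloor>T x\<rfloor> = \<lfloor>x\<rfloor> + 1 \<or> \<lfloor>T x\<rfloor> = 0 \<and> int (h 0) - 1 \<le> \<lfloor>x\<rfloor>" if "l + 1 < h n" "x \<in> lev n l" for n l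
    using that
  proof (induction n arbitrary: l)
    case 0
    then have "T x = x + 1" using T_lev[OF 0] by simp
    then show ?case by simp
  next
    case (Suc n)
    obtain i k where ik: "l = start n i + k" "in_copy n i k" "k < h n \<or> i < q n - 1 \<and> k < h n + a n i"
      using level_decomp[of l n] Suc.prems by (metis add_lessD1)
    have xk: "x \<in> lev n k" using lev_Suc_subset[OF ik(2)] Suc.prems(2) ik(1) by blast
    have Tx: "T x \<in> lev (Suc n) (l + 1)" by (rule T_in_lev[OF Suc.prems])
    show ?case
    proof (cases "k + 1 < h n")
      case True
      then show ?thesis using Suc.IH[of k] xk by blast
    next
      case False
      define d where "d = k - (h n - 1)"
      have k: "k = h n - 1 + d" "k + 1 = h n - 1 + (d + 1)" using False by (auto simp: d_def)
      have iq: "i < q n - 1"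
      proof (rule ccontr)
        assume "\<not> i < q n - 1"
        then have "i = q n - 1" "k < h n" using ik by (auto simp: in_copy_def)
        then show False using Suc.prems(1) False ik(1) by (simp add: h_Suc_start)
      qed
      have fx: "\<lfloor>x\<rfloor> = int (h 0 - 1 + d)" using floor_top xk unfolding k(1) by blast
      show ?thesis
      proof (cases "k + 1 < h n + a n i")
        case True
        have "in_copy n i (k + 1)" using True iq by (auto simp: in_copy_def)
        from lev_Suc_subset[OF this] Tx have "T x \<in> lev n (k + 1)" by (auto simp: ik(1) add.assoc)
        then have "\<lfloor>T x\<rfloor> = int (h 0 - 1 + (d + 1))" unfolding k(2) by (rule floor_top)
        with fx show ?thesis by simp
      next
        case 2: False
        then have "k + 1 = h n + a n i" using ik(3) False by auto
        then have "l + 1 = start n (Suc i) + 0" using ik(1) by (simp add: start_Suc)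
        moreover have "lev (Suc n) (start n (Suc i) + 0) \<subseteq> lev n 0"
          using iq h_pos[of n] by (intro lev_Suc_subset in_copyI) auto
        ultimately have "\<lfloor>T x\<rfloor> = 0" using Tx floor_bottom by auto
        with fx show ?thesis using h_pos[of 0] by (simp add: of_nat_diff)
      qed
    qed
  qed
  moreover obtain n l where "l + 1 < h n" "x \<in> lev n l" using X_not_top[OF assms, of 0] by blast
  ultimately show ?thesis by blast
qed

text \<open>Without a reset the floor has grown by \<open>d\<close>. After a reset it is below
  \<open>d\<close>, while it began at \<open>h 0 - d\<close> or more, and this exceeds
  \<open>d\<close> because \<open>h 0 = 2 * S\<close> and \<open>d < S\<close>.\<close>

lemma floor_T_pow_neq:
  assumes "x \<in> X" "0 < d" "d < S" shows "\<lfloor>(T ^^ d) x\<rfloor> \<noteq> \<lfloor>x\<rfloor>"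
proof -
  have x0: "0 \<le> \<lfloor>x\<rfloor>" using assms(1) X_bounds by auto
  have "\<lfloor>(T ^^ d) x\<rfloor> = \<lfloor>x\<rfloor> + int d \<or> \<lfloor>(T ^^ d) x\<rfloor> < int d \<and> int (h 0) \<le> \<lfloor>x\<rfloor> + int d" for d
  proof (induction d)
    case (Suc d)
    have "\<lfloor>(T ^^ Suc d) x\<rfloor> = \<lfloor>(T ^^ d) x\<rfloor> + 1 \<or> \<lfloor>(T ^^ Suc d) x\<rfloor> = 0 \<and> int (h 0) - 1 \<le> \<lfloor>(T ^^ d) x\<rfloor>"
      using floor_T[OF T_pow_in_X[OF assms(1), of d]] by simp
    with Suc show ?case by linarith
  qed simp
  from this[of d] show ?thesis using assms(2,3) h_0 by linarith
qed

section \<open>Reading spacers from the samples\<close>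

lemma start_add: "start n (i + b) = start n i + (\<Sum>j<b. h n + a n (i + j))"
  by (induction b) (auto simp: start_Suc)

lemma position_in_block:
  assumes "x \<in> lev (Suc n) (start n i + p)" "i + b < q n" "l < h n" "start n i + p + k = start n (i + b) + l"
  shows "(T ^^ k) x \<in> lev n l"
proof -
  have "start n i + p + k < h (Suc n)" using assms start_less_h by metis
  from T_pow_lev[OF this assms(1)] have "(T ^^ k) x \<in> lev (Suc n) (start n (i + b) + l)"
    unfolding assms(4) by blast
  then show ?thesis using lev_Suc_subset[OF in_copyI[OF assms(2,3)]] by blast
qed

text \<open>The window for \<open>k\<close> lies after both spacer gaps and before either orbit
  leaves the following copy. The heights in that copy then differ by the difference of the two
  spacer numbers, which is positive and below \<open>S\<close>, so the floors differ.\<close>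

lemma floor_neq_if_spacers_differ:
  assumes x: "x \<in> lev (Suc n) (start n i + p)" "x' \<in> lev (Suc n) (start n i' + p)"
    and i: "i + Suc b < q n" "i' + Suc b < q n"
    and D: "start n (i + b) = start n i + D" "start n (i' + b) = start n i' + D"
    and k: "D + h n + S \<le> k + p" "k + p < D + h n + h n"
    and less: "a n (i + b) < a n (i' + b)"
  shows "\<lfloor>(T ^^ k) x\<rfloor> \<noteq> \<lfloor>(T ^^ k) x'\<rfloor>"
proof -
  define u where "u = a n (i + b)"
  define u' where "u' = a n (i' + b)"
  define l where "l = k + p - (D + h n + u)"
  define l' where "l' = k + p - (D + h n + u')"
  have u: "u < u'" "u' < S" using less a_less[of n "i' + b"] by (auto simp: u_def u'_def)
  have l: "k + p = D + h n + u + l" "k + p = D + h n + u' + l'" using k u by (auto simp: l_def l'_def)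
  have lh: "l < h n" "l' < h n" using l k by linarith+
  have ll': "l = l' + (u' - u)" using l u by linarith
  have start_b: "start n (i + Suc b) = start n i + D + h n + u"
    "start n (i' + Suc b) = start n i' + D + h n + u'"
    using D start_Suc[of n "i + b"] start_Suc[of n "i' + b"] by (simp_all add: u_def u'_def)
  have "start n i + p + k = start n (i + Suc b) + l" "start n i' + p + k = start n (i' + Suc b) + l'"
    using l start_b by linarith+
  then have 1: "(T ^^ k) x \<in> lev n l" and 2: "(T ^^ k) x' \<in> lev n l'"
    using position_in_block[OF x(1) i(1) lh(1)] position_in_block[OF x(2) i(2) lh(2)] by auto
  have "(T ^^ (u' - u)) ((T ^^ k) x') \<in> lev n l"
    using T_pow_lev[OF _ 2, of "u' - u"] lh(1) unfolding ll' by blast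
  then have "\<lfloor>(T ^^ (u' - u)) ((T ^^ k) x')\<rfloor> = \<lfloor>(T ^^ k) x\<rfloor>" using floor_lev 1 by blast
  moreover have "(T ^^ k) x' \<in> X" using 2 lh lev_subset_X by blast
  then have "\<lfloor>(T ^^ (u' - u)) ((T ^^ k) x')\<rfloor> \<noteq> \<lfloor>(T ^^ k) x'\<rfloor>" using u by (intro floor_T_pow_neq) auto
  ultimately show ?thesis by simp
qed

text \<open>Strong induction: equal earlier spacers give both orbits the same offset
  \<open>D\<close>. The first sample with \<open>t k + p \<ge> D + h n + S\<close> is still in the
  window of \<open>floor_neq_if_spacers_differ\<close>, because the gaps of \<open>t\<close> are at
  most \<open>h n - 2 * S\<close>; different spacers would thus show in the names.\<close>

lemma spacers_determined:
  assumes x: "x \<in> lev (Suc n) (start n i + p)" "x' \<in> lev (Suc n) (start n i' + p)" "p < h n"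
    and i: "i + B < q n" "i' + B < q n"
    and t: "t 1 \<le> 1" "\<And>k. 1 \<le> k \<Longrightarrow> k < N \<Longrightarrow> t (Suc k) + 2 * S \<le> t k + h n"
      "B * (h n + S) \<le> t N" "N \<ge> 1"
    and names: "\<And>k. k \<in> {1..N} \<Longrightarrow> \<lfloor>(T ^^ t k) x\<rfloor> = \<lfloor>(T ^^ t k) x'\<rfloor>"
  shows "b < B \<Longrightarrow> a n (i + b) = a n (i' + b)"
proof (induction b rule: less_induct)
  case (less b)
  define D where "D = (\<Sum>j<b. h n + a n (i + j))"
  have D: "start n (i + b) = start n i + D" by (simp add: D_def start_add)
  have "D = (\<Sum>j<b. h n + a n (i' + j))" unfolding D_def using less by (intro sum.cong) auto
  then have D': "start n (i' + b) = start n i' + D" by (simp add: start_add)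
  have "D \<le> (\<Sum>j<b. h n + S)" unfolding D_def using a_less by (intro sum_mono) (simp add: less_imp_le)
  then have "D + (h n + S) \<le> Suc b * (h n + S)" by simp
  also have "\<dots> \<le> B * (h n + S)" using less.prems by (intro mult_right_mono) auto
  finally have DN: "D + h n + S \<le> t N + p" using t(3) by simp
  define P where "P k \<longleftrightarrow> 1 \<le> k \<and> D + h n + S \<le> t k + p" for k
  define k where "k = (LEAST k. P k)"
  have "P N" using DN t(4) by (simp add: P_def)
  then have "P k" "k \<le> N" unfolding k_def by (rule LeastI, rule Least_le)
  then have k: "1 \<le> k" "D + h n + S \<le> t k + p" "k \<le> N" by (auto simp: P_def)
  have "k \<noteq> 1" using k(2) t(1) x(3) S_pos by auto
  then obtain k' where k': "k = Suc k'" "1 \<le> k'" using k(1) by (cases k) auto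
  have "\<not> D + h n + S \<le> t k' + p"
    using not_less_Least[of k' P, folded k_def] k' by (simp add: P_def)
  then have upper: "t k + p < D + h n + h n" using t(2)[of k'] k' k(3) by simp
  have "i + Suc b < q n" "i' + Suc b < q n" using less.prems i by auto
  note * = floor_neq_if_spacers_differ[OF x(1,2) this D D' k(2) upper]
    floor_neq_if_spacers_differ[OF x(2,1) this(2,1) D' D k(2) upper]
  have "\<lfloor>(T ^^ t k) x\<rfloor> = \<lfloor>(T ^^ t k) x'\<rfloor>" using names[of k] k by simp
  with * show ?case by (metis linorder_neqE_nat)
qed

definition whole :: real where "whole = measure lborel X"

lemma whole_pos: "whole > 0"
  using X_emeasure by (simp add: whole_def measure_def enn2real_positive_iff less_top zero_less_iff_neq_zero)

lemma prob_lev: assumes "l < h n" shows "prob (lev n l) = w n / whole"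
proof -
  have "X \<inter> lev n l = lev n l" using lev_subset_X[OF assms] by blast
  moreover have "measure lborel (lev n l) = w n" using w_pos[of n] by (simp add: lev_def)
  ultimately show ?thesis unfolding M_def whole_def
    using X_emeasure by (subst measure_uniform_measure) auto
qed

lemma prob_levels:
  assumes "finite L" "L \<subseteq> {..<h n}" shows "prob (\<Union>l\<in>L. lev n l) = card L * (w n / whole)"
proof -
  have "prob (\<Union>l\<in>L. lev n l) = (\<Sum>l\<in>L. prob (lev n l))"
    using assms lev_disjoint by (intro finite_measure_finite_Union) (auto simp: disjoint_family_on_def)
  also have "\<dots> = (\<Sum>l\<in>L. w n / whole)" using assms prob_lev by (intro sum.cong) auto
  finally show ?thesis by simp
qed

lemma prob_tower_tendsto: "(\<lambda>n. prob (\<Union>l<h n. lev n l)) \<longlonglongrightarrow> 1"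
proof -
  have "incseq (\<lambda>n. \<Union>l<h n. lev n l)" using tower_mono by (intro incseq_SucI) auto
  then have "(\<lambda>n. prob (\<Union>l<h n. lev n l)) \<longlonglongrightarrow> prob (\<Union>n. \<Union>l<h n. lev n l)"
    by (intro finite_Lim_measure_incseq) (auto intro!: sets.finite_UN)
  then show ?thesis using prob_X by (simp add: X_def)
qed

text \<open>Points outside \<open>X\<close> share the value -1, which is not taken on
  \<open>X\<close>; the range is therefore finite.\<close>

definition floor_sym :: "real \<Rightarrow> int" where "floor_sym x = (if x \<in> X then \<lfloor>x\<rfloor> else - 1)"

lemma simple_function_floor_sym: "simple_function M floor_sym"
  unfolding simple_function_def
proof (intro conjI ballI)
  show "finite (floor_sym ` space M)"
  proof (rule finite_subset)
    show "floor_sym ` space M \<subseteq> {-1..int (h 0 + S)}"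
    proof (rule image_subsetI)
      fix x show "floor_sym x \<in> {-1..int (h 0 + S)}"
      proof (cases "x \<in> X")
        case True
        then have "0 \<le> x" "x < real (h 0 + S)" using X_bounds by auto
        then have "- 1 \<le> \<lfloor>x\<rfloor>" "\<lfloor>x\<rfloor> \<le> int (h 0 + S)" by linarith+
        with True show ?thesis by (simp add: floor_sym_def)
      qed (simp add: floor_sym_def)
    qed
  qed simp
  fix v assume "v \<in> floor_sym ` space M"
  have "floor_sym -` {v} = (X \<inter> {x. \<lfloor>x\<rfloor> = v}) \<union> (if v = - 1 then - X else {})"
    using X_bounds by (auto simp: floor_sym_def split: if_splits)
  moreover have "{x. \<lfloor>x\<rfloor> = v} = {of_int v..<of_int v + 1 :: real}" by (auto simp: floor_eq_iff)
  ultimately show "floor_sym -` {v} \<inter> space M \<in> sets M" by (auto intro!: sets.Un sets.Int borel_comp)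
qed

lemma le_sequence_entropy:
  assumes "\<And>\<epsilon>. \<epsilon> > 0 \<Longrightarrow> \<exists>\<^sub>F N in sequentially. (v - \<epsilon>) * real N \<le> name_entropy M T t floor_sym N"
  shows "ereal v \<le> sequence_entropy M T t"
proof -
  have "ereal v \<le> limsup (\<lambda>N. ereal (name_entropy M T t floor_sym N / real N)) + ereal e" if "e > 0" for e
  proof (rule ccontr)
    assume "\<not> ?thesis"
    then have "limsup (\<lambda>N. ereal (name_entropy M T t floor_sym N / real N)) < ereal (v - e)"
      by (cases "limsup (\<lambda>N. ereal (name_entropy M T t floor_sym N / real N))") auto
    then have "\<forall>\<^sub>F N in sequentially. ereal (name_entropy M T t floor_sym N / real N) < ereal (v - e)"
      by (rule Limsup_lessD)
    then have "\<forall>\<^sub>F N in sequentially. name_entropy M T t floor_sym N < (v - e) * real N"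
      using eventually_gt_at_top[of 0] by eventually_elim (simp add: field_simps)
    then have "\<not> (\<exists>\<^sub>F N in sequentially. (v - e) * real N \<le> name_entropy M T t floor_sym N)"
      unfolding not_frequently by eventually_elim simp
    with assms[OF that] show False by blast
  qed
  then have "ereal v \<le> limsup (\<lambda>N. ereal (name_entropy M T t floor_sym N / real N))"
    by (rule ereal_le_epsilon2)
  also have "\<dots> = sequence_entropy_partition M T t (fibres M floor_sym)"
    using sequence_entropy_fibres[of T M t floor_sym] T_surj by simp
  also have "\<dots> \<le> sequence_entropy M T t"
    unfolding sequence_entropy_def
    by (intro SUP_upper) (simp add: finite_measurable_partition_fibres simple_function_floor_sym)
  finally show ?thesis .
qed

end

text \<open>A copy has index \<open>(x * R n + \<rho>) * m n + r\<close> with word number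
  \<open>x\<close>, repetition \<open>\<rho>\<close> and letter \<open>r\<close>. The words are the
  base \<open>S\<close> expansions with \<open>m n\<close> digits, and the spacer number is digit
  \<open>r\<close> of \<open>x\<close>.\<close>

locale repeated_words = cutting_stacking +
  fixes m R :: "nat \<Rightarrow> nat"
  assumes S_ge_2: "S \<ge> 2" and m_pos: "m n > 0" and R_ge_2: "R n \<ge> 2"
    and q_eq: "q n = S ^ m n * R n * m n"
    and a_eq: "a n i = (i div (m n * R n)) div S ^ (i mod m n) mod S"
begin

definition block :: "nat \<Rightarrow> nat \<Rightarrow> nat \<times> nat \<times> nat \<Rightarrow> nat" where
  "block n x = (\<lambda>(\<rho>, r, p). (x * R n + \<rho>) * m n + r)"

text \<open>The last two repetitions are left out as starting points, so that the next
  \<open>m n\<close> spacers still belong to the same word.\<close>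

definition positions :: "nat \<Rightarrow> (nat \<times> nat \<times> nat) set" where
  "positions n = {..<R n - 2} \<times> {..<m n} \<times> {..<h n}"

definition level :: "nat \<Rightarrow> nat \<Rightarrow> nat \<times> nat \<times> nat \<Rightarrow> nat" where
  "level n x j = start n (block n x j) + snd (snd j)"

lemma block_add_less_q:
  assumes "x < S ^ m n" "j \<in> positions n" shows "block n x j + m n < q n"
proof -
  obtain \<rho> r p where j: "j = (\<rho>, r, p)" "\<rho> < R n - 2" "r < m n" using assms(2) by (auto simp: positions_def)
  have "block n x j + m n < (x * R n + \<rho> + 2) * m n" using j by (simp add: block_def algebra_simps)
  also have "\<dots> \<le> (x * R n + R n) * m n" using j by (intro mult_right_mono) auto
  also have "\<dots> = (Suc x * R n) * m n" by simp
  also have "\<dots> \<le> (S ^ m n * R n) * m n" using assms(1) by (intro mult_right_mono) auto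
  finally show ?thesis by (simp add: q_eq)
qed

lemma block_div_mod:
  assumes "j \<in> positions n" "j = (\<rho>, r, p)"
  shows "block n x j div (m n * R n) = x" "block n x j mod m n = r" "block n x j div m n mod R n = \<rho>"
proof -
  have r: "r < m n" "\<rho> < R n" using assms by (auto simp: positions_def)
  then have d: "block n x j div m n = x * R n + \<rho>" using assms(2) by (simp add: block_def)
  show "block n x j mod m n = r" using assms(2) r by (simp add: block_def)
  show "block n x j div (m n * R n) = x" using d r by (simp add: div_mult2_eq)
  show "block n x j div m n mod R n = \<rho>" using d r by simp
qed

text \<open>Every letter of the word with index \<open>x\<close> is among the \<open>m n\<close> spacers following block \<open>block n x j\<close>.\<close>

lemma word_determined:
  assumes x: "x < S ^ m n" "y < S ^ m n" and j: "j \<in> positions n"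
    and eq: "\<And>b. b < m n \<Longrightarrow> a n (block n x j + b) = a n (block n y j + b)"
  shows "x = y"
proof (rule eq_if_digits_eq[OF x])
  fix c assume c: "c < m n"
  obtain \<rho> r p where jj: "j = (\<rho>, r, p)" "\<rho> < R n - 2" "r < m n" using j by (auto simp: positions_def)
  \<comment> \<open>A letter that precedes the current one is found in the next repetition.\<close>
  have "\<exists>b<m n. \<exists>s<R n. \<forall>z. block n z j + b = (z * R n + s) * m n + c"
  proof (cases "r \<le> c")
    case True
    then show ?thesis using jj c by (intro exI[of _ "c - r"] conjI exI[of _ \<rho>]) (auto simp: block_def)
  next
    case False
    then show ?thesis using jj c
      by (intro exI[of _ "c + m n - r"] conjI exI[of _ "Suc \<rho>"]) (auto simp: block_def algebra_simps)
  qed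
  then obtain b s where b: "b < m n" "s < R n" "\<And>z. block n z j + b = (z * R n + s) * m n + c" by blast
  have "a n (block n z j + b) = z div S ^ c mod S" for z
    using b c by (simp add: a_eq div_mult2_eq)
  with eq[OF b(1)] show "x div S ^ c mod S = y div S ^ c mod S" by simp
qed

lemma level_less: assumes "x < S ^ m n" "j \<in> positions n" shows "level n x j < h (Suc n)"
  using block_add_less_q[OF assms] assms(2) unfolding level_def
  by (intro start_less_h) (auto simp: positions_def)

lemma level_inj: "inj_on (\<lambda>(x, j). level n x j) ({..<S ^ m n} \<times> positions n)"
proof (rule inj_onI)
  fix a b assume a: "a \<in> {..<S ^ m n} \<times> positions n" and b: "b \<in> {..<S ^ m n} \<times> positions n"
    and eq: "(\<lambda>(x, j). level n x j) a = (\<lambda>(x, j). level n x j) b"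
  obtain x \<rho> r p where a': "a = (x, (\<rho>, r, p))" by (metis prod_cases4)
  obtain y \<rho>' r' p' where b': "b = (y, (\<rho>', r', p'))" by (metis prod_cases4)
  let ?j = "(\<rho>, r, p)" and ?j' = "(\<rho>', r', p')"
  have j: "?j \<in> positions n" "?j' \<in> positions n" "x < S ^ m n" "y < S ^ m n" using a b a' b' by auto
  have ic: "in_copy n (block n x ?j) p" "in_copy n (block n y ?j') p'"
    using block_add_less_q[OF j(3,1)] block_add_less_q[OF j(4,2)] j
    by (auto simp: positions_def intro!: in_copyI)
  have eq': "start n (block n x ?j) + p = start n (block n y ?j') + p'" using eq a' b' by (simp add: level_def)
  then have bl: "block n x ?j = block n y ?j'" using copy_start[OF ic(1)] copy_start[OF ic(2)] by simp
  then have "p = p'" using eq' by simp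
  moreover have "x = y" "r = r'" "\<rho> = \<rho>'"
    using block_div_mod[OF j(1) refl, of x] block_div_mod[OF j(2) refl, of y] unfolding bl by auto
  ultimately show "a = b" using a' b' by simp
qed

definition good :: "nat \<Rightarrow> real set" where
  "good n = (\<Union>l\<in>(\<lambda>(x, j). level n x j) ` ({..<S ^ m n} \<times> positions n). lev (Suc n) l)"

lemma finite_positions: "finite (positions n)" by (simp add: positions_def)

lemma prob_good: "prob (good n) = real (S ^ m n) * real (card (positions n)) * (w (Suc n) / whole)"
proof -
  let ?L = "(\<lambda>(x, j). level n x j) ` ({..<S ^ m n} \<times> positions n)"
  have "prob (good n) = card ?L * (w (Suc n) / whole)"
    unfolding good_def using level_less finite_positions by (intro prob_levels) auto
  also have "card ?L = S ^ m n * card (positions n)"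
    using card_image[OF level_inj[of n]] by (simp add: card_cartesian_product)
  finally show ?thesis by simp
qed

text \<open>What is missing from the tower is two repetitions out of \<open>R n\<close>.\<close>

lemma prob_good_tower: "prob (good n) = (1 - 2 / real (R n)) * prob (\<Union>l<h n. lev n l)"
proof -
  have "prob (\<Union>l<h n. lev n l) = real (h n) * (w n / whole)" using prob_levels[of "{..<h n}" n] by simp
  also have "w n = real (S ^ m n) * real (R n) * real (m n) * w (Suc n)" by (subst w_Suc) (simp add: q_eq)
  finally have tower: "prob (\<Union>l<h n. lev n l)
      = real (R n) * (real (S ^ m n) * real (m n) * real (h n) * (w (Suc n) / whole))" by simp
  have "(1 - 2 / real (R n)) * prob (\<Union>l<h n. lev n l)
      = ((1 - 2 / real (R n)) * real (R n)) * (real (S ^ m n) * real (m n) * real (h n) * (w (Suc n) / whole))"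
    unfolding tower by (simp only: mult.assoc)
  also have "(1 - 2 / real (R n)) * real (R n) = real (R n) - 2" using R_ge_2[of n] by (simp add: field_simps)
  also have "real (R n) - 2 = real (R n - 2)" using R_ge_2[of n] by (simp add: of_nat_diff)
  finally show ?thesis unfolding prob_good by (simp add: positions_def card_cartesian_product)
qed

text \<open>For a given name and position at most one word is possible, so the part of
  \<open>good n\<close> with this name is covered by one level per position, a fraction
  \<open>1 / S ^ m n\<close> of \<open>good n\<close>.\<close>

lemma name_entropy_ge:
  assumes t: "t 1 \<le> 1" "\<And>k. 1 \<le> k \<Longrightarrow> k < N \<Longrightarrow> t (Suc k) + 2 * S \<le> t k + h n"
      "m n * (h n + S) \<le> t N" "N \<ge> 1"
  shows "(1 - 2 / real (R n)) * prob (\<Union>l<h n. lev n l) * (real (m n) * ln (real S)) - ln 2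
    \<le> name_entropy M T t floor_sym N"
proof -
  let ?f = "\<lambda>x. \<lambda>k\<in>{1..N}. floor_sym ((T ^^ t k) x)"
  have sf: "simple_function M ?f"
    by (intro simple_function_restrict_family simple_function_T_pow simple_function_floor_sym) auto
  have good_ev: "good n \<in> events" unfolding good_def using finite_positions by (auto intro!: sets.finite_UN)
  have "prob (?f -` {v} \<inter> space M \<inter> good n) \<le> 1 / real (S ^ m n)" for v
  proof -
    \<comment> \<open>If no word is compatible with position \<open>j\<close>, this value is
      arbitrary; the filter in \<open>?L\<close> keeps the covering levels inside the tower.\<close>
    define wd where "wd j = (SOME x. x < S ^ m n \<and> lev (Suc n) (level n x j) \<inter> ?f -` {v} \<noteq> {})" for j
    let ?L = "(\<lambda>j. level n (wd j) j) ` {j \<in> positions n. wd j < S ^ m n}"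
    have fin: "finite {j \<in> positions n. wd j < S ^ m n}" using finite_positions by simp
    have "?f -` {v} \<inter> space M \<inter> good n \<subseteq> (\<Union>l\<in>?L. lev (Suc n) l)"
    proof
      fix z assume z: "z \<in> ?f -` {v} \<inter> space M \<inter> good n"
      then obtain x j where xj: "x < S ^ m n" "j \<in> positions n" "z \<in> lev (Suc n) (level n x j)"
        by (auto simp: good_def)
      then have "x < S ^ m n \<and> lev (Suc n) (level n x j) \<inter> ?f -` {v} \<noteq> {}" using z by blast
      then have wd: "wd j < S ^ m n" "lev (Suc n) (level n (wd j) j) \<inter> ?f -` {v} \<noteq> {}"
        unfolding wd_def by (rule someI2[where a = x], blast)+
      then obtain z' where z': "z' \<in> lev (Suc n) (level n (wd j) j)" "?f z' = v" by blast
      have zX: "z \<in> X" "z' \<in> X"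
        using xj z' level_less[OF xj(1,2)] level_less[OF wd(1) xj(2)] lev_subset_X by blast+
      have "x = wd j"
      proof (rule word_determined[OF xj(1) wd(1) xj(2)])
        fix b assume b: "b < m n"
        show "a n (block n x j + b) = a n (block n (wd j) j + b)"
        proof (rule spacers_determined[OF _ _ _ _ _ t _ b])
          show "z \<in> lev (Suc n) (start n (block n x j) + snd (snd j))"
            "z' \<in> lev (Suc n) (start n (block n (wd j) j) + snd (snd j))"
            using xj(3) z'(1) by (auto simp: level_def)
          show "snd (snd j) < h n" using xj(2) by (auto simp: positions_def)
          show "block n x j + m n < q n" "block n (wd j) j + m n < q n"
            using block_add_less_q xj wd by auto
          fix k assume k: "k \<in> {1..N}"
          have "?f z = ?f z'" using z z' by simp
          then have "floor_sym ((T ^^ t k) z) = floor_sym ((T ^^ t k) z')"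
            using k unfolding restrict_eq_restrict_iff by blast
          then show "\<lfloor>(T ^^ t k) z\<rfloor> = \<lfloor>(T ^^ t k) z'\<rfloor>"
            using T_pow_in_X zX by (simp add: floor_sym_def)
        qed
      qed
      with xj wd(1) show "z \<in> (\<Union>l\<in>?L. lev (Suc n) l)"
        by (intro UN_I[of "level n (wd j) j"] imageI) simp_all
    qed
    then have "prob (?f -` {v} \<inter> space M \<inter> good n) \<le> prob (\<Union>l\<in>?L. lev (Suc n) l)"
      using fin by (intro finite_measure_mono) (auto intro!: sets.finite_UN)
    also have "\<dots> = card ?L * (w (Suc n) / whole)"
      using level_less fin by (intro prob_levels) auto
    also have "\<dots> \<le> real (card (positions n)) * (w (Suc n) / whole)"
    proof (intro mult_right_mono)
      have "card ?L \<le> card {j \<in> positions n. wd j < S ^ m n}" using fin by (rule card_image_le)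
      also have "\<dots> \<le> card (positions n)" using finite_positions by (intro card_mono) auto
      finally show "real (card ?L) \<le> real (card (positions n))" by simp
    qed (use whole_pos w_pos[of "Suc n"] in simp)
    also have "\<dots> = prob (good n) / real (S ^ m n)" using S_ge_2 by (simp add: prob_good)
    also have "\<dots> \<le> 1 / real (S ^ m n)" by (intro divide_right_mono) auto
    finally show ?thesis .
  qed
  from rv_entropy_ge[OF sf good_ev _ this]
  have "prob (good n) * (- ln (1 / real (S ^ m n))) - ln 2 \<le> rv_entropy M ?f" using S_ge_2 by simp
  moreover have "- ln (1 / real (S ^ m n)) = real (m n) * ln (real S)"
    using S_ge_2 by (simp add: ln_div ln_realpow)
  ultimately show ?thesis unfolding name_entropy_def prob_good_tower by (simp only:)
qed

end

section \<open>Choice of the parameters\<close>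

text \<open>The bound on \<open>ln S\<close> says \<open>4 * \<alpha> * \<kappa> \<le> 1\<close> for
  \<open>\<kappa> = v / ln S\<close>. Up to index \<open>2 powr \<beta>\<close> times the saturation
  index, a gap of \<open>t\<close> is at most \<open>2 * \<alpha> * \<kappa>\<close> times the
  height plus 1, so about half of it; the other half leaves room for \<open>2 * S\<close>.\<close>

locale power_sequence_parameters =
  fixes \<beta> \<alpha> v :: real and S :: nat and t :: "nat \<Rightarrow> nat"
  assumes \<beta>_pos: "\<beta> > 0" and \<alpha>_eq: "\<alpha> = 1 + 1 / \<beta>" and v_pos: "v > 0"
    and S_2: "S \<ge> 2" and ln_S: "ln (real S) \<ge> 4 * \<alpha> * v"
    and t_eq: "\<And>n. n \<ge> 1 \<Longrightarrow> t n = nat \<lfloor>real n powr \<alpha>\<rfloor>"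
begin

definition \<kappa> :: real where "\<kappa> = v / ln (real S)"

text \<open>
  Index up to which a tower of height \<open>x\<close> has to be observed: an orbit segment of length
  \<open>satur x powr \<alpha>\<close> crosses \<open>\<kappa> * satur x\<close> blocks of height \<open>x\<close>, one for each letter of a word.
\<close>

definition satur :: "real \<Rightarrow> real" where "satur x = (\<kappa> * x) powr \<beta>"

definition word_length :: "nat \<Rightarrow> nat" where "word_length x = Suc (nat \<lfloor>\<kappa> * satur (real x)\<rfloor>)"

text \<open>Unbounded, so that almost every starting point is usable, yet so small that its
  logarithm is negligible in that of the next height.\<close>

definition repetitions :: "nat \<Rightarrow> nat" where "repetitions x = word_length x + 2"

definition cuts :: "nat \<Rightarrow> nat" where "cuts x = S ^ word_length x * repetitions x * word_length x"

definition spacers :: "nat \<Rightarrow> nat \<Rightarrow> nat" where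
  "spacers x i = (i div (word_length x * repetitions x)) div S ^ (i mod word_length x) mod S"

primrec height :: "nat \<Rightarrow> nat" where
  "height 0 = 2 * S"
| "height (Suc n) = (\<Sum>j<cuts (height n) - 1. height n + spacers (height n) j) + height n"

lemma cuts_ge_2: "cuts x \<ge> 2"
proof -
  have "1 * 2 * 1 \<le> S ^ word_length x * repetitions x * word_length x"
    using S_2 by (intro mult_mono) (auto simp: word_length_def repetitions_def)
  then show ?thesis by (simp add: cuts_def)
qed

sublocale repeated_words S height "\<lambda>n. cuts (height n)" "\<lambda>n. spacers (height n)"
  "\<lambda>n. word_length (height n)" "\<lambda>n. repetitions (height n)"
proof unfold_locales
  show "spacers (height n) i < S" for n i using S_2 by (simp add: spacers_def)
  show "1 \<le> S" using S_2 by simp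
  show "2 \<le> cuts (height n)" for n by (rule cuts_ge_2)
qed (use S_2 in \<open>simp_all add: cuts_def spacers_def repetitions_def word_length_def\<close>)

declare height.simps(2) [simp del]

section \<open>Growth of the heights and of the time sequence\<close>

lemma ln_S_pos: "ln (real S) > 0" using S_2 by simp

lemma \<alpha>_gt_1: "\<alpha> > 1" using \<beta>_pos by (simp add: \<alpha>_eq)

lemma \<kappa>_pos: "\<kappa> > 0" using v_pos ln_S_pos by (simp add: \<kappa>_def)

lemma \<kappa>_ln: "\<kappa> * ln (real S) = v" using ln_S_pos by (simp add: \<kappa>_def)

lemma \<alpha>_\<kappa>: "4 * (\<alpha> * \<kappa>) \<le> 1" using ln_S ln_S_pos by (simp add: \<kappa>_def field_simps)

lemma satur_pos: "x > 0 \<Longrightarrow> satur x > 0" using \<kappa>_pos by (simp add: satur_def)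

lemma satur_root: "x > 0 \<Longrightarrow> satur x powr (1 / \<beta>) = \<kappa> * x"
  using \<kappa>_pos \<beta>_pos by (simp add: satur_def powr_powr)

lemma satur_at_top: "filterlim satur at_top at_top"
  unfolding satur_def using \<kappa>_pos \<beta>_pos by real_asymp

lemma height_at_top: "filterlim (\<lambda>n. real (height n)) at_top sequentially"
proof (rule filterlim_compose[OF filterlim_real_sequentially])
  show "filterlim height at_top sequentially" using h_strict_mono by (rule filterlim_subseq)
qed

lemma word_length_bounds:
  "\<kappa> * satur (real x) \<le> real (word_length x)" "real (word_length x) \<le> \<kappa> * satur (real x) + 1"
proof -
  have "0 \<le> \<kappa> * satur (real x)" using \<kappa>_pos by (simp add: satur_def)
  then show "\<kappa> * satur (real x) \<le> real (word_length x)" "real (word_length x) \<le> \<kappa> * satur (real x) + 1"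
    unfolding word_length_def by (auto simp: of_nat_nat; linarith)+
qed

lemma powr_\<alpha>: "x \<ge> 0 \<Longrightarrow> x powr \<alpha> = x * x powr (1 / \<beta>)"
  by (cases "x = 0") (auto simp: \<alpha>_eq powr_add)

lemma t_le: "n \<ge> 1 \<Longrightarrow> real (t n) \<le> real n powr \<alpha>"
  by (simp add: t_eq of_nat_nat)

lemma t_ge: "n \<ge> 1 \<Longrightarrow> real (t n) \<ge> real n powr \<alpha> - 1"
  by (simp add: t_eq of_nat_nat; linarith)

lemma t_mono: assumes "1 \<le> k" "k \<le> n" shows "t k \<le> t n"
  using assms \<alpha>_gt_1 by (auto simp: t_eq intro!: nat_mono floor_mono powr_mono2)

lemma powr_diff_le:
  assumes "x > 0" shows "(x + 1) powr \<alpha> - x powr \<alpha> \<le> \<alpha> * (x + 1) powr (1 / \<beta>)"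
proof -
  have "\<exists>z. z > x \<and> z < x + 1 \<and> (x + 1) powr \<alpha> - x powr \<alpha> = (x + 1 - x) * (\<alpha> * z powr (\<alpha> - 1))"
    using assms by (intro MVT2) (auto intro!: derivative_eq_intros)
  then obtain z where z: "z > x" "z < x + 1" "(x + 1) powr \<alpha> - x powr \<alpha> = \<alpha> * z powr (\<alpha> - 1)" by auto
  have "z powr (1 / \<beta>) \<le> (x + 1) powr (1 / \<beta>)" using z assms \<beta>_pos by (intro powr_mono2) auto
  moreover have "\<alpha> - 1 = 1 / \<beta>" by (simp add: \<alpha>_eq)
  ultimately show ?thesis using z \<alpha>_gt_1 by simp
qed

lemma t_gap: assumes "1 \<le> k" "k < n" shows "real (t (Suc k)) \<le> real (t k) + \<alpha> * real n powr (1 / \<beta>) + 1"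
proof -
  have "real (t (Suc k)) \<le> (real k + 1) powr \<alpha>" using t_le[of "Suc k"] by (simp add: add.commute)
  also have "\<dots> \<le> real k powr \<alpha> + \<alpha> * (real k + 1) powr (1 / \<beta>)" using powr_diff_le[of "real k"] assms by simp
  also have "real k powr \<alpha> \<le> real (t k) + 1" using t_ge[OF assms(1)] by simp
  also have "\<alpha> * (real k + 1) powr (1 / \<beta>) \<le> \<alpha> * real n powr (1 / \<beta>)"
    using assms \<alpha>_gt_1 \<beta>_pos by (intro mult_left_mono powr_mono2) auto
  finally show ?thesis by simp
qed

lemma S_le_height: "S \<le> height n"
  using strict_mono_mono[OF h_strict_mono, THEN monoD, of 0 n] by simp

lemma height_Suc_le: "height (Suc n) \<le> cuts (height n) * (2 * height n)"
proof -
  have "(\<Sum>j<cuts (height n) - 1. height n + spacers (height n) j) \<le> (\<Sum>j<cuts (height n) - 1. 2 * height n)"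
  proof (rule sum_mono)
    show "height n + spacers (height n) j \<le> 2 * height n" for j
      using a_less[of n j] S_le_height[of n] by linarith
  qed
  then have "height (Suc n) \<le> (cuts (height n) - 1) * (2 * height n) + 2 * height n"
    by (simp add: height.simps(2))
  also have "\<dots> = cuts (height n) * (2 * height n)" using cuts_ge_2[of "height n"] by (cases "cuts (height n)") auto
  finally show ?thesis .
qed

lemma height_Suc_ge: "word_length (height n) * height n \<le> height (Suc n)"
proof -
  have "1 * 1 * word_length (height n) \<le> S ^ word_length (height n) * repetitions (height n) * word_length (height n)"
    using S_2 by (intro mult_mono) (auto simp: repetitions_def)
  then have "word_length (height n) * height n \<le> cuts (height n) * height n" by (simp add: cuts_def)
  also have "\<dots> \<le> height (Suc n)" using h_Suc_sum[of n] by simp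
  finally show ?thesis .
qed

text \<open>The factor \<open>S ^ word_length x\<close> of the number of cuts contributes
  \<open>\<kappa> * satur x * ln S = v * satur x\<close> up to rounding; the other factors have
  logarithms of smaller order.\<close>

lemma ln_height_Suc_le:
  assumes "\<epsilon> > 0"
  shows "\<forall>\<^sub>F n in sequentially. ln (real (height (Suc n))) + c \<le> (v + \<epsilon>) * satur (real (height n))"
proof -
  let ?err = "\<lambda>x. (ln (real S) + ln ((\<kappa> * (\<kappa> * x) powr \<beta> + 3) * (\<kappa> * (\<kappa> * x) powr \<beta> + 1)) + ln (2 * x) + c) / (\<kappa> * x) powr \<beta>"
  have "(?err \<longlongrightarrow> 0) at_top" using \<kappa>_pos \<beta>_pos by real_asymp
  then have "\<forall>\<^sub>F x in at_top. ?err x < \<epsilon>" using assms by (intro order_tendstoD(2))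
  then have "\<forall>\<^sub>F n in sequentially. ?err (real (height n)) < \<epsilon>"
    using height_at_top by (rule eventually_compose_filterlim)
  then show ?thesis
  proof eventually_elim
    case (elim n)
    define x where "x = height n"
    define s where "s = satur (real x)"
    have x: "x > 0" using h_pos by (simp add: x_def)
    have s: "s > 0" using satur_pos[of "real x"] x by (simp add: s_def)
    have wl: "\<kappa> * s \<le> real (word_length x)" "real (word_length x) \<le> \<kappa> * s + 1"
      using word_length_bounds[of x] by (auto simp: s_def)
    have ks: "0 < \<kappa> * s" using \<kappa>_pos s by simp
    have m: "word_length x > 0" "repetitions x > 0" by (auto simp: word_length_def repetitions_def)
    have "real (height (Suc n)) \<le> real (cuts x * (2 * x))" using height_Suc_le[of n] unfolding x_def of_nat_le_iff .
    then have "ln (real (height (Suc n))) \<le> ln (real (cuts x * (2 * x)))" using h_pos[of "Suc n"] by (intro ln_mono) auto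
    also have "real (cuts x * (2 * x))
        = real S ^ word_length x * ((real (repetitions x) * real (word_length x)) * (2 * real x))"
      by (simp add: cuts_def)
    also have "ln \<dots> = real (word_length x) * ln (real S)
        + (ln (real (repetitions x) * real (word_length x)) + ln (2 * real x))"
      using m x S_2 by (subst ln_mult) (auto simp: ln_mult ln_realpow)
    also have "\<dots> \<le> (\<kappa> * s + 1) * ln (real S) + (ln ((\<kappa> * s + 3) * (\<kappa> * s + 1)) + ln (2 * real x))"
    proof (intro add_mono mult_right_mono order_refl)
      have "real (repetitions x) * real (word_length x) \<le> (\<kappa> * s + 3) * (\<kappa> * s + 1)"
        using wl ks by (intro mult_mono) (auto simp: repetitions_def)
      then show "ln (real (repetitions x) * real (word_length x)) \<le> ln ((\<kappa> * s + 3) * (\<kappa> * s + 1))"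
        using m by (intro ln_mono) auto
    qed (use wl ln_S_pos in auto)
    also have "(\<kappa> * s + 1) * ln (real S) = v * s + ln (real S)" using \<kappa>_ln by (simp add: algebra_simps)
    finally have "ln (real (height (Suc n))) + c
        \<le> v * s + (ln (real S) + ln ((\<kappa> * s + 3) * (\<kappa> * s + 1)) + ln (2 * real x) + c)" by simp
    also have "\<dots> \<le> v * s + \<epsilon> * s"
      using elim s unfolding x_def[symmetric] satur_def[symmetric] s_def[symmetric] by (simp add: field_simps)
    finally show ?case by (simp add: s_def x_def algebra_simps)
  qed
qed

text \<open>The height grows at least by the factor \<open>word_length (height n)\<close>, which
  tends to infinity.\<close>

lemma height_ratio:
  assumes "\<epsilon> > 0" "c > 0"
  shows "\<forall>\<^sub>F n in sequentially. c * real (height n) \<le> \<epsilon> * real (height (Suc n))"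
proof -
  have "\<forall>\<^sub>F n in sequentially. satur (real (height n)) \<ge> c / (\<epsilon> * \<kappa>)"
    using filterlim_compose[OF satur_at_top height_at_top] by (simp add: filterlim_at_top)
  then show ?thesis
  proof eventually_elim
    case (elim n)
    have "c \<le> \<epsilon> * (\<kappa> * satur (real (height n)))" using elim assms \<kappa>_pos by (simp add: field_simps)
    also have "\<dots> \<le> \<epsilon> * real (word_length (height n))"
      using word_length_bounds(1) assms by (intro mult_left_mono) auto
    finally have "c * real (height n) \<le> \<epsilon> * real (word_length (height n)) * real (height n)"
      by (intro mult_right_mono) auto
    also have "\<dots> = \<epsilon> * real (word_length (height n) * height n)" by simp
    also have "\<dots> \<le> \<epsilon> * real (height (Suc n))"
      using height_Suc_ge[of n] assms unfolding of_nat_le_iff[symmetric, where 'a = real]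
      by (intro mult_left_mono) auto
    finally show ?case .
  qed
qed

section \<open>The upper estimate\<close>

lemma names_count:
  fixes n :: nat
  assumes "N \<ge> 1" "k \<in> {1..N}"
  defines "B \<equiv> t N div height n + 3"
  shows "t k + height n + S \<le> B * height n"
    "ln (real ((height n + S) * S ^ B)) \<le> ln (real (height n)) + (ln 2 + 3 * ln (real S))
       + real N * (real N powr (1 / \<beta>) * ln (real S) / real (height n))"
proof -
  have h: "height n > 0" by (rule h_pos)
  have "t k \<le> t N" using assms by (intro t_mono) auto
  moreover have "t N < (t N div height n + 1) * height n"
    using h by (metis add.commute div_mult_mod_eq mod_less_divisor mult.commute mult_Suc nat_add_left_cancel_less plus_1_eq_Suc)
  \<comment> \<open>The three extra blocks cover the remainder of the division, the summand
    \<open>height n\<close>, and \<open>S \<le> height n\<close>.\<close>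
  ultimately show "t k + height n + S \<le> B * height n"
    using S_le_height[of n] by (simp add: B_def algebra_simps)
  have "real B \<le> real (t N) / real (height n) + 3"
    unfolding B_def using of_nat_div_le_of_nat[of "t N" "height n"] by simp
  also have "\<dots> \<le> real N powr \<alpha> / real (height n) + 3"
    using t_le[OF assms(1)] by (intro add_right_mono divide_right_mono) auto
  finally have B: "real B \<le> real N * real N powr (1 / \<beta>) / real (height n) + 3" by (simp add: powr_\<alpha>)
  have "ln (real ((height n + S) * S ^ B)) = ln (real (height n + S)) + real B * ln (real S)"
    using h S_2 by (simp add: ln_mult ln_realpow)
  also have "\<dots> \<le> ln (2 * real (height n)) + (real N * real N powr (1 / \<beta>) / real (height n) + 3) * ln (real S)"
    using S_le_height[of n] h B ln_S_pos by (intro add_mono mult_right_mono ln_mono) auto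
  also have "ln (2 * real (height n)) = ln 2 + ln (real (height n))" using h by (simp add: ln_mult)
  finally show "ln (real ((height n + S) * S ^ B)) \<le> ln (real (height n)) + (ln 2 + 3 * ln (real S))
       + real N * (real N powr (1 / \<beta>) * ln (real S) / real (height n))"
    by (simp add: algebra_simps)
qed

text \<open>Divided by \<open>x\<close>, the left side is the price per sample of crossing blocks of
  height \<open>x\<close> up to index \<open>y\<close>; at saturation, \<open>c = 1\<close>, it is
  at most \<open>v\<close>.\<close>

lemma satur_le_root:
  assumes "0 \<le> y" "y \<le> c * satur x" "x > 0" "c > 0"
  shows "y powr (1 / \<beta>) * ln (real S) \<le> c powr (1 / \<beta>) * v * x"
proof -
  have "y powr (1 / \<beta>) \<le> (c * satur x) powr (1 / \<beta>)" using assms \<beta>_pos by (intro powr_mono2) auto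
  also have "\<dots> = c powr (1 / \<beta>) * (\<kappa> * x)"
    using assms satur_pos[of x] by (simp add: powr_mult satur_root)
  finally have "y powr (1 / \<beta>) * ln (real S) \<le> c powr (1 / \<beta>) * (\<kappa> * x) * ln (real S)"
    using ln_S_pos by (intro mult_right_mono) auto
  also have "\<dots> = c powr (1 / \<beta>) * (\<kappa> * ln (real S)) * x" by simp
  finally show ?thesis by (simp add: \<kappa>_ln)
qed

text \<open>
  For \<open>N\<close> between the saturation indices of stages \<open>n\<close> and \<open>n + 1\<close> the names are counted through the
  tower of stage \<open>n + 1\<close>. Shortly after the first of them only its height matters, and much
  later only the number of its copies that are crossed.
\<close>

lemma entropy_upper: "sequence_entropy M T t \<le> ereal v"
proof (rule sequence_entropy_le)
  fix n\<^sub>0 :: nat and \<epsilon> :: real assume \<epsilon>: "\<epsilon> > 0"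
  define c where "c = ln 2 + 3 * ln (real S)"
  \<comment> \<open>\<open>K\<close> separates the regimes. Up to \<open>K\<close> times the
    saturation index of stage \<open>n\<close>, crossing blocks of stage \<open>n + 1\<close> costs
    at most \<open>\<epsilon> / 2\<close> per sample, as these are far higher. Beyond, the price of
    locating the point is at most \<open>(v + \<epsilon> / 2) / K \<le> \<epsilon>\<close> per
    sample.\<close>
  define K where "K = max 1 ((v + \<epsilon> / 2) / \<epsilon>)"
  have K: "K \<ge> 1" "(v + \<epsilon> / 2) / K \<le> \<epsilon>"
    using \<epsilon> v_pos by (auto simp: K_def field_simps max_def)
  have "\<forall>\<^sub>F n in sequentially. ln (real (height (Suc n))) + c \<le> (v + \<epsilon> / 2) * satur (real (height n))
      \<and> K powr (1 / \<beta>) * v * real (height n) \<le> \<epsilon> / 2 * real (height (Suc n)) \<and> n \<ge> n\<^sub>0"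
    using ln_height_Suc_le[of "\<epsilon> / 2" c] height_ratio[of "\<epsilon> / 2" "K powr (1 / \<beta>) * v"] \<epsilon> v_pos K
      eventually_ge_at_top[of n\<^sub>0] by (auto simp: eventually_conj_iff)
  then obtain n\<^sub>1 where n1: "\<And>n. n \<ge> n\<^sub>1 \<Longrightarrow> ln (real (height (Suc n))) + c \<le> (v + \<epsilon> / 2) * satur (real (height n))"
    "\<And>n. n \<ge> n\<^sub>1 \<Longrightarrow> K powr (1 / \<beta>) * v * real (height n) \<le> \<epsilon> / 2 * real (height (Suc n))"
    "\<And>n. n \<ge> n\<^sub>1 \<Longrightarrow> n \<ge> n\<^sub>0"
    unfolding eventually_sequentially by blast
  have sat_mono: "satur (real (height i)) \<le> satur (real (height j))" if "i \<le> j" for i j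
    unfolding satur_def using that \<kappa>_pos \<beta>_pos strict_mono_mono[OF h_strict_mono, THEN monoD, OF that]
    by (intro powr_mono2 mult_left_mono) auto
  have "\<forall>\<^sub>F N in sequentially. real N > satur (real (height n\<^sub>1))"
    using filterlim_real_sequentially by (simp add: filterlim_at_top_dense)
  then show "\<forall>\<^sub>F N in sequentially. \<exists>n\<ge>n\<^sub>0. \<exists>B. (\<forall>k\<in>{1..N}. t k + height n + S \<le> B * height n) \<and>
      ln (real ((height n + S) * S ^ B)) \<le> (v + \<epsilon>) * real N"
    using eventually_ge_at_top[of 1]
  proof eventually_elim
    case (elim N)
    have "\<forall>\<^sub>F j in sequentially. satur (real (height j)) \<ge> real N"
      using filterlim_compose[OF satur_at_top height_at_top] by (simp add: filterlim_at_top)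
    then have ex: "\<exists>j. real N \<le> satur (real (height j))" by (auto simp: eventually_sequentially)
    \<comment> \<open>The count uses the first stage not yet saturated before \<open>N\<close>; its
      predecessor \<open>n\<close> is already saturated.\<close>
    define j where "j = (LEAST j. real N \<le> satur (real (height j)))"
    have j: "real N \<le> satur (real (height j))" unfolding j_def using ex by (rule LeastI_ex)
    have "\<not> j \<le> n\<^sub>1" using sat_mono[of j n\<^sub>1] j elim(1) by linarith
    then obtain n where n: "j = Suc n" "n \<ge> n\<^sub>1" by (cases j) auto
    have nN: "satur (real (height n)) < real N"
      using not_less_Least[of n "\<lambda>j. real N \<le> satur (real (height j))"] n(1) by (simp add: j_def)
    have h: "real (height n) > 0" "real (height j) > 0" using h_pos by simp_all
    define r where "r = real N powr (1 / \<beta>) * ln (real S) / real (height j)"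
    have A: "ln (real (height j)) + c \<le> (v + \<epsilon> / 2) * satur (real (height n))" using n1(1)[OF n(2)] n(1) by simp
    have total: "ln (real (height j)) + c + real N * r \<le> (v + \<epsilon>) * real N"
    proof (cases "real N \<le> K * satur (real (height n))")
      case True
      have "real N powr (1 / \<beta>) * ln (real S) \<le> K powr (1 / \<beta>) * v * real (height n)"
        using True K h by (intro satur_le_root) auto
      also have "\<dots> \<le> \<epsilon> / 2 * real (height j)" using n1(2)[OF n(2)] n(1) by simp
      finally have "r \<le> \<epsilon> / 2" using h by (simp add: r_def field_simps)
      then have "real N * r \<le> real N * (\<epsilon> / 2)" by (intro mult_left_mono) auto
      moreover have "(v + \<epsilon> / 2) * satur (real (height n)) \<le> (v + \<epsilon> / 2) * real N"
        using nN v_pos \<epsilon> by (intro mult_left_mono) auto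
      ultimately show ?thesis using A by (simp add: algebra_simps)
    next
      case False
      have "real N powr (1 / \<beta>) * ln (real S) \<le> 1 powr (1 / \<beta>) * v * real (height j)"
        using j h by (intro satur_le_root) auto
      then have "r \<le> v" using h by (simp add: r_def field_simps)
      then have "real N * r \<le> real N * v" by (intro mult_left_mono) auto
      moreover have "(v + \<epsilon> / 2) * satur (real (height n)) \<le> (v + \<epsilon> / 2) * (real N / K)"
        using False K v_pos \<epsilon> by (intro mult_left_mono) (auto simp: field_simps)
      moreover have "(v + \<epsilon> / 2) * (real N / K) = (v + \<epsilon> / 2) / K * real N" by simp
      moreover have "(v + \<epsilon> / 2) / K * real N \<le> \<epsilon> * real N" using K by (intro mult_right_mono) auto
      ultimately show ?thesis using A by (simp add: algebra_simps)
    qed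
    have jn0: "j \<ge> n\<^sub>0" using n1(3)[OF n(2)] n(1) by simp
    have "ln (real ((height j + S) * S ^ (t N div height j + 3))) \<le> (v + \<epsilon>) * real N"
      using names_count(2)[of N N j] elim(2) total by (simp add: c_def r_def)
    moreover have "\<forall>k\<in>{1..N}. t k + height j + S \<le> (t N div height j + 3) * height j"
      using names_count(1)[of N _ j] elim(2) by blast
    ultimately show ?case using jn0 by blast
  qed
qed

text \<open>Only indices slightly beyond saturation are tested, which suffices for a limsup. There a
  whole word is revealed, worth at least \<open>v * s n\<close> on a set of measure near 1.\<close>

lemma entropy_lower: "ereal v \<le> sequence_entropy M T t"
proof (rule le_sequence_entropy)
  fix \<epsilon> :: real assume \<epsilon>: "\<epsilon> > 0"
  \<comment> \<open>The factor \<open>1 + \<delta>\<close> pays for spacers and rounding in the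
    length to be crossed. It lowers the ratio by at most \<open>\<epsilon>\<close> because
    \<open>\<delta> * v \<le> \<epsilon>\<close>, and it stays below \<open>2 powr \<beta>\<close>,
    as the control of the gaps requires.\<close>
  define \<delta> where "\<delta> = min (\<epsilon> / v) ((2 powr \<beta> - 1) / 2)"
  have two: "2 powr \<beta> > 1" using \<beta>_pos by simp
  have \<delta>: "\<delta> > 0" "\<delta> * v \<le> \<epsilon>" "1 + \<delta> < 2 powr \<beta>"
    using \<epsilon> v_pos two by (auto simp: \<delta>_def min_def field_simps)
  define s where "s n = satur (real (height n))" for n
  define N where "N n = nat \<lceil>(1 + \<delta>) * s n\<rceil>" for n
  define p where "p n = (1 - 2 / real (repetitions (height n))) * prob (\<Union>l<height n. lev n l)" for n
  have s_pos: "s n > 0" for n using satur_pos h_pos by (simp add: s_def)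
  have s_top: "filterlim s at_top sequentially"
    unfolding s_def by (rule filterlim_compose[OF satur_at_top height_at_top])
  have N: "(1 + \<delta>) * s n \<le> real (N n)" "real (N n) \<le> (1 + \<delta>) * s n + 1" for n
  proof -
    have "0 \<le> (1 + \<delta>) * s n" using s_pos[of n] \<delta> by simp
    then show "(1 + \<delta>) * s n \<le> real (N n)" "real (N n) \<le> (1 + \<delta>) * s n + 1"
      unfolding N_def by (auto simp: of_nat_nat; linarith)+
  qed
  have N_pos: "N n \<ge> 1" for n
  proof -
    have "0 < (1 + \<delta>) * s n" using s_pos[of n] \<delta> by simp
    then show ?thesis using N(1)[of n] by linarith
  qed
  have gaps: "\<forall>\<^sub>F n in sequentially. \<forall>k. 1 \<le> k \<longrightarrow> k < N n \<longrightarrow> t (Suc k) + 2 * S \<le> t k + height n"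
  proof -
    have "\<forall>\<^sub>F n in sequentially. s n \<ge> 1 / (2 powr \<beta> - (1 + \<delta>))"
      using s_top by (simp add: filterlim_at_top)
    moreover have "\<forall>\<^sub>F n in sequentially. real (height n) \<ge> 2 * (1 + 2 * real S)"
      using height_at_top by (simp only: filterlim_at_top)
    ultimately show ?thesis
    proof eventually_elim
      case (elim n)
      have h: "real (height n) > 0" using h_pos by simp
      have "(1 + \<delta>) * s n + 1 \<le> 2 powr \<beta> * s n" using elim(1) \<delta>(3) by (simp add: field_simps)
      then have Nn: "real (N n) \<le> 2 powr \<beta> * s n" using N(2)[of n] by linarith
      have "real (N n) powr (1 / \<beta>) \<le> (2 powr \<beta> * s n) powr (1 / \<beta>)"
        using Nn \<beta>_pos by (intro powr_mono2) auto
      also have "\<dots> = 2 * (\<kappa> * real (height n))"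
        using s_pos[of n] h \<beta>_pos by (simp add: powr_mult powr_powr s_def satur_root)
      finally have "\<alpha> * real (N n) powr (1 / \<beta>) \<le> \<alpha> * (2 * (\<kappa> * real (height n)))"
        using \<alpha>_gt_1 by (intro mult_left_mono) auto
      also have "\<dots> = (4 * (\<alpha> * \<kappa>)) * (real (height n) / 2)" by simp
      also have "\<dots> \<le> 1 * (real (height n) / 2)" using \<alpha>_\<kappa> h by (intro mult_right_mono) auto
      finally have "\<alpha> * real (N n) powr (1 / \<beta>) + 1 + 2 * real S \<le> real (height n)" using elim(2) by simp
      then show ?case
      proof (intro allI impI)
        fix k assume "1 \<le> k" "k < N n"
        from t_gap[OF this] have "real (t (Suc k)) + 2 * real S \<le> real (t k) + real (height n)"
          using \<open>\<alpha> * real (N n) powr (1 / \<beta>) + 1 + 2 * real S \<le> real (height n)\<close> by linarith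
        then show "t (Suc k) + 2 * S \<le> t k + height n" by linarith
      qed
    qed
  qed
  have crossed: "\<forall>\<^sub>F n in sequentially. word_length (height n) * (height n + S) \<le> t (N n)"
  proof -
    \<comment> \<open>The relative excess of \<open>(\<kappa> * s n + 1) * (x + S) + 1\<close> over
      \<open>\<kappa> * s n * x\<close>; the final 1 accounts for the floor in
      \<open>t\<close>.\<close>
    let ?err = "\<lambda>x. real S * (1 / x) + 1 / (\<kappa> * (\<kappa> * x) powr \<beta>) + (real S + 1) * (1 / (\<kappa> * (\<kappa> * x) powr \<beta> * x))"
    have "((\<lambda>x::real. 1 / x) \<longlongrightarrow> 0) at_top" "((\<lambda>x. 1 / (\<kappa> * (\<kappa> * x) powr \<beta>)) \<longlongrightarrow> 0) at_top"
      "((\<lambda>x. 1 / (\<kappa> * (\<kappa> * x) powr \<beta> * x)) \<longlongrightarrow> 0) at_top"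
      using \<kappa>_pos \<beta>_pos by real_asymp+
    then have "(?err \<longlongrightarrow> real S * 0 + 0 + (real S + 1) * 0) at_top"
      by (intro tendsto_intros)
    then have "(?err \<longlongrightarrow> 0) at_top" by simp
    then have "\<forall>\<^sub>F x in at_top. ?err x < \<delta>" using \<delta>(1) by (intro order_tendstoD(2))
    then have "\<forall>\<^sub>F n in sequentially. ?err (real (height n)) < \<delta>"
      using height_at_top by (rule eventually_compose_filterlim)
    then show ?thesis
    proof eventually_elim
      case (elim n)
      define x where "x = real (height n)"
      have x: "x > 0" using h_pos by (simp add: x_def)
      have ksx: "\<kappa> * s n * x > 0" using \<kappa>_pos s_pos[of n] x by simp
      have "real S * (1 / x) + 1 / (\<kappa> * s n) + (real S + 1) * (1 / (\<kappa> * s n * x)) \<le> \<delta>"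
        using elim by (simp add: s_def satur_def x_def)
      then have "(real S * (1 / x) + 1 / (\<kappa> * s n) + (real S + 1) * (1 / (\<kappa> * s n * x))) * (\<kappa> * s n * x)
          \<le> \<delta> * (\<kappa> * s n * x)" using ksx by (intro mult_right_mono) auto
      moreover have "(real S * (1 / x) + 1 / (\<kappa> * s n) + (real S + 1) * (1 / (\<kappa> * s n * x))) * (\<kappa> * s n * x)
          = \<kappa> * s n * real S + x + real S + 1"
        using \<kappa>_pos s_pos[of n] x by (simp add: field_simps)
      ultimately have err: "\<kappa> * s n * real S + x + real S + 1 \<le> \<delta> * (\<kappa> * s n * x)" by simp
      have "real (word_length (height n) * (height n + S)) \<le> (\<kappa> * s n + 1) * (x + real S)"
        using word_length_bounds(2)[of "height n"] unfolding of_nat_mult of_nat_add x_def s_def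
        by (intro mult_right_mono) auto
      also have "\<dots> \<le> (1 + \<delta>) * (\<kappa> * s n * x) - 1" using err by (simp add: algebra_simps)
      also have "(1 + \<delta>) * (\<kappa> * s n * x) = ((1 + \<delta>) * s n) * (s n powr (1 / \<beta>))"
        using x by (simp add: s_def x_def satur_root)
      also have "\<dots> \<le> real (N n) * (real (N n) powr (1 / \<beta>))"
      proof (intro mult_mono powr_mono2)
        have "1 * s n \<le> (1 + \<delta>) * s n" using \<delta> s_pos[of n] by (intro mult_right_mono) auto
        then show "s n \<le> real (N n)" using N(1)[of n] by simp
      qed (use N(1)[of n] s_pos[of n] \<beta>_pos in auto)
      also have "\<dots> = real (N n) powr \<alpha>" by (simp add: powr_\<alpha>)
      also have "\<dots> - 1 \<le> real (t (N n))" using t_ge[OF N_pos] .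
      finally show ?case by (simp only: of_nat_le_iff)
    qed
  qed
  have "p \<longlonglongrightarrow> (1 - 0) * 1"
    unfolding p_def
  proof (intro tendsto_mult tendsto_diff tendsto_const prob_tower_tendsto)
    have "filterlim (\<lambda>n. real (repetitions (height n))) at_top sequentially"
    proof (rule filterlim_at_top_mono)
      show "filterlim (\<lambda>n. \<kappa> * s n) at_top sequentially"
        using \<kappa>_pos s_top by (intro filterlim_tendsto_pos_mult_at_top[OF tendsto_const])
      show "\<forall>\<^sub>F n in sequentially. \<kappa> * s n \<le> real (repetitions (height n))"
      proof (intro always_eventually allI)
        show "\<kappa> * s n \<le> real (repetitions (height n))" for n
          using word_length_bounds(1)[of "height n"] by (simp add: s_def repetitions_def)
      qed
    qed
    then show "(\<lambda>n. 2 / real (repetitions (height n))) \<longlonglongrightarrow> 0"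
      by (intro tendsto_divide_0[OF tendsto_const] filterlim_at_top_imp_at_infinity)
  qed
  moreover have inv: "(\<lambda>n. 1 / s n) \<longlonglongrightarrow> 0"
    using s_top by (intro tendsto_divide_0[OF tendsto_const] filterlim_at_top_imp_at_infinity)
  \<comment> \<open>The desired inequality divided by \<open>s n\<close>. The last term absorbs the
    rounding of \<open>N n\<close>, with an absolute value since \<open>v - \<epsilon>\<close> may
    be negative.\<close>
  ultimately have "(\<lambda>n. p n * v - ln 2 * (1 / s n) - (v - \<epsilon>) * (1 + \<delta>) - \<bar>v - \<epsilon>\<bar> * (1 / s n))
      \<longlonglongrightarrow> (1 - 0) * 1 * v - ln 2 * 0 - (v - \<epsilon>) * (1 + \<delta>) - \<bar>v - \<epsilon>\<bar> * 0"
    by (intro tendsto_intros)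
  moreover have "(1 - 0) * 1 * v - ln 2 * 0 - (v - \<epsilon>) * (1 + \<delta>) - \<bar>v - \<epsilon>\<bar> * 0 > 0"
  proof -
    have "(1 - 0) * 1 * v - ln 2 * 0 - (v - \<epsilon>) * (1 + \<delta>) - \<bar>v - \<epsilon>\<bar> * 0 = \<epsilon> - \<delta> * v + \<epsilon> * \<delta>"
      by (simp add: algebra_simps)
    with \<delta>(2) mult_pos_pos[OF \<epsilon> \<delta>(1)] show ?thesis by linarith
  qed
  ultimately have "\<forall>\<^sub>F n in sequentially. p n * v - ln 2 * (1 / s n) - (v - \<epsilon>) * (1 + \<delta>) - \<bar>v - \<epsilon>\<bar> * (1 / s n) > 0"
    by (intro order_tendstoD(1))
  moreover have "\<forall>\<^sub>F n in sequentially. p n > 0"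
    using \<open>p \<longlonglongrightarrow> (1 - 0) * 1\<close> by (intro order_tendstoD(1)) auto
  ultimately have "\<forall>\<^sub>F n in sequentially. (v - \<epsilon>) * real (N n) \<le> name_entropy M T t floor_sym (N n)"
    using gaps crossed
  proof eventually_elim
    case (elim n)
    have "(v - \<epsilon>) * real (N n) \<le> (v - \<epsilon>) * ((1 + \<delta>) * s n) + \<bar>v - \<epsilon>\<bar>"
    proof -
      have "(v - \<epsilon>) * (real (N n) - (1 + \<delta>) * s n) \<le> \<bar>v - \<epsilon>\<bar> * 1"
        using N[of n] by (intro mult_mono) auto
      then show ?thesis by (simp add: algebra_simps)
    qed
    also have "\<dots> = s n * ((v - \<epsilon>) * (1 + \<delta>) + \<bar>v - \<epsilon>\<bar> * (1 / s n))"
      using s_pos[of n] by (simp add: field_simps)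
    also have "\<dots> \<le> s n * (p n * v - ln 2 * (1 / s n))"
      using elim(1) s_pos[of n] by (intro mult_left_mono) auto
    also have "\<dots> = p n * (v * s n) - ln 2" using s_pos[of n] by (simp add: field_simps)
    also have "\<dots> \<le> p n * (real (word_length (height n)) * ln (real S)) - ln 2"
    proof -
      have "v * s n = \<kappa> * s n * ln (real S)" using \<kappa>_ln by (simp add: algebra_simps)
      also have "\<dots> \<le> real (word_length (height n)) * ln (real S)"
        using word_length_bounds(1)[of "height n"] ln_S_pos by (intro mult_right_mono) (auto simp: s_def)
      finally show ?thesis using elim(2) by (intro diff_right_mono mult_left_mono) auto
    qed
    also have "\<dots> \<le> name_entropy M T t floor_sym (N n)"
      unfolding p_def using elim(3,4) N_pos[of n] by (intro name_entropy_ge) (auto simp: t_eq)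
    finally show ?case .
  qed
  then obtain n\<^sub>0 where n0: "\<And>n. n \<ge> n\<^sub>0 \<Longrightarrow> (v - \<epsilon>) * real (N n) \<le> name_entropy M T t floor_sym (N n)"
    by (auto simp: eventually_sequentially)
  show "\<exists>\<^sub>F N in sequentially. (v - \<epsilon>) * real N \<le> name_entropy M T t floor_sym N"
    unfolding frequently_sequentially
  proof
    fix k :: nat
    have "\<forall>\<^sub>F n in sequentially. s n \<ge> real k" using s_top by (simp add: filterlim_at_top)
    then obtain n where n: "n \<ge> n\<^sub>0" "s n \<ge> real k"
      using eventually_ge_at_top[of n\<^sub>0] by (metis (no_types, lifting) eventually_sequentially nle_le)
    have "1 * s n \<le> (1 + \<delta>) * s n" using \<delta> s_pos[of n] by (intro mult_right_mono) auto
    then have "k \<le> N n" using n(2) N(1)[of n] by linarith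
    with n0[OF n(1)] show "\<exists>N\<ge>k. (v - \<epsilon>) * real N \<le> name_entropy M T t floor_sym N" by blast
  qed
qed

end

lemma rank_one_system_with_entropy:
  assumes "\<beta> > 0" "\<alpha> = 1 + 1 / \<beta>" "\<And>n. n \<ge> 1 \<Longrightarrow> t n = nat \<lfloor>real n powr \<alpha>\<rfloor>" "v > 0"
  shows "\<exists>(M :: real measure) T. rank_one_system M T \<and> sequence_entropy M T t = ereal v"
proof -
  define S where "S = nat \<lceil>exp (4 * \<alpha> * v)\<rceil> + 2"
  have "exp (4 * \<alpha> * v) \<le> real S" unfolding S_def by linarith
  then have "ln (exp (4 * \<alpha> * v)) \<le> ln (real S)" by (intro ln_mono) auto
  then interpret power_sequence_parameters \<beta> \<alpha> v S t
    using assms by unfold_locales (auto simp: S_def)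
  show ?thesis using rank_one_system entropy_upper entropy_lower by (intro exI conjI antisym)
qed

theorem theorem1p9:
  fixes \<beta> \<alpha> C\<^sub>1 C\<^sub>2 :: real and t :: "nat \<Rightarrow> nat"
  assumes "\<beta> > 0"
    and "\<alpha> = 1 + 1 / \<beta>"
    and "\<And>n. n \<ge> 1 \<Longrightarrow> t n = nat \<lfloor>real n powr \<alpha>\<rfloor>"
    and "C\<^sub>1 = \<beta> / (1 + \<beta>)"
    and "C\<^sub>2 = (2 * \<beta>) powr (1 / (1 + \<beta>))"
  shows "(\<forall>m::real. m > 0 \<longrightarrow>
            (\<exists>(M :: real measure) T. rank_one_system M T \<and>
               0 < sequence_entropy M T t \<and> sequence_entropy M T t < ereal m)) \<and>
         (\<forall>L::nat. L \<ge> 2 \<longrightarrow>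
            (\<exists>(M :: real measure) T. rank_one_system M T \<and>
               ereal (C\<^sub>1 * ln (real L)) \<le> sequence_entropy M T t \<and>
               sequence_entropy M T t \<le> ereal (C\<^sub>2 * ln (real L))))"
proof (intro conjI allI impI)
  fix m :: real assume m: "m > 0"
  obtain M :: "real measure" and T where "rank_one_system M T" "sequence_entropy M T t = ereal (m / 2)"
    using rank_one_system_with_entropy[OF assms(1-3), of "m / 2"] m by auto
  with m show "\<exists>(M :: real measure) T. rank_one_system M T \<and>
      0 < sequence_entropy M T t \<and> sequence_entropy M T t < ereal m"
    by (intro exI[of _ M] exI[of _ T]) simp
next
  fix L :: nat assume L: "L \<ge> 2"
  then have lnL: "ln (real L) > 0" by simp
  have C1: "C\<^sub>1 > 0" using assms(1,4) by simp
  \<comment> \<open>For \<open>2 * \<beta> \<ge> 1\<close> the number 1 separates the constants.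
    Otherwise \<open>C\<^sub>1 \<le> \<beta> \<le> 2 * \<beta>\<close>, and lowering the exponent
    from 1 to \<open>1 / (1 + \<beta>)\<close> does not decrease a power with base below 1.\<close>
  have "C\<^sub>1 \<le> C\<^sub>2"
  proof (cases "2 * \<beta> \<ge> 1")
    case True
    have "C\<^sub>1 \<le> 1" using assms(1,4) by simp
    also have "1 \<le> C\<^sub>2" unfolding assms(5) using True assms(1) by (intro ge_one_powr_ge_zero) auto
    finally show ?thesis .
  next
    case False
    have "C\<^sub>1 \<le> \<beta> / 1" unfolding assms(4) using assms(1) by (intro divide_left_mono) auto
    also have "\<dots> \<le> (2 * \<beta>) powr 1" using assms(1) by simp
    also have "\<dots> \<le> C\<^sub>2" unfolding assms(5) using False assms(1) by (intro powr_mono') auto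
    finally show ?thesis .
  qed
  then have le: "C\<^sub>1 * ln (real L) \<le> C\<^sub>2 * ln (real L)" using lnL by (intro mult_right_mono) auto
  obtain M :: "real measure" and T where
    "rank_one_system M T" "sequence_entropy M T t = ereal (C\<^sub>1 * ln (real L))"
    using rank_one_system_with_entropy[OF assms(1-3), of "C\<^sub>1 * ln (real L)"] C1 lnL by auto
  with le show "\<exists>(M :: real measure) T. rank_one_system M T \<and>
      ereal (C\<^sub>1 * ln (real L)) \<le> sequence_entropy M T t \<and>
      sequence_entropy M T t \<le> ereal (C\<^sub>2 * ln (real L))"
    by (intro exI[of _ M] exI[of _ T]) simp
qed

end
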